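(* Let $m,d\in\mathbb N$ (with $m,d\ge1$) and let $\odot$ be an $m$-$d$-universal product. Then $\odot$ is Schoenberg if and only if the Schoenberg correspondence holds for $\odot$, i.e. if and only if for every $*$-$m$-faced dual semigroup $B$ and every linear map $\psi\colon B\to\mathbb C^d$: $$\psi\text{ is a restricted generating functional}\iff \exp_\odot(t\psi)\text{ is a restricted state for all }t>0.$$
   Context: **Algebras.** "Algebra" means associative, not necessarily unital algebra over $\mathbb C$; $\sqcup$ is the free product (coproduct) of such algebras, and $\{0\}$ is the trivial algebra. An $m$-faced algebra is an algebra $A$ with subalgebras $A^1,\dots,A^m$ (the faces) such that the canonical homomorphism $A^1\sqcup\dots\sqcup A^m\to A$ is an isomorphism. An $m$-faced homomorphism $j\colon A\to B$ is an algebra homomorphism with $j(A^k)\subset B^k$ for all $k$. The free product $A\sqcup B$ of $m$-faced algebras is $m$-faced with faces $(A\sqcup B)^k=A^k\sqcup B^k$. The unitization $\mathds{1}A$ is the unital algebra $\mathbb C1\oplus A$ containing $A$ as an ideal of codimension $1$ (even if $A$ already has a unit). **Dual semigroups.** An $m$-faced dual semigroup is an $m$-faced algebra $B$ with an $m$-faced homomorphism $\Lambda\colon B\to B\sqcup B$ satisfying $(\Lambda\sqcup\mathrm{id})\Lambda=(\mathrm{id}\sqcup\Lambda)\Lambda$ and $(\mathrm{id}\sqcup 0)\Lambda=\mathrm{id}=(0\sqcup\mathrm{id})\Lambda$ (identifying $B\sqcup\{0\}=B=\{0\}\sqcup B$, where $0\colon B\to\{0\}$). **Universal products.** An $m$-$d$-functional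 is a linear map $\varphi\colon A\to\mathbb C^d$ on an $m$-faced algebra $A$. An $m$-$d$-universal product $\odot$ assigns to all $m$-$d$-functionals $\varphi_1\colon A_1\to\mathbb C^d$, $\varphi_2\colon A_2\to\mathbb C^d$ a linear map $\varphi_1\odot\varphi_2\colon A_1\sqcup A_2\to\mathbb C^d$ such that (with the canonical identifications for $\sqcup$): - $(\varphi_1\circ j_1)\odot(\varphi_2\circ j_2)=(\varphi_1\odot\varphi_2)\circ(j_1\sqcup j_2)$ for all $m$-faced homomorphisms $j_i\colon B_i\to A_i$; - $(\varphi_1\odot\varphi_2)\odot\varphi_3=\varphi_1\odot(\varphi_2\odot\varphi_3)$; - $\varphi\odot 0=\varphi=0\odot\varphi$ for the functional $0\colon\{0\}\to\mathbb C^d$ (equivalently, $(\varphi_1\odot\varphi_2)\restriction A_i=\varphi_i$). **Convolution exponential.** For a linear map $\varphi=(\varphi_1,\dots,\varphi_d)\colon A\to\mathbb C^d$, its transpose is $\varphi^{\mathrm{tr}}\colon A^{\oplus d}\to\mathbb C$, $\varphi^{\mathrm{tr}}(a_1,\dots,a_d)=\sum_{k=1}^d\varphi_k(a_k)$; $\mathrm{tr}$ also denotes the inverse bijection $(A^{\oplus d})'\to\{\text{linear maps }A\to\mathbb C^d\}$. Let $S(V)$ be the (unital) symmetric tensor algebra over a vector space $V$; for a linear functional $f$ on $V$, $S(f)\colon S(V)\to\mathbb C$ is the unital algebra homomorphism extending $f$, and for a linear map $T\colon V\to W$, $S(T)\colon S(V)\to S(W)$ is the induced unital homomorphism. Let $D(f)\colon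 S(V)\to\mathbb C$ be the linear functional with $D(f)(1)=0$, $D(f)(v)=f(v)$ for $v\in V$, and $D(f)(v_1\cdots v_n)=0$ for $v_i\in V$, $n\geq 2$. It is a known fact that for an $m$-$d$-universal product $\odot$ and $m$-faced algebras $A_1,A_2$ there is a unital algebra homomorphism $\sigma^\odot_{A_1,A_2}\colon S((A_1\sqcup A_2)^{\oplus d})\to S(A_1^{\oplus d})\otimes S(A_2^{\oplus d})$ with $$S\bigl((\varphi_1\odot\varphi_2)^{\mathrm{tr}}\bigr)=\bigl(S(\varphi_1^{\mathrm{tr}})\otimes S(\varphi_2^{\mathrm{tr}})\bigr)\circ\sigma^\odot_{A_1,A_2}$$ for all linear $\varphi_i\colon A_i\to\mathbb C^d$ (this identity determines $\sigma^\odot_{A_1,A_2}$ uniquely). For an $m$-faced dual semigroup $(B,\Lambda)$, the algebra $S(B^{\oplus d})$ becomes a bialgebra, denoted $\mathcal L^\odot(B)$, with comultiplication $\Delta=\sigma^\odot_{B,B}\circ S(\Lambda^{\oplus d})$ and counit $\delta=S(0)$. Linear functionals on it are convolved by $f*g=(f\otimes g)\circ\Delta$ (with unit $\delta=f^{*0}$), and $\exp_{\mathcal L^\odot(B)}(f)(c)=\sum_{n\ge0}\frac{1}{n!}f^{*n}(c)$, which converges absolutely for each $c\in S(B^{\oplus d})$. For linear $\psi\colon B\to\mathbb C^d$, the convolution exponential $\exp_\odot(\psi)\colon B\to\mathbb C^d$ is $$\exp_\odot(\psi)=\bigl(\exp_{\mathcal L^\odot(B)}(D(\psi^{\mathrm{tr}}))\restriction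 B^{\oplus d}\bigr)^{\mathrm{tr}}.$$ **Positivity.** An $m$-faced $*$-algebra is an $m$-faced algebra with an involution such that the faces are $*$-subalgebras; free products of $*$-algebras carry the unique involution extending those of the factors, and unitizations of $*$-algebras carry the natural involution. A $*$-$m$-faced dual semigroup is an $m$-faced dual semigroup with an involution such that the faces are $*$-subalgebras and $\Lambda$ is a $*$-homomorphism. For $x\in\mathbb C^d$, $x\ge0$ means that all components are non-negative reals. A linear map $\varphi\colon A\to\mathbb C^d$ on a $*$-algebra $A$ is - a restricted state if its unital extension $\mathds{1}\varphi\colon\mathds{1}A\to\mathbb C^d$ (with $1\mapsto(1,\dots,1)$) satisfies $\mathds{1}\varphi(a^*a)\ge0$ for all $a\in\mathds{1}A$; - a restricted generating functional if it is hermitian ($\varphi(a^* )=\overline{\varphi(a)}$ componentwise) and $\varphi(a^*a)\ge0$ for all $a\in A$. An $m$-$d$-universal product $\odot$ is Schoenberg if $\exp_\odot(\psi)$ is a restricted state for every ($d$-valued) restricted generating functional $\psi$ on a $*$-$m$-faced dual semigroup. *)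

theory Defs
  imports
    Complex_Main
    "HOL-Library.Multiset"
    "HOL-Library.Poly_Mapping"
    "HOL-Library.Nonpos_Ints"
    "HOL-Analysis.Finite_Cartesian_Product"
    "HOL-Algebra.QuotRing"
    "HOL-Algebra.Module"
begin

text \<open>
  Algebras are records with a carrier inside an arbitrary type \<^typ>\<open>'u\<close>, which plays the role of
  a universe: all statements below about all algebras range over the algebras carried by subsets
  of \<^typ>\<open>'u\<close>, and \<^typ>\<open>'u\<close> is a type variable of the final theorem.
  The universe is closed (up to isomorphism) under finite free products without any assumption on
  its size: a nonzero complex vector space has at least the cardinality of the continuum, so
  a free product of finitely many algebras is either zero or as large as its largest
  factor. Hence the coproducts of the algebras on \<^typ>\<open>'u\<close> are the usual free products.

  The finite index types \<^typ>\<open>'m\<close> and \<^typ>\<open>'d\<close> stand for the numbers \<open>m \<ge> 1\<close> of faces and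
  \<open>d \<ge> 1\<close> of components.
\<close>


section \<open>Algebras, free products, faces\<close>

definition complex_ring :: "complex ring" where
  "complex_ring = \<lparr>carrier = UNIV, mult = (*), one = 1, zero = 0, add = (+)\<rparr>"

text \<open>Not necessarily unital: the field \<^const>\<open>one\<close> of the record is ignored.\<close>

definition nu_algebra :: "(complex, 'a, 'x) module_scheme \<Rightarrow> bool" where
  "nu_algebra A \<longleftrightarrow>
     Module.module complex_ring A \<and>
     (\<forall>x\<in>carrier A. \<forall>y\<in>carrier A. x \<otimes>\<^bsub>A\<^esub> y \<in> carrier A) \<and>
     (\<forall>x\<in>carrier A. \<forall>y\<in>carrier A. \<forall>z\<in>carrier A.
        (x \<otimes>\<^bsub>A\<^esub> y) \<otimes>\<^bsub>A\<^esub> z = x \<otimes>\<^bsub>A\<^esub> (y \<otimes>\<^bsub>A\<^esub> z) \<and>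
        (x \<oplus>\<^bsub>A\<^esub> y) \<otimes>\<^bsub>A\<^esub> z = x \<otimes>\<^bsub>A\<^esub> z \<oplus>\<^bsub>A\<^esub> y \<otimes>\<^bsub>A\<^esub> z \<and>
        z \<otimes>\<^bsub>A\<^esub> (x \<oplus>\<^bsub>A\<^esub> y) = z \<otimes>\<^bsub>A\<^esub> x \<oplus>\<^bsub>A\<^esub> z \<otimes>\<^bsub>A\<^esub> y) \<and>
     (\<forall>c. \<forall>x\<in>carrier A. \<forall>y\<in>carrier A.
        (c \<odot>\<^bsub>A\<^esub> x) \<otimes>\<^bsub>A\<^esub> y = c \<odot>\<^bsub>A\<^esub> (x \<otimes>\<^bsub>A\<^esub> y) \<and>
        x \<otimes>\<^bsub>A\<^esub> (c \<odot>\<^bsub>A\<^esub> y) = c \<odot>\<^bsub>A\<^esub> (x \<otimes>\<^bsub>A\<^esub> y))"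

definition alg_hom ::
  "(complex, 'a, 'x) module_scheme \<Rightarrow> (complex, 'b, 'y) module_scheme \<Rightarrow> ('a \<Rightarrow> 'b) \<Rightarrow> bool" where
  "alg_hom A B h \<longleftrightarrow>
     (\<forall>x\<in>carrier A. h x \<in> carrier B) \<and>
     (\<forall>x\<in>carrier A. \<forall>y\<in>carrier A. h (x \<oplus>\<^bsub>A\<^esub> y) = h x \<oplus>\<^bsub>B\<^esub> h y \<and> h (x \<otimes>\<^bsub>A\<^esub> y) = h x \<otimes>\<^bsub>B\<^esub> h y) \<and>
     (\<forall>c. \<forall>x\<in>carrier A. h (c \<odot>\<^bsub>A\<^esub> x) = c \<odot>\<^bsub>B\<^esub> h x)"

definition subalg :: "'a set \<Rightarrow> (complex, 'a, 'x) module_scheme \<Rightarrow> bool" where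
  "subalg S A \<longleftrightarrow>
     S \<subseteq> carrier A \<and> \<zero>\<^bsub>A\<^esub> \<in> S \<and>
     (\<forall>x\<in>S. \<forall>y\<in>S. x \<oplus>\<^bsub>A\<^esub> y \<in> S \<and> x \<otimes>\<^bsub>A\<^esub> y \<in> S) \<and>
     (\<forall>c. \<forall>x\<in>S. c \<odot>\<^bsub>A\<^esub> x \<in> S)"

definition subalg_gen :: "(complex, 'a, 'x) module_scheme \<Rightarrow> 'a set \<Rightarrow> 'a set" where
  "subalg_gen A S = \<Inter>{T. subalg T A \<and> S \<subseteq> T}"

definition is_coproduct ::
  "('i \<Rightarrow> (complex, 'u, 'x) module_scheme) \<Rightarrow> (complex, 'u, 'y) module_scheme \<Rightarrow>
     ('i \<Rightarrow> 'u \<Rightarrow> 'u) \<Rightarrow> bool" where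
  "is_coproduct A C \<iota> \<longleftrightarrow>
     nu_algebra C \<and> (\<forall>i. alg_hom (A i) C (\<iota> i)) \<and>
     (\<forall>(D :: (complex, 'u) module) f.
        nu_algebra D \<and> (\<forall>i. alg_hom (A i) D (f i)) \<longrightarrow>
        (\<exists>h. alg_hom C D h \<and> (\<forall>i. \<forall>a\<in>carrier (A i). h (\<iota> i a) = f i a) \<and>
           (\<forall>h'. alg_hom C D h' \<and> (\<forall>i. \<forall>a\<in>carrier (A i). h' (\<iota> i a) = f i a) \<longrightarrow>
              (\<forall>x\<in>carrier C. h' x = h x))))"

record ('u, 'm) faced = "(complex, 'u) module" +
  face :: "'m \<Rightarrow> 'u set"

text \<open>
  The canonical homomorphism from the free product of the faces to the algebra is an isomorphism
  iff the inclusions of the faces exhibit the algebra as their coproduct.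
\<close>

definition faced_algebra :: "('u, 'm::finite) faced \<Rightarrow> bool" where
  "faced_algebra A \<longleftrightarrow>
     nu_algebra A \<and> (\<forall>k. subalg (face A k) A) \<and>
     is_coproduct (\<lambda>k. A\<lparr>carrier := face A k\<rparr>) A (\<lambda>k x. x)"

definition faced_hom :: "('u, 'm) faced \<Rightarrow> ('u, 'm) faced \<Rightarrow> ('u \<Rightarrow> 'u) \<Rightarrow> bool" where
  "faced_hom A B j \<longleftrightarrow> alg_hom A B j \<and> (\<forall>k. j ` face A k \<subseteq> face B k)"

text \<open>A fixed choice of the coproduct of two algebras, with its two canonical embeddings.\<close>

definition coproduct_choice ::
  "('u, 'm) faced \<Rightarrow> ('u, 'm) faced \<Rightarrow> (complex, 'u) module \<times> ('u \<Rightarrow> 'u) \<times> ('u \<Rightarrow> 'u)" where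
  "coproduct_choice A B =
     (SOME (C, i, j). is_coproduct (case_bool A B) C (case_bool i j))"

definition inl :: "('u, 'm) faced \<Rightarrow> ('u, 'm) faced \<Rightarrow> 'u \<Rightarrow> 'u" where
  "inl A B = fst (snd (coproduct_choice A B))"

definition inr :: "('u, 'm) faced \<Rightarrow> ('u, 'm) faced \<Rightarrow> 'u \<Rightarrow> 'u" where
  "inr A B = snd (snd (coproduct_choice A B))"

definition free_product :: "('u, 'm) faced \<Rightarrow> ('u, 'm) faced \<Rightarrow> ('u, 'm) faced"
    (infixl "\<squnion>\<^sub>f" 65) where
  "A \<squnion>\<^sub>f B =
     (let C = fst (coproduct_choice A B)
      in module.extend C (faced.fields
           (\<lambda>k. subalg_gen C (inl A B ` face A k \<union> inr A B ` face B k))))"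

text \<open>The homomorphism determined by \<open>f : A \<rightarrow> C\<close> and \<open>g : B \<rightarrow> C\<close>, unique on the carrier.\<close>

definition copair ::
  "('u, 'm) faced \<Rightarrow> ('u, 'm) faced \<Rightarrow> ('u, 'm) faced \<Rightarrow> ('u \<Rightarrow> 'u) \<Rightarrow> ('u \<Rightarrow> 'u) \<Rightarrow> 'u \<Rightarrow> 'u" where
  "copair A B C f g =
     (SOME h. alg_hom (A \<squnion>\<^sub>f B) C h \<and>
        (\<forall>a\<in>carrier A. h (inl A B a) = f a) \<and> (\<forall>b\<in>carrier B. h (inr A B b) = g b))"

text \<open>\<open>j\<^sub>1 \<squnion> j\<^sub>2 : B\<^sub>1 \<squnion> B\<^sub>2 \<rightarrow> A\<^sub>1 \<squnion> A\<^sub>2\<close>\<close>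

definition fp_map ::
  "('u, 'm) faced \<Rightarrow> ('u, 'm) faced \<Rightarrow> ('u, 'm) faced \<Rightarrow> ('u, 'm) faced \<Rightarrow>
     ('u \<Rightarrow> 'u) \<Rightarrow> ('u \<Rightarrow> 'u) \<Rightarrow> 'u \<Rightarrow> 'u" where
  "fp_map B1 B2 A1 A2 j1 j2 =
     copair B1 B2 (A1 \<squnion>\<^sub>f A2) (\<lambda>b. inl A1 A2 (j1 b)) (\<lambda>b. inr A1 A2 (j2 b))"

text \<open>The canonical isomorphism \<open>(A\<^sub>1 \<squnion> A\<^sub>2) \<squnion> A\<^sub>3 \<rightarrow> A\<^sub>1 \<squnion> (A\<^sub>2 \<squnion> A\<^sub>3)\<close>\<close>

definition fp_assoc ::
  "('u, 'm) faced \<Rightarrow> ('u, 'm) faced \<Rightarrow> ('u, 'm) faced \<Rightarrow> 'u \<Rightarrow> 'u" where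
  "fp_assoc A1 A2 A3 =
     copair (A1 \<squnion>\<^sub>f A2) A3 (A1 \<squnion>\<^sub>f (A2 \<squnion>\<^sub>f A3))
       (copair A1 A2 (A1 \<squnion>\<^sub>f (A2 \<squnion>\<^sub>f A3))
          (inl A1 (A2 \<squnion>\<^sub>f A3)) (\<lambda>a. inr A1 (A2 \<squnion>\<^sub>f A3) (inl A2 A3 a)))
       (\<lambda>a. inr A1 (A2 \<squnion>\<^sub>f A3) (inr A2 A3 a))"

definition zero_alg :: "('u, 'm) faced" where
  "zero_alg = \<lparr>carrier = {undefined}, mult = \<lambda>_ _. undefined, one = undefined, zero = undefined,
     add = \<lambda>_ _. undefined, smult = \<lambda>_ _. undefined, face = \<lambda>_. {undefined}\<rparr>"

definition zero_hom :: "'u \<Rightarrow> 'u" where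
  "zero_hom = (\<lambda>_. undefined)"


section \<open>Dual semigroups\<close>

text \<open>\<open>B\<close> is identified with \<open>B \<squnion> {0}\<close> and \<open>{0} \<squnion> B\<close> along the canonical embeddings.\<close>

definition dual_semigroup :: "('u, 'm::finite) faced \<Rightarrow> ('u \<Rightarrow> 'u) \<Rightarrow> bool" where
  "dual_semigroup B \<Lambda> \<longleftrightarrow>
     faced_algebra B \<and> faced_hom B (B \<squnion>\<^sub>f B) \<Lambda> \<and>
     (\<forall>b\<in>carrier B.
        fp_assoc B B B (fp_map B B (B \<squnion>\<^sub>f B) B \<Lambda> (\<lambda>x. x) (\<Lambda> b)) =
          fp_map B B B (B \<squnion>\<^sub>f B) (\<lambda>x. x) \<Lambda> (\<Lambda> b) \<and>
        fp_map B B B zero_alg (\<lambda>x. x) zero_hom (\<Lambda> b) = inl B zero_alg b \<and>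
        fp_map B B zero_alg B zero_hom (\<lambda>x. x) (\<Lambda> b) = inr zero_alg B b)"


section \<open>Universal products\<close>

definition linear_map :: "(complex, 'a, 'x) module_scheme \<Rightarrow> ('a \<Rightarrow> complex ^ 'd) \<Rightarrow> bool" where
  "linear_map A \<phi> \<longleftrightarrow>
     (\<forall>x\<in>carrier A. \<forall>y\<in>carrier A. \<phi> (x \<oplus>\<^bsub>A\<^esub> y) = \<phi> x + \<phi> y) \<and>
     (\<forall>c. \<forall>x\<in>carrier A. \<phi> (c \<odot>\<^bsub>A\<^esub> x) = c *s \<phi> x)"

text \<open>
  \<open>P A\<^sub>1 \<phi>\<^sub>1 A\<^sub>2 \<phi>\<^sub>2\<close> is the product of the functionals \<open>\<phi>\<^sub>i\<close> on \<open>A\<^sub>i\<close>. Only values on carriers are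
  meaningful; by the naturality axiom (with identities for \<open>j\<^sub>i\<close>) the values of the \<open>\<phi>\<^sub>i\<close> outside
  of the carriers are irrelevant.
\<close>

type_synonym ('u, 'm, 'd) functional_product =
  "('u, 'm) faced \<Rightarrow> ('u \<Rightarrow> complex ^ 'd) \<Rightarrow> ('u, 'm) faced \<Rightarrow> ('u \<Rightarrow> complex ^ 'd) \<Rightarrow>
     'u \<Rightarrow> complex ^ 'd"

definition universal_product :: "('u, 'm::finite, 'd::finite) functional_product \<Rightarrow> bool" where
  "universal_product P \<longleftrightarrow>
     (\<forall>A1 A2 \<phi>1 \<phi>2.
        faced_algebra A1 \<and> faced_algebra A2 \<and> linear_map A1 \<phi>1 \<and> linear_map A2 \<phi>2 \<longrightarrow>
        linear_map (A1 \<squnion>\<^sub>f A2) (P A1 \<phi>1 A2 \<phi>2)) \<and>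
     (\<forall>A1 A2 B1 B2 \<phi>1 \<phi>2 \<psi>1 \<psi>2 j1 j2.
        faced_algebra A1 \<and> faced_algebra A2 \<and> faced_algebra B1 \<and> faced_algebra B2 \<and>
        linear_map A1 \<phi>1 \<and> linear_map A2 \<phi>2 \<and> faced_hom B1 A1 j1 \<and> faced_hom B2 A2 j2 \<and>
        (\<forall>b\<in>carrier B1. \<psi>1 b = \<phi>1 (j1 b)) \<and> (\<forall>b\<in>carrier B2. \<psi>2 b = \<phi>2 (j2 b)) \<longrightarrow>
        (\<forall>x\<in>carrier (B1 \<squnion>\<^sub>f B2).
           P B1 \<psi>1 B2 \<psi>2 x = P A1 \<phi>1 A2 \<phi>2 (fp_map B1 B2 A1 A2 j1 j2 x))) \<and>
     (\<forall>A1 A2 A3 \<phi>1 \<phi>2 \<phi>3.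
        faced_algebra A1 \<and> faced_algebra A2 \<and> faced_algebra A3 \<and>
        linear_map A1 \<phi>1 \<and> linear_map A2 \<phi>2 \<and> linear_map A3 \<phi>3 \<longrightarrow>
        (\<forall>x\<in>carrier ((A1 \<squnion>\<^sub>f A2) \<squnion>\<^sub>f A3).
           P (A1 \<squnion>\<^sub>f A2) (P A1 \<phi>1 A2 \<phi>2) A3 \<phi>3 x =
           P A1 \<phi>1 (A2 \<squnion>\<^sub>f A3) (P A2 \<phi>2 A3 \<phi>3) (fp_assoc A1 A2 A3 x))) \<and>
     (\<forall>A \<phi>. faced_algebra A \<and> linear_map A \<phi> \<longrightarrow>
        (\<forall>a\<in>carrier A.
           P A \<phi> zero_alg (\<lambda>_. 0) (inl A zero_alg a) = \<phi> a \<and>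
           P zero_alg (\<lambda>_. 0) A \<phi> (inr zero_alg A a) = \<phi> a))"


section \<open>Symmetric tensor algebras and tensor products\<close>

text \<open>
  Both are presented as quotients of monoid algebras: \<open>S(V)\<close> is the polynomial ring with one
  variable for each vector (the monoid algebra of the finite multisets in \<open>V\<close>) modulo the linear
  relations, and \<open>S \<otimes> T\<close> is the vector space with basis \<open>S \<times> T\<close> modulo the bilinear relations.
  In the latter, pure tensors multiply componentwise, so the subspace spanned by the bilinear
  relations is the ideal generated by them.
\<close>

definition monoid_alg :: "('a, 'x) monoid_scheme \<Rightarrow> (complex, 'a \<Rightarrow>\<^sub>0 complex) module" where
  "monoid_alg M =
     \<lparr>carrier = {p. Poly_Mapping.keys p \<subseteq> carrier M},
      mult = (\<lambda>p q. \<Sum>x\<in>Poly_Mapping.keys p. \<Sum>y\<in>Poly_Mapping.keys q.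
                Poly_Mapping.single (x \<otimes>\<^bsub>M\<^esub> y) (Poly_Mapping.lookup p x * Poly_Mapping.lookup q y)),
      one = Poly_Mapping.single \<one>\<^bsub>M\<^esub> 1, zero = 0, add = (+),
      smult = (\<lambda>c. Poly_Mapping.map ((*) c))\<rparr>"

text \<open>The quotient by the ideal generated by \<open>R\<close>; \<^const>\<open>FactRing\<close> with scalar multiplication.\<close>

definition quot_alg :: "(complex, 'a) module \<Rightarrow> 'a set \<Rightarrow> (complex, 'a set) module" where
  "quot_alg A R =
     ring.extend (A Quot (Idl\<^bsub>A\<^esub> R))
       (module.fields (\<lambda>c X. \<Union>x\<in>X. (Idl\<^bsub>A\<^esub> R) +>\<^bsub>A\<^esub> (c \<odot>\<^bsub>A\<^esub> x)))"

definition lin_ext :: "('a \<Rightarrow> complex) \<Rightarrow> ('a \<Rightarrow>\<^sub>0 complex) \<Rightarrow> complex" where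
  "lin_ext f p = (\<Sum>x\<in>Poly_Mapping.keys p. Poly_Mapping.lookup p x * f x)"

definition multisets_in :: "'v set \<Rightarrow> 'v multiset monoid" where
  "multisets_in V = \<lparr>carrier = {M. set_mset M \<subseteq> V}, mult = (+), one = {#}\<rparr>"

definition sym_var :: "'v \<Rightarrow> ('v multiset \<Rightarrow>\<^sub>0 complex)" where
  "sym_var v = Poly_Mapping.single {#v#} 1"

definition sym_rels :: "(complex, 'v, 'x) module_scheme \<Rightarrow> ('v multiset \<Rightarrow>\<^sub>0 complex) set" where
  "sym_rels V =
     {sym_var (v \<oplus>\<^bsub>V\<^esub> w) - (sym_var v + sym_var w) |v w. v \<in> carrier V \<and> w \<in> carrier V} \<union>
     {sym_var (c \<odot>\<^bsub>V\<^esub> v) - Poly_Mapping.map ((*) c) (sym_var v) |c v. v \<in> carrier V}"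

type_synonym 'v sym = "('v multiset \<Rightarrow>\<^sub>0 complex) set"

definition Sym :: "(complex, 'v, 'x) module_scheme \<Rightarrow> (complex, 'v sym) module" where
  "Sym V = quot_alg (monoid_alg (multisets_in (carrier V))) (sym_rels V)"

definition sym_class :: "(complex, 'v, 'x) module_scheme \<Rightarrow> ('v multiset \<Rightarrow>\<^sub>0 complex) \<Rightarrow> 'v sym" where
  "sym_class V p =
     (let A = monoid_alg (multisets_in (carrier V)) in (Idl\<^bsub>A\<^esub> (sym_rels V)) +>\<^bsub>A\<^esub> p)"

text \<open>The canonical embedding \<open>V \<rightarrow> S(V)\<close>\<close>

definition sym_emb :: "(complex, 'v, 'x) module_scheme \<Rightarrow> 'v \<Rightarrow> 'v sym" where
  "sym_emb V v = sym_class V (sym_var v)"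

text \<open>
  Functionals on a quotient are given on representatives; for linear arguments, the values do
  not depend on the representative, so that the image of a coset is a singleton.
  \<open>sym_fun f\<close> is the homomorphism \<open>S(f)\<close>, and \<open>sym_der f\<close> is \<open>D(f)\<close>.
\<close>

definition sym_fun :: "('v \<Rightarrow> complex) \<Rightarrow> 'v sym \<Rightarrow> complex" where
  "sym_fun f X = the_elem (lin_ext (\<lambda>M. \<Prod>v\<in>#M. f v) ` X)"

definition sym_der :: "('v \<Rightarrow> complex) \<Rightarrow> 'v sym \<Rightarrow> complex" where
  "sym_der f X = the_elem (lin_ext (\<lambda>M. if size M = 1 then \<Prod>v\<in>#M. f v else 0) ` X)"

text \<open>\<open>S(T) : S(V) \<rightarrow> S(W)\<close> for linear \<open>T : V \<rightarrow> W\<close>\<close>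

definition sym_map :: "(complex, 'w, 'x) module_scheme \<Rightarrow> ('v \<Rightarrow> 'w) \<Rightarrow> 'v sym \<Rightarrow> 'w sym" where
  "sym_map W T X =
     (\<Union>p\<in>X. sym_class W
        (\<Sum>M\<in>Poly_Mapping.keys p. Poly_Mapping.single (image_mset T M) (Poly_Mapping.lookup p M)))"

definition pure :: "'a \<Rightarrow> 'b \<Rightarrow> ('a \<times> 'b \<Rightarrow>\<^sub>0 complex)" where
  "pure x y = Poly_Mapping.single (x, y) 1"

definition tensor_rels ::
  "(complex, 'a) module \<Rightarrow> (complex, 'b) module \<Rightarrow> ('a \<times> 'b \<Rightarrow>\<^sub>0 complex) set" where
  "tensor_rels S T =
     {pure (x \<oplus>\<^bsub>S\<^esub> x') y - (pure x y + pure x' y) |x x' y.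
        x \<in> carrier S \<and> x' \<in> carrier S \<and> y \<in> carrier T} \<union>
     {pure x (y \<oplus>\<^bsub>T\<^esub> y') - (pure x y + pure x y') |x y y'.
        x \<in> carrier S \<and> y \<in> carrier T \<and> y' \<in> carrier T} \<union>
     {pure (c \<odot>\<^bsub>S\<^esub> x) y - Poly_Mapping.map ((*) c) (pure x y) |c x y.
        x \<in> carrier S \<and> y \<in> carrier T} \<union>
     {pure x (c \<odot>\<^bsub>T\<^esub> y) - Poly_Mapping.map ((*) c) (pure x y) |c x y.
        x \<in> carrier S \<and> y \<in> carrier T}"

definition tensor ::
  "(complex, 'a) module \<Rightarrow> (complex, 'b) module \<Rightarrow> (complex, ('a \<times> 'b \<Rightarrow>\<^sub>0 complex) set) module"
  where "tensor S T = quot_alg (monoid_alg (S \<times>\<times> T)) (tensor_rels S T)"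

text \<open>\<open>f \<otimes> g\<close> for linear functionals \<open>f\<close>, \<open>g\<close>\<close>

definition tensor_fun ::
  "('a \<Rightarrow> complex) \<Rightarrow> ('b \<Rightarrow> complex) \<Rightarrow> ('a \<times> 'b \<Rightarrow>\<^sub>0 complex) set \<Rightarrow> complex" where
  "tensor_fun f g X = the_elem (lin_ext (\<lambda>(x, y). f x * g y) ` X)"

definition unital_alg_hom ::
  "(complex, 'a) module \<Rightarrow> (complex, 'b) module \<Rightarrow> ('a \<Rightarrow> 'b) \<Rightarrow> bool" where
  "unital_alg_hom S T h \<longleftrightarrow> alg_hom S T h \<and> h \<one>\<^bsub>S\<^esub> = \<one>\<^bsub>T\<^esub>"


section \<open>Convolution exponential\<close>

text \<open>\<open>A\<^sup>\<oplus>\<^sup>d\<close> as a vector space; \<^const>\<open>mult\<close> and \<^const>\<open>one\<close> are not used.\<close>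

definition dsum :: "(complex, 'a, 'x) module_scheme \<Rightarrow> (complex, 'a ^ 'd) module" where
  "dsum A =
     \<lparr>carrier = {a. \<forall>k. a $ k \<in> carrier A}, mult = undefined, one = undefined,
      zero = (\<chi> k. \<zero>\<^bsub>A\<^esub>), add = (\<lambda>a b. \<chi> k. a $ k \<oplus>\<^bsub>A\<^esub> b $ k),
      smult = (\<lambda>c a. \<chi> k. c \<odot>\<^bsub>A\<^esub> a $ k)\<rparr>"

definition transp :: "('a \<Rightarrow> complex ^ 'd) \<Rightarrow> 'a ^ 'd \<Rightarrow> complex" where
  "transp \<phi> a = (\<Sum>k\<in>UNIV. \<phi> (a $ k) $ k)"

definition inv_transp ::
  "(complex, 'a, 'x) module_scheme \<Rightarrow> ('a ^ 'd \<Rightarrow> complex) \<Rightarrow> 'a \<Rightarrow> complex ^ 'd" where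
  "inv_transp A F a = (\<chi> k. F (\<chi> i. if i = k then a else \<zero>\<^bsub>A\<^esub>))"

definition is_sigma ::
  "('u, 'm::finite, 'd::finite) functional_product \<Rightarrow> ('u, 'm) faced \<Rightarrow> ('u, 'm) faced \<Rightarrow>
     (('u ^ 'd) sym \<Rightarrow> (('u ^ 'd) sym \<times> ('u ^ 'd) sym \<Rightarrow>\<^sub>0 complex) set) \<Rightarrow> bool" where
  "is_sigma P A1 A2 s \<longleftrightarrow>
     unital_alg_hom (Sym (dsum (A1 \<squnion>\<^sub>f A2))) (tensor (Sym (dsum A1)) (Sym (dsum A2))) s \<and>
     (\<forall>\<phi>1 \<phi>2. linear_map A1 \<phi>1 \<and> linear_map A2 \<phi>2 \<longrightarrow>
        (\<forall>x\<in>carrier (Sym (dsum (A1 \<squnion>\<^sub>f A2)) :: (complex, ('u ^ 'd) sym) module).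
           sym_fun (transp (P A1 \<phi>1 A2 \<phi>2)) x =
           tensor_fun (sym_fun (transp \<phi>1)) (sym_fun (transp \<phi>2)) (s x)))"

text \<open>For a universal product, such a homomorphism exists, and it is unique on the carrier.\<close>

definition sigma ::
  "('u, 'm::finite, 'd::finite) functional_product \<Rightarrow> ('u, 'm) faced \<Rightarrow> ('u, 'm) faced \<Rightarrow>
     ('u ^ 'd) sym \<Rightarrow> (('u ^ 'd) sym \<times> ('u ^ 'd) sym \<Rightarrow>\<^sub>0 complex) set" where
  "sigma P A1 A2 = (SOME s. is_sigma P A1 A2 s)"

definition comult ::
  "('u, 'm::finite, 'd::finite) functional_product \<Rightarrow> ('u, 'm) faced \<Rightarrow> ('u \<Rightarrow> 'u) \<Rightarrow>
     ('u ^ 'd) sym \<Rightarrow> (('u ^ 'd) sym \<times> ('u ^ 'd) sym \<Rightarrow>\<^sub>0 complex) set" where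
  "comult P B \<Lambda> x =
     sigma P B B (sym_map (dsum (B \<squnion>\<^sub>f B)) (\<lambda>b. \<chi> k. \<Lambda> (b $ k)) x)"

definition convolve ::
  "('u, 'm::finite, 'd::finite) functional_product \<Rightarrow> ('u, 'm) faced \<Rightarrow> ('u \<Rightarrow> 'u) \<Rightarrow>
     (('u ^ 'd) sym \<Rightarrow> complex) \<Rightarrow> (('u ^ 'd) sym \<Rightarrow> complex) \<Rightarrow> ('u ^ 'd) sym \<Rightarrow> complex" where
  "convolve P B \<Lambda> f g x = tensor_fun f g (comult P B \<Lambda> x)"

primrec conv_power ::
  "('u, 'm::finite, 'd::finite) functional_product \<Rightarrow> ('u, 'm) faced \<Rightarrow> ('u \<Rightarrow> 'u) \<Rightarrow>
     (('u ^ 'd) sym \<Rightarrow> complex) \<Rightarrow> nat \<Rightarrow> ('u ^ 'd) sym \<Rightarrow> complex" where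
  "conv_power P B \<Lambda> f 0 = sym_fun (\<lambda>_. 0)"
| "conv_power P B \<Lambda> f (Suc n) = convolve P B \<Lambda> (conv_power P B \<Lambda> f n) f"

definition bialg_exp ::
  "('u, 'm::finite, 'd::finite) functional_product \<Rightarrow> ('u, 'm) faced \<Rightarrow> ('u \<Rightarrow> 'u) \<Rightarrow>
     (('u ^ 'd) sym \<Rightarrow> complex) \<Rightarrow> ('u ^ 'd) sym \<Rightarrow> complex" where
  "bialg_exp P B \<Lambda> f c = suminf (\<lambda>n. 1 / fact n * conv_power P B \<Lambda> f n c)"

definition conv_exp ::
  "('u, 'm::finite, 'd::finite) functional_product \<Rightarrow> ('u, 'm) faced \<Rightarrow> ('u \<Rightarrow> 'u) \<Rightarrow>
     ('u \<Rightarrow> complex ^ 'd) \<Rightarrow> 'u \<Rightarrow> complex ^ 'd" where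
  "conv_exp P B \<Lambda> \<psi> =
     inv_transp B (\<lambda>b. bialg_exp P B \<Lambda> (sym_der (transp \<psi>)) (sym_emb (dsum B) b))"


section \<open>Positivity\<close>

definition involution :: "(complex, 'a, 'x) module_scheme \<Rightarrow> ('a \<Rightarrow> 'a) \<Rightarrow> bool" where
  "involution A s \<longleftrightarrow>
     (\<forall>x\<in>carrier A. s x \<in> carrier A \<and> s (s x) = x) \<and>
     (\<forall>x\<in>carrier A. \<forall>y\<in>carrier A. s (x \<oplus>\<^bsub>A\<^esub> y) = s x \<oplus>\<^bsub>A\<^esub> s y \<and> s (x \<otimes>\<^bsub>A\<^esub> y) = s y \<otimes>\<^bsub>A\<^esub> s x) \<and>
     (\<forall>c. \<forall>x\<in>carrier A. s (c \<odot>\<^bsub>A\<^esub> x) = cnj c \<odot>\<^bsub>A\<^esub> s x)"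

text \<open>The involution of the free product, unique on the carrier.\<close>

definition fp_star ::
  "('u, 'm) faced \<Rightarrow> ('u \<Rightarrow> 'u) \<Rightarrow> ('u, 'm) faced \<Rightarrow> ('u \<Rightarrow> 'u) \<Rightarrow> 'u \<Rightarrow> 'u" where
  "fp_star A s B t =
     (SOME r. involution (A \<squnion>\<^sub>f B) r \<and>
        (\<forall>a\<in>carrier A. r (inl A B a) = inl A B (s a)) \<and>
        (\<forall>b\<in>carrier B. r (inr A B b) = inr A B (t b)))"

definition star_dual_semigroup ::
  "('u, 'm::finite) faced \<Rightarrow> ('u \<Rightarrow> 'u) \<Rightarrow> ('u \<Rightarrow> 'u) \<Rightarrow> bool" where
  "star_dual_semigroup B s \<Lambda> \<longleftrightarrow>
     dual_semigroup B \<Lambda> \<and> involution B s \<and> (\<forall>k. s ` face B k \<subseteq> face B k) \<and>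
     (\<forall>b\<in>carrier B. \<Lambda> (s b) = fp_star B s B s (\<Lambda> b))"

definition unitization :: "(complex, 'a, 'x) module_scheme \<Rightarrow> (complex, complex \<times> 'a) module" where
  "unitization A =
     \<lparr>carrier = UNIV \<times> carrier A,
      mult = (\<lambda>(c, a) (d, b). (c * d, c \<odot>\<^bsub>A\<^esub> b \<oplus>\<^bsub>A\<^esub> d \<odot>\<^bsub>A\<^esub> a \<oplus>\<^bsub>A\<^esub> a \<otimes>\<^bsub>A\<^esub> b)),
      one = (1, \<zero>\<^bsub>A\<^esub>), zero = (0, \<zero>\<^bsub>A\<^esub>),
      add = (\<lambda>(c, a) (d, b). (c + d, a \<oplus>\<^bsub>A\<^esub> b)),
      smult = (\<lambda>r (c, a). (r * c, r \<odot>\<^bsub>A\<^esub> a))\<rparr>"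

definition unit_star :: "('a \<Rightarrow> 'a) \<Rightarrow> complex \<times> 'a \<Rightarrow> complex \<times> 'a" where
  "unit_star s = (\<lambda>(c, a). (cnj c, s a))"

definition unit_ext :: "('a \<Rightarrow> complex ^ 'd) \<Rightarrow> complex \<times> 'a \<Rightarrow> complex ^ 'd" where
  "unit_ext \<phi> = (\<lambda>(c, a). (\<chi> k. c) + \<phi> a)"

definition nonneg_vec :: "complex ^ 'd \<Rightarrow> bool" where
  "nonneg_vec x \<longleftrightarrow> (\<forall>k. x $ k \<in> \<real>\<^sub>\<ge>\<^sub>0)"

definition restricted_state ::
  "(complex, 'a, 'x) module_scheme \<Rightarrow> ('a \<Rightarrow> 'a) \<Rightarrow> ('a \<Rightarrow> complex ^ 'd) \<Rightarrow> bool" where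
  "restricted_state A s \<phi> \<longleftrightarrow>
     linear_map A \<phi> \<and>
     (\<forall>a\<in>carrier (unitization A). nonneg_vec (unit_ext \<phi> (unit_star s a \<otimes>\<^bsub>unitization A\<^esub> a)))"

definition restricted_generating_functional ::
  "(complex, 'a, 'x) module_scheme \<Rightarrow> ('a \<Rightarrow> 'a) \<Rightarrow> ('a \<Rightarrow> complex ^ 'd) \<Rightarrow> bool" where
  "restricted_generating_functional A s \<psi> \<longleftrightarrow>
     linear_map A \<psi> \<and>
     (\<forall>a\<in>carrier A. \<forall>k. \<psi> (s a) $ k = cnj (\<psi> a $ k)) \<and>
     (\<forall>a\<in>carrier A. nonneg_vec (\<psi> (s a \<otimes>\<^bsub>A\<^esub> a)))"

definition schoenberg :: "('u, 'm::finite, 'd::finite) functional_product \<Rightarrow> bool" where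
  "schoenberg P \<longleftrightarrow>
     (\<forall>B s \<Lambda> \<psi>. star_dual_semigroup B s \<Lambda> \<and> restricted_generating_functional B s \<psi> \<longrightarrow>
        restricted_state B s (conv_exp P B \<Lambda> \<psi>))"

end

theory Submission
  imports Defs
begin

text \<open>
  The substantial implication is that states yield generating functionals. Pointwise
  \<open>exp(t\<psi>) = t\<psi> + o(t)\<close> as \<open>t \<down> 0\<close>, so hermiticity and positivity pass from \<open>exp(t\<psi>)\<close> to \<open>\<psi>\<close>. Two facts
  are behind this expansion.

  First, \<open>\<sigma>\<close> exists, because the value of \<open>\<phi>\<^sub>1 \<odot> \<phi>\<^sub>2\<close> on a word is a polynomial in values of \<open>\<phi>\<^sub>1\<close> and
  \<open>\<phi>\<^sub>2\<close>; this follows from naturality under linear substitutions of the generators of free algebras.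

  Second, the exponential series converges. The product \<open>\<phi> \<star> \<eta> = (\<phi> \<odot> \<eta>) \<circ> \<Lambda>\<close> is associative with unit
  \<open>0\<close>, and \<open>D(\<psi>)\<close> is the derivative of \<open>S(s\<psi>)\<close> at \<open>s = 0\<close>. Hence, as functions of \<open>\<phi>\<close>, the iterates
  of \<open>(id \<otimes> D(\<psi>)) \<circ> \<Delta>\<close> on \<open>c\<close> stay in the span of the left legs of \<open>\<Delta>(c)\<close>. A linear dependence among
  them is a linear recurrence for the convolution powers of \<open>D(\<psi>)\<close> at \<open>c\<close>, which therefore grow at
  most geometrically.
\<close>

section \<open>Finitely supported functions and monoid algebras\<close>

text \<open>Coproducts and \<open>sigma\<close> are picked by \<open>SOME\<close>, so nothing can be
  computed with them until existence has been shown, for coproducts inside the universe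
  \<open>'u\<close> itself. What is then known about \<open>sigma\<close> concerns only the
  characters \<open>S(\<phi>1)\<close> tensor \<open>S(\<phi>2)\<close>. Identities for
  \<open>\<Delta>\<close> are therefore tested on characters; coassociativity of
  \<open>\<Delta>\<close> is never formulated, and associativity of the product of functionals takes
  its place. The main obstacle to polynomiality is that naturality demands equality of functionals
  on a whole free algebra, although the word of interest contains every letter once. The values on
  words with repeated letters must be present in the substituted functional and yet stay out of the
  coefficients of the polynomial; the labels are designed for this. The recurrence plays the part of
  the theorem that every element of a coalgebra lies in a finite-dimensional subcoalgebra: the
  finite support of one representative of \<open>\<Delta>(c)\<close> bounds the dimension.\<close>

lemma lookup_scale [simp]:
  "Poly_Mapping.lookup (Poly_Mapping.map ((*) c) p) k = (c::complex) * Poly_Mapping.lookup p k"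
  by (simp add: Poly_Mapping.map.rep_eq when_def)

lemma scale_add:
  "Poly_Mapping.map ((*) (c::complex)) (p + q) = Poly_Mapping.map ((*) c) p + Poly_Mapping.map ((*) c) q"
  by (rule poly_mapping_eqI) (simp add: lookup_add algebra_simps)

lemma scale_single:
  "Poly_Mapping.map ((*) (c::complex)) (Poly_Mapping.single x a) = Poly_Mapping.single x (c * a)"
  by (rule poly_mapping_eqI) (simp add: lookup_single when_def)

lemma keys_scale_subset: "Poly_Mapping.keys (Poly_Mapping.map ((*) (c::complex)) p) \<subseteq> Poly_Mapping.keys p"
  by (auto simp: in_keys_iff)

lemma scale_zero [simp]: "Poly_Mapping.map ((*) (c::complex)) 0 = 0"
  by (rule poly_mapping_eqI) simp

text \<open>Keeps the support inside a prescribed set, so that conditions such as "nonempty word"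
  survive the step. The peeled-off key may still occur in the rest, which is harmless because the
  rule is applied to additive maps.\<close>

lemma pm_induct [consumes 1, case_names zero add]:
  fixes p :: "'a \<Rightarrow>\<^sub>0 'b::ab_group_add"
  assumes "Poly_Mapping.keys p \<subseteq> A" "P 0"
    and "\<And>x c p. x \<in> A \<Longrightarrow> Poly_Mapping.keys p \<subseteq> A \<Longrightarrow> P p \<Longrightarrow> P (Poly_Mapping.single x c + p)"
  shows "P p"
  using assms(1)
proof (induction "card (Poly_Mapping.keys p)" arbitrary: p)
  case 0
  then show ?case using assms(2) by simp
next
  case (Suc n)
  then obtain x where x: "x \<in> Poly_Mapping.keys p"
    by (metis card.empty ex_in_conv old.nat.distinct(1))
  define q where "q = p - Poly_Mapping.single x (Poly_Mapping.lookup p x)"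
  have k: "Poly_Mapping.keys q = Poly_Mapping.keys p - {x}"
    by (auto simp: q_def in_keys_iff lookup_minus lookup_single when_def split: if_splits)
  with Suc(2) x have "n = card (Poly_Mapping.keys q)" by simp
  with Suc(1)[of q] Suc(3) k have "P q" by blast
  moreover have "p = Poly_Mapping.single x (Poly_Mapping.lookup p x) + q" by (simp add: q_def)
  ultimately show ?case using assms(3) x Suc(3) k by (metis Diff_subset subset_eq)
qed

lemma lin_ext_zero [simp]: "lin_ext f 0 = 0"
  by (simp add: lin_ext_def)

lemma lin_ext_add: "lin_ext f (p + q) = lin_ext f p + lin_ext f q"
  unfolding lin_ext_def by (rule setsum_keys_plus_distrib) (auto simp: algebra_simps)

lemma lin_ext_single [simp]: "lin_ext f (Poly_Mapping.single x a) = a * f x"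
  by (simp add: lin_ext_def)

lemma lin_ext_diff: "lin_ext f (p - q) = lin_ext f p - lin_ext f q"
  using lin_ext_add[of f "p - q" q] by simp

lemma lin_ext_scale: "lin_ext f (Poly_Mapping.map ((*) c) p) = c * lin_ext f p"
  by (induction p rule: pm_induct[OF subset_UNIV])
     (simp_all add: scale_add scale_single lin_ext_add distrib_left)

lemma lin_ext_cong:
  "(\<And>x. x \<in> Poly_Mapping.keys p \<Longrightarrow> f x = g x) \<Longrightarrow> lin_ext f p = lin_ext g p"
  by (simp add: lin_ext_def)

lemma lin_ext_fun_scale: "lin_ext (\<lambda>x. c * f x) p = c * lin_ext f p"
  by (simp add: lin_ext_def sum_distrib_left algebra_simps)

section \<open>Monoid algebras\<close>

lemma monoid_alg_simps [simp]:
  "carrier (monoid_alg M) = {p. Poly_Mapping.keys p \<subseteq> carrier M}"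
  "\<one>\<^bsub>monoid_alg M\<^esub> = Poly_Mapping.single \<one>\<^bsub>M\<^esub> 1"
  "\<zero>\<^bsub>monoid_alg M\<^esub> = 0"
  "p \<oplus>\<^bsub>monoid_alg M\<^esub> q = p + q"
  "c \<odot>\<^bsub>monoid_alg M\<^esub> p = Poly_Mapping.map ((*) c) p"
  by (simp_all add: monoid_alg_def)

lemma monoid_alg_mult:
  "p \<otimes>\<^bsub>monoid_alg M\<^esub> q = (\<Sum>x\<in>Poly_Mapping.keys p. \<Sum>y\<in>Poly_Mapping.keys q.
     Poly_Mapping.single (x \<otimes>\<^bsub>M\<^esub> y) (Poly_Mapping.lookup p x * Poly_Mapping.lookup q y))"
  by (simp add: monoid_alg_def)

lemma monoid_alg_mult_zero [simp]:
  "0 \<otimes>\<^bsub>monoid_alg M\<^esub> q = 0" "p \<otimes>\<^bsub>monoid_alg M\<^esub> 0 = 0"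
  by (simp_all add: monoid_alg_mult)

lemma monoid_alg_mult_single:
  "Poly_Mapping.single x a \<otimes>\<^bsub>monoid_alg M\<^esub> Poly_Mapping.single y b =
     Poly_Mapping.single (x \<otimes>\<^bsub>M\<^esub> y) (a * b)"
  by (simp add: monoid_alg_mult)

lemma monoid_alg_distrib_right:
  "(p + p') \<otimes>\<^bsub>monoid_alg M\<^esub> q = p \<otimes>\<^bsub>monoid_alg M\<^esub> q + p' \<otimes>\<^bsub>monoid_alg M\<^esub> q"
  unfolding monoid_alg_mult
  by (rule setsum_keys_plus_distrib) (simp_all add: algebra_simps single_add sum.distrib)

lemma monoid_alg_distrib_left:
  "q \<otimes>\<^bsub>monoid_alg M\<^esub> (p + p') = q \<otimes>\<^bsub>monoid_alg M\<^esub> p + q \<otimes>\<^bsub>monoid_alg M\<^esub> p'"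
  unfolding monoid_alg_mult sum.distrib[symmetric]
  by (rule sum.cong[OF refl], rule setsum_keys_plus_distrib) (simp_all add: algebra_simps single_add)

text \<open>Closure of the carrier under multiplication is the only assumption on \<open>M\<close>,
  so that the lemma also covers the semigroup of nonempty words and the words in the letters of one
  face.\<close>

lemma monoid_alg_closed:
  assumes "\<And>x y. x \<in> carrier M \<Longrightarrow> y \<in> carrier M \<Longrightarrow> x \<otimes>\<^bsub>M\<^esub> y \<in> carrier M"
    and "Poly_Mapping.keys p \<subseteq> carrier M" "Poly_Mapping.keys q \<subseteq> carrier M"
  shows "Poly_Mapping.keys (p \<otimes>\<^bsub>monoid_alg M\<^esub> q) \<subseteq> carrier M"
  using assms(2)
proof (induction p rule: pm_induct)
  case (add x c p)
  have "Poly_Mapping.keys (Poly_Mapping.single x c \<otimes>\<^bsub>monoid_alg M\<^esub> q) \<subseteq> carrier M"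
    using assms(3)
  proof (induction q rule: pm_induct)
    case (add y d q)
    have "x \<otimes>\<^bsub>M\<^esub> y \<in> carrier M" using assms(1) add \<open>x \<in> carrier M\<close> by blast
    with add show ?case unfolding monoid_alg_distrib_left monoid_alg_mult_single
      by (intro order_trans[OF Poly_Mapping.keys_add] Un_least) (auto simp: in_keys_iff)
  qed simp
  with add show ?case unfolding monoid_alg_distrib_right
    by (intro order_trans[OF Poly_Mapping.keys_add] Un_least)
qed simp

lemma monoid_alg_assoc:
  assumes M: "\<And>x y. x \<in> carrier M \<Longrightarrow> y \<in> carrier M \<Longrightarrow> x \<otimes>\<^bsub>M\<^esub> y \<in> carrier M"
    "\<And>x y z. x \<in> carrier M \<Longrightarrow> y \<in> carrier M \<Longrightarrow> z \<in> carrier M \<Longrightarrow>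
       (x \<otimes>\<^bsub>M\<^esub> y) \<otimes>\<^bsub>M\<^esub> z = x \<otimes>\<^bsub>M\<^esub> (y \<otimes>\<^bsub>M\<^esub> z)"
    and p: "Poly_Mapping.keys p \<subseteq> carrier M" and q: "Poly_Mapping.keys q \<subseteq> carrier M"
    and r: "Poly_Mapping.keys r \<subseteq> carrier M"
  shows "(p \<otimes>\<^bsub>monoid_alg M\<^esub> q) \<otimes>\<^bsub>monoid_alg M\<^esub> r = p \<otimes>\<^bsub>monoid_alg M\<^esub> (q \<otimes>\<^bsub>monoid_alg M\<^esub> r)"
  using p
proof (induction p rule: pm_induct)
  case (add x a p)
  note p_IH = add(3) and x = add(1)
  have "(Poly_Mapping.single x a \<otimes>\<^bsub>monoid_alg M\<^esub> q) \<otimes>\<^bsub>monoid_alg M\<^esub> r =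
      Poly_Mapping.single x a \<otimes>\<^bsub>monoid_alg M\<^esub> (q \<otimes>\<^bsub>monoid_alg M\<^esub> r)"
    using q
  proof (induction q rule: pm_induct)
    case (add y b q)
    note q_IH = add(3) and y = add(1)
    have "(Poly_Mapping.single x a \<otimes>\<^bsub>monoid_alg M\<^esub> Poly_Mapping.single y b) \<otimes>\<^bsub>monoid_alg M\<^esub> r =
      Poly_Mapping.single x a \<otimes>\<^bsub>monoid_alg M\<^esub> (Poly_Mapping.single y b \<otimes>\<^bsub>monoid_alg M\<^esub> r)"
      using r
      by (induction r rule: pm_induct)
         (simp_all add: monoid_alg_distrib_left monoid_alg_mult_single M x y mult.assoc)
    with q_IH show ?case by (simp add: monoid_alg_distrib_left monoid_alg_distrib_right)
  qed simp
  with p_IH show ?case by (simp add: monoid_alg_distrib_left monoid_alg_distrib_right)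
qed simp

lemma monoid_alg_comm:
  assumes M: "\<And>x y. x \<in> carrier M \<Longrightarrow> y \<in> carrier M \<Longrightarrow> x \<otimes>\<^bsub>M\<^esub> y = y \<otimes>\<^bsub>M\<^esub> x"
    and p: "Poly_Mapping.keys p \<subseteq> carrier M" and q: "Poly_Mapping.keys q \<subseteq> carrier M"
  shows "p \<otimes>\<^bsub>monoid_alg M\<^esub> q = q \<otimes>\<^bsub>monoid_alg M\<^esub> p"
  using p
proof (induction p rule: pm_induct)
  case (add x a p)
  have "Poly_Mapping.single x a \<otimes>\<^bsub>monoid_alg M\<^esub> q = q \<otimes>\<^bsub>monoid_alg M\<^esub> Poly_Mapping.single x a"
    using q
    by (induction q rule: pm_induct)
       (simp_all add: monoid_alg_distrib_left monoid_alg_distrib_right monoid_alg_mult_single M add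
          mult.commute)
  with add show ?case by (simp add: monoid_alg_distrib_left monoid_alg_distrib_right)
qed simp

lemma monoid_alg_scale:
  "Poly_Mapping.map ((*) c) p \<otimes>\<^bsub>monoid_alg M\<^esub> q = Poly_Mapping.map ((*) c) (p \<otimes>\<^bsub>monoid_alg M\<^esub> q)"
  "p \<otimes>\<^bsub>monoid_alg M\<^esub> Poly_Mapping.map ((*) c) q = Poly_Mapping.map ((*) c) (p \<otimes>\<^bsub>monoid_alg M\<^esub> q)"
proof -
  have *: "Poly_Mapping.single x (c * a) \<otimes>\<^bsub>monoid_alg M\<^esub> q =
      Poly_Mapping.map ((*) c) (Poly_Mapping.single x a \<otimes>\<^bsub>monoid_alg M\<^esub> q) \<and>
      Poly_Mapping.single x a \<otimes>\<^bsub>monoid_alg M\<^esub> Poly_Mapping.map ((*) c) q =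
      Poly_Mapping.map ((*) c) (Poly_Mapping.single x a \<otimes>\<^bsub>monoid_alg M\<^esub> q)" for x a
    by (induction q rule: pm_induct[OF subset_UNIV])
       (simp_all add: monoid_alg_distrib_left monoid_alg_mult_single scale_add scale_single mult.assoc
         mult.left_commute)
  show "Poly_Mapping.map ((*) c) p \<otimes>\<^bsub>monoid_alg M\<^esub> q = Poly_Mapping.map ((*) c) (p \<otimes>\<^bsub>monoid_alg M\<^esub> q)"
    by (induction p rule: pm_induct[OF subset_UNIV])
       (simp_all add: monoid_alg_distrib_right scale_add scale_single *)
  show "p \<otimes>\<^bsub>monoid_alg M\<^esub> Poly_Mapping.map ((*) c) q = Poly_Mapping.map ((*) c) (p \<otimes>\<^bsub>monoid_alg M\<^esub> q)"
    by (induction p rule: pm_induct[OF subset_UNIV])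
       (simp_all add: monoid_alg_distrib_right scale_add *)
qed

section \<open>Complex vector spaces as modules\<close>

lemma cring_complex_ring: "cring complex_ring"
proof (rule cringI)
  show "abelian_group complex_ring"
    by (rule abelian_groupI) (auto simp: complex_ring_def intro: exI[of _ "- x" for x])
  show "Group.comm_monoid complex_ring"
    by (rule comm_monoidI) (auto simp: complex_ring_def)
qed (auto simp: complex_ring_def algebra_simps)

lemma complex_ring_simps [simp]:
  "carrier complex_ring = UNIV" "a \<otimes>\<^bsub>complex_ring\<^esub> b = a * b" "\<one>\<^bsub>complex_ring\<^esub> = 1"
  "\<zero>\<^bsub>complex_ring\<^esub> = 0" "a \<oplus>\<^bsub>complex_ring\<^esub> b = a + b"
  by (simp_all add: complex_ring_def)

text \<open>Additive inverses come from scalars: \<open>(-1) \<odot> x\<close> is one, because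
  \<open>0 \<odot> x = \<zero>\<close> is among the assumptions.\<close>

lemma module_complexI:
  fixes A (structure)
  assumes "\<zero> \<in> carrier A"
    and add: "\<And>x y. x \<in> carrier A \<Longrightarrow> y \<in> carrier A \<Longrightarrow> x \<oplus> y \<in> carrier A"
    "\<And>x y z. x \<in> carrier A \<Longrightarrow> y \<in> carrier A \<Longrightarrow> z \<in> carrier A \<Longrightarrow> (x \<oplus> y) \<oplus> z = x \<oplus> (y \<oplus> z)"
    "\<And>x y. x \<in> carrier A \<Longrightarrow> y \<in> carrier A \<Longrightarrow> x \<oplus> y = y \<oplus> x"
    "\<And>x. x \<in> carrier A \<Longrightarrow> \<zero> \<oplus> x = x"
    and smult: "\<And>c x. x \<in> carrier A \<Longrightarrow> c \<odot> x \<in> carrier A"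
    "\<And>c d x. x \<in> carrier A \<Longrightarrow> (c + d) \<odot> x = c \<odot> x \<oplus> d \<odot> x"
    "\<And>c x y. x \<in> carrier A \<Longrightarrow> y \<in> carrier A \<Longrightarrow> c \<odot> (x \<oplus> y) = c \<odot> x \<oplus> c \<odot> y"
    "\<And>c d x. x \<in> carrier A \<Longrightarrow> (c * d) \<odot> x = c \<odot> (d \<odot> x)"
    "\<And>x. x \<in> carrier A \<Longrightarrow> 1 \<odot> x = x"
    "\<And>x. x \<in> carrier A \<Longrightarrow> 0 \<odot> x = \<zero>"
  shows "Module.module complex_ring A"
proof (rule moduleI)
  show "abelian_group A"
  proof (rule abelian_groupI)
    fix x assume x: "x \<in> carrier A"
    have "(-1 + 1) \<odot> x = (-1) \<odot> x \<oplus> 1 \<odot> x" using x by (rule smult)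
    then show "\<exists>y\<in>carrier A. y \<oplus> x = \<zero>" using x smult by (metis add.left_inverse)
  qed (use assms in auto)
qed (use smult in \<open>auto simp: cring_complex_ring\<close>)

lemma module_complexD:
  fixes A (structure)
  assumes "Module.module complex_ring A"
  shows "\<zero> \<in> carrier A"
    "\<And>x y. x \<in> carrier A \<Longrightarrow> y \<in> carrier A \<Longrightarrow> x \<oplus> y \<in> carrier A"
    "\<And>x y z. x \<in> carrier A \<Longrightarrow> y \<in> carrier A \<Longrightarrow> z \<in> carrier A \<Longrightarrow> (x \<oplus> y) \<oplus> z = x \<oplus> (y \<oplus> z)"
    "\<And>x y. x \<in> carrier A \<Longrightarrow> y \<in> carrier A \<Longrightarrow> x \<oplus> y = y \<oplus> x"
    "\<And>x. x \<in> carrier A \<Longrightarrow> \<zero> \<oplus> x = x"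
    "\<And>x. x \<in> carrier A \<Longrightarrow> x \<oplus> \<zero> = x"
    "\<And>c x. x \<in> carrier A \<Longrightarrow> c \<odot> x \<in> carrier A"
    "\<And>c d x. x \<in> carrier A \<Longrightarrow> (c + d) \<odot> x = c \<odot> x \<oplus> d \<odot> x"
    "\<And>c x y. x \<in> carrier A \<Longrightarrow> y \<in> carrier A \<Longrightarrow> c \<odot> (x \<oplus> y) = c \<odot> x \<oplus> c \<odot> y"
    "\<And>c d x. x \<in> carrier A \<Longrightarrow> (c * d) \<odot> x = c \<odot> (d \<odot> x)"
    "\<And>x. x \<in> carrier A \<Longrightarrow> 1 \<odot> x = x"
    "\<And>x. x \<in> carrier A \<Longrightarrow> 0 \<odot> x = \<zero>"
    "\<And>c. c \<odot> \<zero> = \<zero>"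
proof -
  interpret Module.module complex_ring A by fact
  show "\<zero> \<in> carrier A"
    "\<And>x y. x \<in> carrier A \<Longrightarrow> y \<in> carrier A \<Longrightarrow> x \<oplus> y \<in> carrier A"
    "\<And>x y z. x \<in> carrier A \<Longrightarrow> y \<in> carrier A \<Longrightarrow> z \<in> carrier A \<Longrightarrow> (x \<oplus> y) \<oplus> z = x \<oplus> (y \<oplus> z)"
    "\<And>x y. x \<in> carrier A \<Longrightarrow> y \<in> carrier A \<Longrightarrow> x \<oplus> y = y \<oplus> x"
    "\<And>x. x \<in> carrier A \<Longrightarrow> \<zero> \<oplus> x = x"
    "\<And>x. x \<in> carrier A \<Longrightarrow> x \<oplus> \<zero> = x"
    "\<And>c x. x \<in> carrier A \<Longrightarrow> c \<odot> x \<in> carrier A"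
    "\<And>c d x. x \<in> carrier A \<Longrightarrow> (c + d) \<odot> x = c \<odot> x \<oplus> d \<odot> x"
    "\<And>c x y. x \<in> carrier A \<Longrightarrow> y \<in> carrier A \<Longrightarrow> c \<odot> (x \<oplus> y) = c \<odot> x \<oplus> c \<odot> y"
    "\<And>c d x. x \<in> carrier A \<Longrightarrow> (c * d) \<odot> x = c \<odot> (d \<odot> x)"
    "\<And>x. x \<in> carrier A \<Longrightarrow> 1 \<odot> x = x"
    "\<And>x. x \<in> carrier A \<Longrightarrow> 0 \<odot> x = \<zero>"
    "\<And>c. c \<odot> \<zero> = \<zero>"
    using smult_l_distr smult_r_distr smult_assoc1 smult_one smult_l_null smult_r_null
    by (auto simp: M.a_assoc intro: M.a_comm)
qed

lemma monoid_alg_module: "Module.module complex_ring (monoid_alg M)"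
proof (rule module_complexI)
  fix x y assume "x \<in> carrier (monoid_alg M)" "y \<in> carrier (monoid_alg M)"
  then show "x \<oplus>\<^bsub>monoid_alg M\<^esub> y \<in> carrier (monoid_alg M)"
    using Poly_Mapping.keys_add[of x y] by auto
next
  fix c x assume "x \<in> carrier (monoid_alg M)"
  then show "c \<odot>\<^bsub>monoid_alg M\<^esub> x \<in> carrier (monoid_alg M)"
    using keys_scale_subset[of c x] by auto
qed (auto intro!: poly_mapping_eqI simp: lookup_add algebra_simps)

lemma monoid_alg_cring:
  assumes "Group.comm_monoid M"
  shows "cring (monoid_alg M)"
proof -
  interpret M: Group.comm_monoid M by fact
  interpret A: Module.module complex_ring "monoid_alg M" by (rule monoid_alg_module)
  show ?thesis
  proof (rule cringI)
    show "abelian_group (monoid_alg M)" by unfold_locales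
    show "Group.comm_monoid (monoid_alg M)"
    proof (rule comm_monoidI)
      show "x \<otimes>\<^bsub>monoid_alg M\<^esub> y \<in> carrier (monoid_alg M)"
        if "x \<in> carrier (monoid_alg M)" "y \<in> carrier (monoid_alg M)" for x y
        using that monoid_alg_closed[of M x y] by auto
      show "x \<otimes>\<^bsub>monoid_alg M\<^esub> y \<otimes>\<^bsub>monoid_alg M\<^esub> z = x \<otimes>\<^bsub>monoid_alg M\<^esub> (y \<otimes>\<^bsub>monoid_alg M\<^esub> z)"
        if "x \<in> carrier (monoid_alg M)" "y \<in> carrier (monoid_alg M)" "z \<in> carrier (monoid_alg M)"
        for x y z
        using that monoid_alg_assoc[of M x y z] by (auto simp: M.m_assoc)
      show "x \<otimes>\<^bsub>monoid_alg M\<^esub> y = y \<otimes>\<^bsub>monoid_alg M\<^esub> x"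
        if "x \<in> carrier (monoid_alg M)" "y \<in> carrier (monoid_alg M)" for x y
        using that monoid_alg_comm[of M x y] by (auto simp: M.m_comm)
      show "\<one>\<^bsub>monoid_alg M\<^esub> \<otimes>\<^bsub>monoid_alg M\<^esub> x = x" if "x \<in> carrier (monoid_alg M)" for x
      proof -
        from that have "Poly_Mapping.keys x \<subseteq> carrier M" by simp
        then show ?thesis
          by (induction x rule: pm_induct) (auto simp: monoid_alg_distrib_left monoid_alg_mult_single)
      qed
    qed auto
  qed (auto simp: monoid_alg_distrib_right)
qed

lemma monoid_alg_algebra:
  assumes "Group.comm_monoid M"
  shows "algebra complex_ring (monoid_alg M)"
proof -
  interpret A: Module.module complex_ring "monoid_alg M" by (rule monoid_alg_module)
  show ?thesis
    by (rule algebraI) (use monoid_alg_cring[OF assms] A.smult_closed A.smult_l_distr A.smult_r_distr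
      A.smult_assoc1 A.smult_one in \<open>simp_all add: cring_complex_ring monoid_alg_scale
        del: monoid_alg_simps(1,4,5)\<close>, simp add: monoid_alg_scale)
qed

section \<open>Quotients of commutative algebras\<close>

context
  fixes A :: "(complex, 'a) module" (structure) and R
  assumes alg: "algebra complex_ring A" and R: "R \<subseteq> carrier A"
begin

interpretation M: cring A by (rule algebra.M_cring[OF alg])
interpretation Module.module complex_ring A by (rule algebra.module[OF alg])
interpretation ideal "Idl R" A by (rule M.genideal_ideal[OF R])

text \<open>Negatives are products with \<open>\<ominus> \<one>\<close>, so they need no hypothesis
  of their own. With J the set of elements on which a map behaves well, this is the way every map on
  a quotient is shown to be well defined.\<close>

lemma Idl_subsetI:
  assumes J: "R \<subseteq> J" "J \<subseteq> carrier A" "\<zero> \<in> J"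
    and add: "\<And>x y. x \<in> J \<Longrightarrow> y \<in> J \<Longrightarrow> x \<oplus> y \<in> J"
    and mult: "\<And>a x. a \<in> carrier A \<Longrightarrow> x \<in> J \<Longrightarrow> a \<otimes> x \<in> J"
  shows "Idl R \<subseteq> J"
proof (rule M.genideal_minimal)
  show "ideal J A"
  proof (rule idealI)
    show "subgroup J (add_monoid A)"
    proof (rule M.add.subgroupI)
      show "\<ominus> x \<in> J" if "x \<in> J" for x
      proof -
        have "(\<ominus> \<one>) \<otimes> x \<in> J" using that by (intro mult) auto
        then show ?thesis using that J(2) by (metis M.l_minus M.l_one M.one_closed subsetD)
      qed
    qed (use J add in auto)
    show "\<And>a x. a \<in> J \<Longrightarrow> x \<in> carrier A \<Longrightarrow> a \<otimes> x \<in> J"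
      using mult J(2) by (metis M.m_comm subsetD)
  qed (use mult M.ring_axioms in auto)
qed (use J in auto)

lemma coset_mem: "p \<in> carrier A \<Longrightarrow> p' \<in> Idl R +> p \<longleftrightarrow> (\<exists>i\<in>Idl R. p' = i \<oplus> p)"
  by (auto simp: a_r_coset_def')

lemma coset_self: "p \<in> carrier A \<Longrightarrow> p \<in> Idl R +> p"
  by (rule a_rcos_self)

lemma coset_eqI:
  assumes "p \<in> carrier A" "i \<in> Idl R"
  shows "Idl R +> (i \<oplus> p) = Idl R +> p"
proof -
  have "i \<oplus> p \<in> Idl R +> p" using assms coset_mem by blast
  then show ?thesis using assms a_repr_independence' by (metis)
qed

text \<open>Scalars act as multiplication by multiples of the unit, so a ring ideal is a
  subspace.\<close>

lemma Idl_smult_closed: "i \<in> Idl R \<Longrightarrow> c \<odot> i \<in> Idl R"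
proof -
  assume i: "i \<in> Idl R"
  then have "i \<in> carrier A" by auto
  then have "c \<odot> i = (c \<odot> \<one>) \<otimes> i" by (simp add: algebra.smult_assoc2[OF alg])
  then show ?thesis using i I_l_closed by simp
qed

lemma quot_alg_simps:
  "carrier (quot_alg A R) = (\<lambda>p. Idl R +> p) ` carrier A"
  "\<one>\<^bsub>quot_alg A R\<^esub> = Idl R +> \<one>"
  "\<zero>\<^bsub>quot_alg A R\<^esub> = Idl R +> \<zero>"
proof -
  have "Idl R = Idl R +> \<zero>" by (rule a_rcos_const[OF zero_closed, symmetric])
  then show "\<zero>\<^bsub>quot_alg A R\<^esub> = Idl R +> \<zero>"
    by (simp add: quot_alg_def ring.extend_def module.fields_def FactRing_def)
qed (auto simp: quot_alg_def ring.extend_def module.fields_def FactRing_def A_RCOSETS_defs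
        a_r_coset_def[symmetric])

lemma quot_alg_ops:
  assumes "p \<in> carrier A" "q \<in> carrier A"
  shows "(Idl R +> p) \<oplus>\<^bsub>quot_alg A R\<^esub> (Idl R +> q) = Idl R +> (p \<oplus> q)"
    "(Idl R +> p) \<otimes>\<^bsub>quot_alg A R\<^esub> (Idl R +> q) = Idl R +> (p \<otimes> q)"
    "c \<odot>\<^bsub>quot_alg A R\<^esub> (Idl R +> p) = Idl R +> (c \<odot> p)"
proof -
  have "Idl R +> (c \<odot> x) = Idl R +> (c \<odot> p)" if x: "x \<in> Idl R +> p" for x
  proof -
    obtain i where i: "i \<in> Idl R" "x = i \<oplus> p" using x coset_mem[OF assms(1)] by blast
    then have "c \<odot> x = c \<odot> i \<oplus> c \<odot> p" using assms by (simp add: smult_r_distr a_Hcarr)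
    then show ?thesis
      using coset_eqI[OF smult_closed[OF _ assms(1)] Idl_smult_closed[OF i(1)], of c c] by simp
  qed
  then have "(\<Union>x\<in>Idl R +> p. Idl R +> (c \<odot> x)) = (\<Union>x\<in>Idl R +> p. Idl R +> (c \<odot> p))"
    by (rule SUP_cong[OF refl])
  also have "\<dots> = Idl R +> (c \<odot> p)" using coset_self[OF assms(1)] by blast
  finally show "c \<odot>\<^bsub>quot_alg A R\<^esub> (Idl R +> p) = Idl R +> (c \<odot> p)"
    by (simp only: quot_alg_def ring.extend_def module.fields_def module.select_convs)
qed (use assms in \<open>simp_all add: quot_alg_def ring.extend_def module.fields_def FactRing_def
      a_rcos_sum rcoset_mult_add\<close>)

lemma quot_alg_algebra: "algebra complex_ring (quot_alg A R)"
proof -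
  let ?Q = "quot_alg A R"
  note mod = algebra.module[OF alg]
  have modQ: "Module.module complex_ring ?Q"
  proof (rule module_complexI)
    show "(c + d) \<odot>\<^bsub>?Q\<^esub> x = c \<odot>\<^bsub>?Q\<^esub> x \<oplus>\<^bsub>?Q\<^esub> d \<odot>\<^bsub>?Q\<^esub> x"
      "(c * d) \<odot>\<^bsub>?Q\<^esub> x = c \<odot>\<^bsub>?Q\<^esub> (d \<odot>\<^bsub>?Q\<^esub> x)" "c \<odot>\<^bsub>?Q\<^esub> x \<in> carrier ?Q"
      "1 \<odot>\<^bsub>?Q\<^esub> x = x" "0 \<odot>\<^bsub>?Q\<^esub> x = \<zero>\<^bsub>?Q\<^esub>" "\<zero>\<^bsub>?Q\<^esub> \<oplus>\<^bsub>?Q\<^esub> x = x"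
      if x: "x \<in> carrier ?Q" for c d x
    proof -
      obtain p where p: "p \<in> carrier A" "x = Idl R +> p" using x by (auto simp: quot_alg_simps)
      then show "(c + d) \<odot>\<^bsub>?Q\<^esub> x = c \<odot>\<^bsub>?Q\<^esub> x \<oplus>\<^bsub>?Q\<^esub> d \<odot>\<^bsub>?Q\<^esub> x"
        "(c * d) \<odot>\<^bsub>?Q\<^esub> x = c \<odot>\<^bsub>?Q\<^esub> (d \<odot>\<^bsub>?Q\<^esub> x)" "c \<odot>\<^bsub>?Q\<^esub> x \<in> carrier ?Q"
        "1 \<odot>\<^bsub>?Q\<^esub> x = x" "0 \<odot>\<^bsub>?Q\<^esub> x = \<zero>\<^bsub>?Q\<^esub>" "\<zero>\<^bsub>?Q\<^esub> \<oplus>\<^bsub>?Q\<^esub> x = x"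
        using module_complexD[OF mod] by (simp_all add: quot_alg_simps quot_alg_ops)
    qed
    show "x \<oplus>\<^bsub>?Q\<^esub> y \<in> carrier ?Q" "x \<oplus>\<^bsub>?Q\<^esub> y = y \<oplus>\<^bsub>?Q\<^esub> x"
      "c \<odot>\<^bsub>?Q\<^esub> (x \<oplus>\<^bsub>?Q\<^esub> y) = c \<odot>\<^bsub>?Q\<^esub> x \<oplus>\<^bsub>?Q\<^esub> c \<odot>\<^bsub>?Q\<^esub> y"
      if xy: "x \<in> carrier ?Q" "y \<in> carrier ?Q" for c x y
    proof -
      obtain p q where p: "p \<in> carrier A" "x = Idl R +> p" "q \<in> carrier A" "y = Idl R +> q"
        using xy by (auto simp: quot_alg_simps)
      then show "x \<oplus>\<^bsub>?Q\<^esub> y \<in> carrier ?Q" "x \<oplus>\<^bsub>?Q\<^esub> y = y \<oplus>\<^bsub>?Q\<^esub> x"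
        "c \<odot>\<^bsub>?Q\<^esub> (x \<oplus>\<^bsub>?Q\<^esub> y) = c \<odot>\<^bsub>?Q\<^esub> x \<oplus>\<^bsub>?Q\<^esub> c \<odot>\<^bsub>?Q\<^esub> y"
        using module_complexD(7,9)[OF mod] by (simp_all add: quot_alg_simps quot_alg_ops M.a_comm)
    qed
  qed (auto simp: quot_alg_simps quot_alg_ops M.a_assoc)
  interpret Q: Module.module complex_ring ?Q by (fact modQ)
  have cr: "cring ?Q"
  proof (rule cringI)
    show "abelian_group ?Q" by unfold_locales
    show "Group.comm_monoid ?Q"
    proof (rule comm_monoidI)
      show "x \<otimes>\<^bsub>?Q\<^esub> y = y \<otimes>\<^bsub>?Q\<^esub> x" if "x \<in> carrier ?Q" "y \<in> carrier ?Q" for x y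
      proof -
        obtain p q where "p \<in> carrier A" "q \<in> carrier A" "x = Idl R +> p" "y = Idl R +> q"
          using \<open>x \<in> carrier ?Q\<close> \<open>y \<in> carrier ?Q\<close> by (auto simp: quot_alg_simps)
        then show ?thesis by (simp add: quot_alg_ops M.m_comm)
      qed
    qed (auto simp: quot_alg_simps quot_alg_ops M.m_assoc)
  qed (auto simp: quot_alg_simps quot_alg_ops M.l_distr)
  show ?thesis
    by (intro algebra.intro modQ cr algebra_axioms.intro)
       (auto simp: quot_alg_simps quot_alg_ops algebra.smult_assoc2[OF alg])
qed

text \<open>Maps on quotients are defined through \<open>the_elem\<close> of an image or a union
  over a coset. Both have the expected value once the map on representatives is invariant under
  adding elements of the ideal.\<close>

lemma the_elem_coset:
  assumes p: "p \<in> carrier A" and F: "\<And>i. i \<in> Idl R \<Longrightarrow> F (i \<oplus> p) = F p"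
  shows "the_elem (F ` (Idl R +> p)) = F p"
proof -
  have "F ` (Idl R +> p) = {F p}"
    using coset_self[OF p] F coset_mem[OF p] by auto
  then show ?thesis by simp
qed

lemma Union_coset:
  assumes p: "p \<in> carrier A" and F: "\<And>i. i \<in> Idl R \<Longrightarrow> F (i \<oplus> p) = F p"
  shows "(\<Union>q\<in>Idl R +> p. F q) = F p"
  using coset_self[OF p] F coset_mem[OF p] by fastforce

lemma Idl_self: "R \<subseteq> Idl R"
  by (rule M.genideal_self[OF R])

lemma Idl_closed:
  "\<zero> \<in> Idl R" "x \<in> Idl R \<Longrightarrow> y \<in> Idl R \<Longrightarrow> x \<oplus> y \<in> Idl R"
  "a \<in> carrier A \<Longrightarrow> x \<in> Idl R \<Longrightarrow> a \<otimes> x \<in> Idl R"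
  using I_l_closed by auto

end

section \<open>Symmetric tensor algebras\<close>

definition lin_fun :: "(complex, 'v, 'x) module_scheme \<Rightarrow> ('v \<Rightarrow> complex) \<Rightarrow> bool" where
  "lin_fun V f \<longleftrightarrow> (\<forall>x\<in>carrier V. \<forall>y\<in>carrier V. f (x \<oplus>\<^bsub>V\<^esub> y) = f x + f y) \<and>
     (\<forall>c. \<forall>x\<in>carrier V. f (c \<odot>\<^bsub>V\<^esub> x) = c * f x)"

lemma multisets_in_simps [simp]:
  "carrier (multisets_in V) = {M. set_mset M \<subseteq> V}"
  "M \<otimes>\<^bsub>multisets_in V\<^esub> N = M + N" "\<one>\<^bsub>multisets_in V\<^esub> = {#}"
  by (simp_all add: multisets_in_def)

lemma multisets_in_comm_monoid: "Group.comm_monoid (multisets_in V)"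
  by (rule comm_monoidI) auto

abbreviation "polys V \<equiv> monoid_alg (multisets_in (carrier V))"

lemma polys_algebra: "algebra complex_ring (polys V)"
  by (rule monoid_alg_algebra[OF multisets_in_comm_monoid])

lemma lin_ext_prod_mult:
  "lin_ext (\<lambda>M. \<Prod>v\<in>#M. f v) (p \<otimes>\<^bsub>polys V\<^esub> q) =
     lin_ext (\<lambda>M. \<Prod>v\<in>#M. f v) p * lin_ext (\<lambda>M. \<Prod>v\<in>#M. f v) q"
proof -
  have *: "lin_ext (\<lambda>M. \<Prod>v\<in>#M. f v) (Poly_Mapping.single M a \<otimes>\<^bsub>polys V\<^esub> q) =
      a * (\<Prod>v\<in>#M. f v) * lin_ext (\<lambda>M. \<Prod>v\<in>#M. f v) q" for M a
    by (induction q rule: pm_induct[OF subset_UNIV])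
       (simp_all add: monoid_alg_distrib_left monoid_alg_mult_single lin_ext_add algebra_simps)
  show ?thesis
    by (induction p rule: pm_induct[OF subset_UNIV])
       (simp_all add: monoid_alg_distrib_right lin_ext_add * algebra_simps)
qed

definition der_ext :: "('v \<Rightarrow> complex) \<Rightarrow> ('v multiset \<Rightarrow>\<^sub>0 complex) \<Rightarrow> complex" where
  "der_ext f = lin_ext (\<lambda>M. if size M = 1 then \<Prod>v\<in>#M. f v else 0)"


text \<open>The Leibniz rule of a derivation along the augmentation. The augmentation is the
  evaluation at f = 0: a product of zeros over a multiset is 1 if the multiset is empty and 0
  otherwise.\<close>

lemma der_ext_mult:
  fixes f :: "'v \<Rightarrow> complex"
  shows "der_ext f (p \<otimes>\<^bsub>polys V\<^esub> q) =
     der_ext f p * lin_ext (\<lambda>M. \<Prod>v\<in>#M. 0) q + lin_ext (\<lambda>M. \<Prod>v\<in>#M. 0) p * der_ext f q"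
proof -
  define g where "g M = (if size M = 1 then \<Prod>v\<in>#M. f v else 0)" for M
  define h :: "'v multiset \<Rightarrow> complex" where "h M = (\<Prod>v\<in>#M. 0)" for M
  have s: "g (M + N) = g M * h N + h M * g N" for M N
  proof (cases "M = {#} \<or> N = {#}")
    case False
    then have "size M > 0" "size N > 0" by (auto simp: nonempty_has_size)
    then have "size (M + N) \<noteq> 1" by simp
    then show ?thesis using False by (auto simp: power_0_left g_def h_def)
  qed (auto simp: g_def h_def)
  have *: "lin_ext g (Poly_Mapping.single M a \<otimes>\<^bsub>polys V\<^esub> q) = a * (g M * lin_ext h q + h M * lin_ext g q)"
    for M a
    by (induction q rule: pm_induct[OF subset_UNIV])
       (simp_all add: monoid_alg_distrib_left monoid_alg_mult_single lin_ext_add s algebra_simps)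
  have "lin_ext g (p \<otimes>\<^bsub>polys V\<^esub> q) = lin_ext g p * lin_ext h q + lin_ext h p * lin_ext g q"
    by (induction p rule: pm_induct[OF subset_UNIV])
       (simp_all add: monoid_alg_distrib_right lin_ext_add * algebra_simps)
  then show ?thesis by (simp add: der_ext_def g_def[abs_def] h_def[abs_def])
qed

text \<open>Scaling f by s multiplies a monomial of degree n by \<open>s ^ n\<close>, whose
  derivative at 0 is nonzero only for n = 1.\<close>

lemma der_ext_derivative:
  "((\<lambda>s. lin_ext (\<lambda>M. \<Prod>v\<in>#M. s * f v) p) has_field_derivative der_ext f p) (at 0)"
proof (induction p rule: pm_induct[OF subset_UNIV])
  case (2 M c p)
  have pw: "(\<Prod>v\<in>#M. s * f v) = s ^ size M * (\<Prod>v\<in>#M. f v)" for s :: complex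
    by (simp add: prod_mset.distrib)
  have "((\<lambda>s. s ^ size M) has_field_derivative (if size M = 1 then 1 else 0)) (at (0::complex))"
    by (rule derivative_eq_intros refl)+ (auto simp: power_0_left le_Suc_eq)
  then have "((\<lambda>s. c * (s ^ size M * (\<Prod>v\<in>#M. f v))) has_field_derivative
      (c * ((if size M = 1 then 1 else 0) * (\<Prod>v\<in>#M. f v)))) (at 0)"
    by (intro DERIV_cmult DERIV_cmult_right)
  then have "((\<lambda>s. lin_ext (\<lambda>M. \<Prod>v\<in>#M. s * f v) (Poly_Mapping.single M c)) has_field_derivative
      der_ext f (Poly_Mapping.single M c)) (at 0)"
    unfolding der_ext_def lin_ext_single pw by (cases "size M = 1") simp_all
  from DERIV_add[OF this 2(3)] show ?case by (simp add: lin_ext_add der_ext_def)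
qed (simp add: der_ext_def)

text \<open>The map of polynomial rings underlying \<open>sym_map\<close>, whose definition contains
  this sum inline.\<close>

definition push :: "('v \<Rightarrow> 'w) \<Rightarrow> ('v multiset \<Rightarrow>\<^sub>0 complex) \<Rightarrow> ('w multiset \<Rightarrow>\<^sub>0 complex)" where
  "push T p = (\<Sum>M\<in>Poly_Mapping.keys p.
     Poly_Mapping.single (image_mset T M) (Poly_Mapping.lookup p M))"

lemma push_add: "push T (p + q) = push T p + push T q"
  unfolding push_def by (rule setsum_keys_plus_distrib) (auto simp: single_add)

lemma push_zero [simp]: "push T 0 = 0"
  by (simp add: push_def)

lemma push_single [simp]:
  "push T (Poly_Mapping.single M a) = Poly_Mapping.single (image_mset T M) a"
  by (simp add: push_def)

lemma push_diff: "push T (p - q) = push T p - push T q"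
  using push_add[of T "p - q" q] by simp

lemma push_scale: "push T (Poly_Mapping.map ((*) c) p) = Poly_Mapping.map ((*) c) (push T p)"
  by (induction p rule: pm_induct[OF subset_UNIV])
     (simp_all add: scale_add scale_single push_add)

lemma push_mult: "push T (p \<otimes>\<^bsub>polys V\<^esub> q) = push T p \<otimes>\<^bsub>polys W\<^esub> push T q"
proof -
  have *: "push T (Poly_Mapping.single M a \<otimes>\<^bsub>polys V\<^esub> q) =
      push T (Poly_Mapping.single M a) \<otimes>\<^bsub>polys W\<^esub> push T q" for M a
    by (induction q rule: pm_induct[OF subset_UNIV])
       (simp_all add: monoid_alg_distrib_left monoid_alg_mult_single push_add)
  show ?thesis
    by (induction p rule: pm_induct[OF subset_UNIV])
       (simp_all add: monoid_alg_distrib_right push_add *)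
qed

lemma push_carrier:
  assumes "T ` carrier V \<subseteq> carrier W" "p \<in> carrier (polys V)"
  shows "push T p \<in> carrier (polys W)"
proof -
  interpret Module.module complex_ring "polys W" by (rule monoid_alg_module)
  from assms(2) have "Poly_Mapping.keys p \<subseteq> {M. set_mset M \<subseteq> carrier V}" by simp
  then show ?thesis
  proof (induction p rule: pm_induct)
    case (add M c p)
    have "Poly_Mapping.single (image_mset T M) c \<in> carrier (polys W)"
      using add(1) assms(1) by fastforce
    then show ?case using add M.a_closed unfolding push_add push_single by simp
  qed simp
qed

lemma lin_ext_push:
  "lin_ext (\<lambda>M. \<Prod>v\<in>#M. f v) (push T p) = lin_ext (\<lambda>M. \<Prod>v\<in>#M. f (T v)) p"
  by (induction p rule: pm_induct[OF subset_UNIV])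
     (simp_all add: push_add lin_ext_add image_mset.compositionality comp_def)

context
  fixes V :: "(complex, 'v, 'x) module_scheme" (structure)
  assumes V: "Module.module complex_ring V"
begin

interpretation V: Module.module complex_ring V by (fact V)

lemma sym_rels_carrier: "sym_rels V \<subseteq> carrier (polys V)"
proof -
  interpret P: Module.module complex_ring "polys V" by (rule monoid_alg_module)
  have v: "sym_var v \<in> carrier (polys V)" if "v \<in> carrier V" for v
    using that by (auto simp: sym_var_def)
  have d: "p - q \<in> carrier (polys V)" if "p \<in> carrier (polys V)" "q \<in> carrier (polys V)" for p q
    using that keys_diff[of p q] by auto
  show ?thesis
    unfolding sym_rels_def
    using d[OF v P.M.a_closed[OF v v]] d[OF v P.smult_closed[OF _ v]]
    by (auto simp del: monoid_alg_simps(1))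
qed

lemma Sym_algebra: "algebra complex_ring (Sym V)"
  unfolding Sym_def by (rule quot_alg_algebra[OF polys_algebra sym_rels_carrier])

lemma sym_class_eq: "sym_class V p = (Idl\<^bsub>polys V\<^esub> (sym_rels V)) +>\<^bsub>polys V\<^esub> p"
  by (simp add: sym_class_def Let_def)

lemma Sym_simps:
  "carrier (Sym V) = sym_class V ` carrier (polys V)"
  "\<one>\<^bsub>Sym V\<^esub> = sym_class V (Poly_Mapping.single {#} 1)"
  "\<zero>\<^bsub>Sym V\<^esub> = sym_class V 0"
  unfolding Sym_def sym_class_eq[abs_def] quot_alg_simps[OF polys_algebra sym_rels_carrier] by auto

lemma Sym_ops:
  assumes "p \<in> carrier (polys V)" "q \<in> carrier (polys V)"
  shows "sym_class V p \<oplus>\<^bsub>Sym V\<^esub> sym_class V q = sym_class V (p + q)"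
    "sym_class V p \<otimes>\<^bsub>Sym V\<^esub> sym_class V q = sym_class V (p \<otimes>\<^bsub>polys V\<^esub> q)"
    "c \<odot>\<^bsub>Sym V\<^esub> sym_class V p = sym_class V (Poly_Mapping.map ((*) c) p)"
  unfolding Sym_def sym_class_eq[abs_def] quot_alg_ops[OF polys_algebra sym_rels_carrier assms]
  by auto

lemma Sym_Idl_subsetI:
  assumes "sym_rels V \<subseteq> J" "J \<subseteq> carrier (polys V)" "0 \<in> J"
    and "\<And>x y. x \<in> J \<Longrightarrow> y \<in> J \<Longrightarrow> x + y \<in> J"
    and "\<And>a x. a \<in> carrier (polys V) \<Longrightarrow> x \<in> J \<Longrightarrow> a \<otimes>\<^bsub>polys V\<^esub> x \<in> J"
  shows "Idl\<^bsub>polys V\<^esub> (sym_rels V) \<subseteq> J"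
  using Idl_subsetI[OF polys_algebra sym_rels_carrier, of J] assms by auto

lemma polys_mult_closed:
  "p \<in> carrier (polys V) \<Longrightarrow> q \<in> carrier (polys V) \<Longrightarrow> p \<otimes>\<^bsub>polys V\<^esub> q \<in> carrier (polys V)"
  using monoid_alg_closed[of "multisets_in (carrier V)" p q] by auto

lemma polys_add_closed:
  "p \<in> carrier (polys V) \<Longrightarrow> q \<in> carrier (polys V) \<Longrightarrow> p + q \<in> carrier (polys V)"
  using Poly_Mapping.keys_add[of p q] by auto

text \<open>Evaluation is multiplicative, so its kernel is an ideal, and linearity of f puts the
  relations into it.\<close>

lemma lin_ext_prod_vanish:
  assumes "lin_fun V f"
  shows "Idl\<^bsub>polys V\<^esub> (sym_rels V) \<subseteq>
    {p \<in> carrier (polys V). lin_ext (\<lambda>M. \<Prod>v\<in>#M. f v) p = 0}"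
proof (rule Sym_Idl_subsetI)
  show "sym_rels V \<subseteq> {p \<in> carrier (polys V). lin_ext (\<lambda>M. \<Prod>v\<in>#M. f v) p = 0}"
    using sym_rels_carrier
  proof (rule_tac subsetI, rule_tac CollectI, rule_tac conjI)
    fix r assume "r \<in> sym_rels V"
    then show "lin_ext (\<lambda>M. \<Prod>v\<in>#M. f v) r = 0"
      using assms by (auto simp: sym_rels_def sym_var_def lin_ext_diff lin_ext_add lin_ext_scale lin_fun_def)
  qed blast
qed (auto simp: lin_ext_add lin_ext_prod_mult polys_mult_closed polys_add_closed
      simp del: monoid_alg_simps(1), simp)

lemma sym_fun_class:
  assumes "lin_fun V f" "p \<in> carrier (polys V)"
  shows "sym_fun f (sym_class V p) = lin_ext (\<lambda>M. \<Prod>v\<in>#M. f v) p"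
  unfolding sym_fun_def sym_class_eq
  by (rule the_elem_coset[OF polys_algebra sym_rels_carrier assms(2)])
     (use lin_ext_prod_vanish[OF assms(1)] in \<open>auto simp: lin_ext_add\<close>)

text \<open>The kernel of \<open>der_ext f\<close> is no ideal, since this functional is not
  multiplicative. Its intersection with the kernel of the augmentation is one, by the Leibniz
  rule.\<close>

lemma sym_der_class:
  assumes f: "lin_fun V f" and p: "p \<in> carrier (polys V)"
  shows "sym_der f (sym_class V p) = der_ext f p"
proof -
  have "Idl\<^bsub>polys V\<^esub> (sym_rels V) \<subseteq>
      {p \<in> carrier (polys V). lin_ext (\<lambda>M. \<Prod>v\<in>#M. 0) p = 0 \<and> der_ext f p = 0}"
  proof (rule Sym_Idl_subsetI)
    show "sym_rels V \<subseteq> {p \<in> carrier (polys V). lin_ext (\<lambda>M. \<Prod>v\<in>#M. 0) p = 0 \<and> der_ext f p = 0}"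
      using sym_rels_carrier
    proof (rule_tac subsetI, rule_tac CollectI, rule_tac conjI)
      fix r assume "r \<in> sym_rels V"
      then show "lin_ext (\<lambda>M. \<Prod>v\<in>#M. 0) r = 0 \<and> der_ext f r = 0"
        using f by (auto simp: sym_rels_def sym_var_def lin_ext_diff lin_ext_add lin_ext_scale der_ext_def
            lin_fun_def)
    qed blast
  qed (auto simp: lin_ext_add lin_ext_prod_mult polys_mult_closed polys_add_closed der_ext_mult
        der_ext_def[THEN fun_cong, of f, symmetric]
        simp del: monoid_alg_simps(1) prod_mset_constant, simp_all add: der_ext_def lin_ext_add)
  then show ?thesis
    unfolding sym_der_def sym_class_eq der_ext_def
    by (intro the_elem_coset[OF polys_algebra sym_rels_carrier p]) (auto simp: lin_ext_add)
qed

end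

text \<open>\<open>push T\<close> is multiplicative and sends relations of V to relations of W,
  hence the ideal into the ideal.\<close>

lemma sym_map_class:
  fixes V :: "(complex, 'v, 'x) module_scheme" and W :: "(complex, 'w, 'y) module_scheme"
  assumes V: "Module.module complex_ring V" and W: "Module.module complex_ring W"
    and T: "T ` carrier V \<subseteq> carrier W"
    "\<And>x y. x \<in> carrier V \<Longrightarrow> y \<in> carrier V \<Longrightarrow> T (x \<oplus>\<^bsub>V\<^esub> y) = T x \<oplus>\<^bsub>W\<^esub> T y"
    "\<And>c x. x \<in> carrier V \<Longrightarrow> T (c \<odot>\<^bsub>V\<^esub> x) = c \<odot>\<^bsub>W\<^esub> T x"
    and p: "p \<in> carrier (polys V)"
  shows "sym_map W T (sym_class V p) = sym_class W (push T p)"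
proof -
  let ?I = "Idl\<^bsub>polys W\<^esub> (sym_rels W)"
  note algW = polys_algebra[of W] sym_rels_carrier[OF W]
  have "Idl\<^bsub>polys V\<^esub> (sym_rels V) \<subseteq> {p \<in> carrier (polys V). push T p \<in> ?I}"
  proof (rule Sym_Idl_subsetI[OF V])
    have "push T r \<in> sym_rels W" if "r \<in> sym_rels V" for r
    proof -
      from that consider v w where "r = sym_var (v \<oplus>\<^bsub>V\<^esub> w) - (sym_var v + sym_var w)" "v \<in> carrier V" "w \<in> carrier V"
        | c v where "r = sym_var (c \<odot>\<^bsub>V\<^esub> v) - Poly_Mapping.map ((*) c) (sym_var v)" "v \<in> carrier V"
        by (auto simp: sym_rels_def)
      then show ?thesis
      proof cases
        case 1
        then have "push T r = sym_var (T v \<oplus>\<^bsub>W\<^esub> T w) - (sym_var (T v) + sym_var (T w))"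
          by (simp add: push_diff push_add sym_var_def T)
        then show ?thesis unfolding sym_rels_def using T(1) 1 by blast
      next
        case 2
        then have "push T r = sym_var (c \<odot>\<^bsub>W\<^esub> T v) - Poly_Mapping.map ((*) c) (sym_var (T v))"
          by (simp add: push_diff push_scale sym_var_def T)
        then show ?thesis unfolding sym_rels_def using T(1) 2 by blast
      qed
    qed
    then show "sym_rels V \<subseteq> {p \<in> carrier (polys V). push T p \<in> ?I}"
      using sym_rels_carrier[OF V] Idl_self[OF algW] by blast
  next
    fix a x assume "a \<in> carrier (polys V)" "x \<in> {p \<in> carrier (polys V). push T p \<in> ?I}"
    then show "a \<otimes>\<^bsub>polys V\<^esub> x \<in> {p \<in> carrier (polys V). push T p \<in> ?I}"
      using Idl_closed(3)[OF algW push_carrier[OF T(1)]] polys_mult_closed[OF V]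
      by (simp add: push_mult[where W = W] del: monoid_alg_simps(1))
  next
    fix x y assume "x \<in> {p \<in> carrier (polys V). push T p \<in> ?I}" "y \<in> {p \<in> carrier (polys V). push T p \<in> ?I}"
    then show "x + y \<in> {p \<in> carrier (polys V). push T p \<in> ?I}"
      using Idl_closed(2)[OF algW] polys_add_closed[OF V] by (simp add: push_add del: monoid_alg_simps(1))
  qed (use Idl_closed(1)[OF algW] in auto)
  then have *: "sym_class W (push T (i + p)) = sym_class W (push T p)"
    if "i \<in> Idl\<^bsub>polys V\<^esub> (sym_rels V)" for i
    using coset_eqI[OF algW push_carrier[OF T(1) p], of "push T i"] that
    by (auto simp: push_add sym_class_eq[OF W])
  show ?thesis
    unfolding sym_map_def push_def[symmetric] sym_class_eq[OF V]
    by (rule Union_coset[OF polys_algebra sym_rels_carrier[OF V] p]) (use * in auto)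
qed

section \<open>Tensor products\<close>

text \<open>Characters are the points at which elements of symmetric algebras and their tensor
  products are evaluated.\<close>

definition character :: "(complex, 'v, 'x) module_scheme \<Rightarrow> ('v \<Rightarrow> complex) \<Rightarrow> bool" where
  "character S f \<longleftrightarrow> lin_fun S f \<and> f \<one>\<^bsub>S\<^esub> = 1 \<and>
     (\<forall>x\<in>carrier S. \<forall>y\<in>carrier S. f (x \<otimes>\<^bsub>S\<^esub> y) = f x * f y)"

abbreviation "tpolys S T \<equiv> monoid_alg (S \<times>\<times> T)"

definition tensor_class ::
  "(complex, 'a) module \<Rightarrow> (complex, 'b) module \<Rightarrow> ('a \<times> 'b \<Rightarrow>\<^sub>0 complex) \<Rightarrow> ('a \<times> 'b \<Rightarrow>\<^sub>0 complex) set"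
  where "tensor_class S T p = Idl\<^bsub>tpolys S T\<^esub> (tensor_rels S T) +>\<^bsub>tpolys S T\<^esub> p"

lemma DirProd_simps:
  "carrier (S \<times>\<times> T) = carrier S \<times> carrier T"
  "(x, y) \<otimes>\<^bsub>S \<times>\<times> T\<^esub> (x', y') = (x \<otimes>\<^bsub>S\<^esub> x', y \<otimes>\<^bsub>T\<^esub> y')"
  "\<one>\<^bsub>S \<times>\<times> T\<^esub> = (\<one>\<^bsub>S\<^esub>, \<one>\<^bsub>T\<^esub>)"
  by (auto simp: DirProd_def)

context
  fixes S :: "(complex, 'a) module" and T :: "(complex, 'b) module"
  assumes S: "algebra complex_ring S" and T: "algebra complex_ring T"
begin

interpretation S: cring S by (rule algebra.M_cring[OF S])
interpretation T: cring T by (rule algebra.M_cring[OF T])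
interpretation MS: Module.module complex_ring S by (rule algebra.module[OF S])
interpretation MT: Module.module complex_ring T by (rule algebra.module[OF T])

lemma DirProd_comm_monoid: "Group.comm_monoid (S \<times>\<times> T)"
  by (rule comm_monoidI)
     (auto simp: DirProd_simps S.m_assoc T.m_assoc intro: S.m_comm T.m_comm)

lemma tpolys_algebra: "algebra complex_ring (tpolys S T)"
  by (rule monoid_alg_algebra[OF DirProd_comm_monoid])

lemma tensor_rels_carrier: "tensor_rels S T \<subseteq> carrier (tpolys S T)"
proof -
  interpret PM: Module.module complex_ring "tpolys S T" by (rule monoid_alg_module)
  have v: "pure x y \<in> carrier (tpolys S T)" if "x \<in> carrier S" "y \<in> carrier T" for x y
    using that by (auto simp: pure_def DirProd_simps)
  have a: "p + q \<in> carrier (tpolys S T)" if "p \<in> carrier (tpolys S T)" "q \<in> carrier (tpolys S T)" for p q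
    using PM.M.a_closed that by simp
  have c: "Poly_Mapping.map ((*) c) p \<in> carrier (tpolys S T)" if "p \<in> carrier (tpolys S T)" for p c
    using PM.smult_closed[of c] that by simp
  have d: "p - q \<in> carrier (tpolys S T)" if "p \<in> carrier (tpolys S T)" "q \<in> carrier (tpolys S T)" for p q
    using that keys_diff[of p q] by auto
  show ?thesis
    unfolding tensor_rels_def by (auto simp del: monoid_alg_simps(1) intro!: v d a c)
qed

lemmas tquot = tpolys_algebra tensor_rels_carrier

lemma tensor_algebra: "algebra complex_ring (tensor S T)"
  unfolding tensor_def by (rule quot_alg_algebra[OF tquot])

lemma tensor_simps:
  "carrier (tensor S T) = tensor_class S T ` carrier (tpolys S T)"
  "\<one>\<^bsub>tensor S T\<^esub> = tensor_class S T (pure \<one>\<^bsub>S\<^esub> \<one>\<^bsub>T\<^esub>)"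
  "\<zero>\<^bsub>tensor S T\<^esub> = tensor_class S T 0"
  unfolding tensor_def tensor_class_def[abs_def] quot_alg_simps[OF tquot]
  by (auto simp: pure_def DirProd_simps)

lemma tensor_ops:
  assumes "p \<in> carrier (tpolys S T)" "q \<in> carrier (tpolys S T)"
  shows "tensor_class S T p \<oplus>\<^bsub>tensor S T\<^esub> tensor_class S T q = tensor_class S T (p + q)"
    "tensor_class S T p \<otimes>\<^bsub>tensor S T\<^esub> tensor_class S T q = tensor_class S T (p \<otimes>\<^bsub>tpolys S T\<^esub> q)"
    "c \<odot>\<^bsub>tensor S T\<^esub> tensor_class S T p = tensor_class S T (Poly_Mapping.map ((*) c) p)"
  unfolding tensor_def tensor_class_def[abs_def] quot_alg_ops[OF tquot assms] by auto

lemma tpolys_closed: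
  assumes "p \<in> carrier (tpolys S T)" "q \<in> carrier (tpolys S T)"
  shows "p \<otimes>\<^bsub>tpolys S T\<^esub> q \<in> carrier (tpolys S T)" "p + q \<in> carrier (tpolys S T)"
    "Poly_Mapping.map ((*) c) p \<in> carrier (tpolys S T)"
proof -
  interpret P: cring "tpolys S T" by (rule algebra.M_cring[OF tpolys_algebra])
  interpret PM: Module.module complex_ring "tpolys S T" by (rule monoid_alg_module)
  show "p \<otimes>\<^bsub>tpolys S T\<^esub> q \<in> carrier (tpolys S T)" using assms P.m_closed by blast
  show "p + q \<in> carrier (tpolys S T)" using P.a_closed assms by simp
  show "Poly_Mapping.map ((*) c) p \<in> carrier (tpolys S T)"
    using PM.smult_closed[of c p] assms by simp
qed

text \<open>For one fixed pair (f, g) the vanishing set is no ideal, because f and g are merely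
  linear. Multiplication by a pure tensor of x and y turns (f, g) into the pair of functionals f(x
  _) and g(y _), again linear; so the set \<open>?J\<close> quantifies over all pairs at
  once.\<close>

lemma lin_ext_tensor_vanish:
  assumes "p \<in> Idl\<^bsub>tpolys S T\<^esub> (tensor_rels S T)" "lin_fun S f" "lin_fun T g"
  shows "lin_ext (\<lambda>(x, y). f x * g y) p = 0"
proof -
  let ?J = "{p \<in> carrier (tpolys S T). \<forall>f g. lin_fun S f \<and> lin_fun T g \<longrightarrow>
      lin_ext (\<lambda>(x, y). f x * g y) p = 0}"
  have "Idl\<^bsub>tpolys S T\<^esub> (tensor_rels S T) \<subseteq> ?J"
  proof (rule Idl_subsetI[OF tquot])
    show "tensor_rels S T \<subseteq> ?J"
    proof
      fix r assume r: "r \<in> tensor_rels S T"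
      then have "lin_ext (\<lambda>(x, y). f x * g y) r = 0" if "lin_fun S f" "lin_fun T g" for f g
        using that
        by (auto simp: tensor_rels_def pure_def lin_ext_diff lin_ext_add lin_ext_scale lin_fun_def
            distrib_left distrib_right)
      then show "r \<in> ?J" using r tensor_rels_carrier by blast
    qed
  next
    fix a p assume a: "a \<in> carrier (tpolys S T)" and p: "p \<in> ?J"
    have "lin_ext (\<lambda>(x, y). f x * g y) (a \<otimes>\<^bsub>tpolys S T\<^esub> p) = 0" if fg: "lin_fun S f" "lin_fun T g" for f g
    proof -
      have pk: "Poly_Mapping.keys p \<subseteq> carrier S \<times> carrier T" using p by (auto simp: DirProd_simps)
      from a have "Poly_Mapping.keys a \<subseteq> carrier S \<times> carrier T" by (simp add: DirProd_simps)
      then show ?thesis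
      proof (induction a rule: pm_induct)
        case (add xy c a)
        obtain x y where xy: "xy = (x, y)" "x \<in> carrier S" "y \<in> carrier T" using add(1) by auto
        have l: "lin_fun S (\<lambda>x'. f (x \<otimes>\<^bsub>S\<^esub> x'))" "lin_fun T (\<lambda>y'. g (y \<otimes>\<^bsub>T\<^esub> y'))"
          using fg xy by (auto simp: lin_fun_def S.r_distr T.r_distr S.m_comm[of x] T.m_comm[of y]
              algebra.smult_assoc2[OF S] algebra.smult_assoc2[OF T] S.l_distr T.l_distr)
        have "lin_ext (\<lambda>(x, y). f x * g y) (Poly_Mapping.single xy c \<otimes>\<^bsub>tpolys S T\<^esub> p) =
            c * lin_ext (\<lambda>(x', y'). f (x \<otimes>\<^bsub>S\<^esub> x') * g (y \<otimes>\<^bsub>T\<^esub> y')) p"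
          by (induction p rule: pm_induct[OF subset_UNIV])
             (auto simp: monoid_alg_distrib_left monoid_alg_mult_single lin_ext_add DirProd_simps xy
               algebra_simps split_beta)
        also have "\<dots> = 0" using p l by auto
        finally show ?case using add(3) by (simp add: monoid_alg_distrib_right lin_ext_add)
      qed simp
    qed
    then show "a \<otimes>\<^bsub>tpolys S T\<^esub> p \<in> ?J" using a p tpolys_closed by blast
  next
    fix p q assume "p \<in> ?J" "q \<in> ?J"
    then show "p \<oplus>\<^bsub>tpolys S T\<^esub> q \<in> ?J" using tpolys_closed(2)[of p q] by (auto simp: lin_ext_add)
  qed auto
  then show ?thesis using assms by blast
qed

lemma tensor_fun_class:
  assumes "lin_fun S f" "lin_fun T g" "p \<in> carrier (tpolys S T)"
  shows "tensor_fun f g (tensor_class S T p) = lin_ext (\<lambda>(x, y). f x * g y) p"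
  unfolding tensor_fun_def tensor_class_def
  by (rule the_elem_coset[OF tquot assms(3)])
     (use lin_ext_tensor_vanish[OF _ assms(1,2)] in \<open>auto simp: lin_ext_add\<close>)

lemma lin_ext_tensor_mult:
  assumes f: "character S f" and g: "character T g"
    and p: "p \<in> carrier (tpolys S T)" and q: "q \<in> carrier (tpolys S T)"
  shows "lin_ext (\<lambda>(x, y). f x * g y) (p \<otimes>\<^bsub>tpolys S T\<^esub> q) =
     lin_ext (\<lambda>(x, y). f x * g y) p * lin_ext (\<lambda>(x, y). f x * g y) q"
proof -
  have q: "Poly_Mapping.keys q \<subseteq> carrier S \<times> carrier T" using q by (auto simp: DirProd_simps)
  have "Poly_Mapping.keys p \<subseteq> carrier S \<times> carrier T" using p by (auto simp: DirProd_simps)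
  then show ?thesis
  proof (induction p rule: pm_induct)
    case (add xy c p)
    obtain x y where xy: "xy = (x, y)" "x \<in> carrier S" "y \<in> carrier T" using add(1) by auto
    have "lin_ext (\<lambda>(x, y). f x * g y) (Poly_Mapping.single xy c \<otimes>\<^bsub>tpolys S T\<^esub> q) =
        c * f x * g y * lin_ext (\<lambda>(x, y). f x * g y) q"
      using q
    proof (induction q rule: pm_induct)
      case (add xy' c' q)
      obtain x' y' where "xy' = (x', y')" "x' \<in> carrier S" "y' \<in> carrier T" using add(1) by auto
      with add(3) f g xy show ?case
        by (simp add: monoid_alg_distrib_left monoid_alg_mult_single lin_ext_add DirProd_simps
            character_def algebra_simps)
    qed simp
    then show ?case using add(3)
      by (simp add: monoid_alg_distrib_right lin_ext_add xy algebra_simps)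
  qed simp
qed

lemma character_tensor:
  assumes f: "character S f" and g: "character T g"
  shows "character (tensor S T) (tensor_fun f g)"
proof -
  have l: "lin_fun S f" "lin_fun T g" using f g by (auto simp: character_def)
  note cl = tensor_fun_class[OF l]
  have pu: "pure \<one>\<^bsub>S\<^esub> \<one>\<^bsub>T\<^esub> \<in> carrier (tpolys S T)" by (auto simp: pure_def DirProd_simps)
  have "tensor_fun f g \<one>\<^bsub>tensor S T\<^esub> = 1"
    unfolding tensor_simps cl[OF pu] using f g by (simp add: pure_def character_def)
  then show ?thesis
    unfolding character_def lin_fun_def tensor_simps(1)
    by (auto simp: tensor_ops cl tpolys_closed lin_ext_add lin_ext_scale lin_ext_tensor_mult[OF f g]
        simp del: monoid_alg_simps(1))
qed

lemma tensor_fun_lin: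
  assumes l: "lin_fun S f" "lin_fun T g"
  shows "lin_fun (tensor S T) (tensor_fun f g)"
  unfolding lin_fun_def tensor_simps(1)
  by (auto simp: tensor_ops tensor_fun_class[OF l] tpolys_closed lin_ext_add lin_ext_scale
      simp del: monoid_alg_simps(1))

end

section \<open>Linear extension and linear selection\<close>

definition lext ::
  "(complex, 'w, 'y) module_scheme \<Rightarrow> ('a \<Rightarrow> 'w) \<Rightarrow> ('a \<Rightarrow>\<^sub>0 complex) \<Rightarrow> 'w" where
  "lext W m p = finsum W (\<lambda>x. Poly_Mapping.lookup p x \<odot>\<^bsub>W\<^esub> m x) (Poly_Mapping.keys p)"

context
  fixes W :: "(complex, 'w, 'y) module_scheme" (structure) and m :: "'a \<Rightarrow> 'w" and A
  assumes W: "Module.module complex_ring W" and m: "\<And>x. x \<in> A \<Longrightarrow> m x \<in> carrier W"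
begin

interpretation Module.module complex_ring W by (fact W)

lemma lext_superset:
  assumes "finite B" "Poly_Mapping.keys p \<subseteq> B" "B \<subseteq> A"
  shows "lext W m p = finsum W (\<lambda>x. Poly_Mapping.lookup p x \<odot> m x) B"
  unfolding lext_def
  by (rule M.add.finprod_mono_neutral_cong_left)
     (use assms m module_complexD[OF W] in \<open>auto simp: in_keys_iff\<close>)

lemma lext_closed: "Poly_Mapping.keys p \<subseteq> A \<Longrightarrow> lext W m p \<in> carrier W"
  unfolding lext_def using m module_complexD(7)[OF W] by (intro M.finsum_closed) auto

lemma lext_add:
  assumes "Poly_Mapping.keys p \<subseteq> A" "Poly_Mapping.keys q \<subseteq> A"
  shows "lext W m (p + q) = lext W m p \<oplus> lext W m q"
proof -
  let ?B = "Poly_Mapping.keys p \<union> Poly_Mapping.keys q"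
  have B: "finite ?B" "?B \<subseteq> A" using assms by auto
  have c: "(\<lambda>x. Poly_Mapping.lookup r x \<odot> m x) \<in> ?B \<rightarrow> carrier W" for r
    using m module_complexD(7)[OF W] B by auto
  have "lext W m (p + q) = finsum W (\<lambda>x. Poly_Mapping.lookup (p + q) x \<odot> m x) ?B"
    by (rule lext_superset) (use B Poly_Mapping.keys_add[of p q] in auto)
  also have "\<dots> = finsum W (\<lambda>x. Poly_Mapping.lookup p x \<odot> m x \<oplus> Poly_Mapping.lookup q x \<odot> m x) ?B"
    by (rule M.finsum_cong') (use m module_complexD[OF W] B in \<open>auto simp: lookup_add\<close>)
  also have "\<dots> = lext W m p \<oplus> lext W m q"
    unfolding M.finsum_addf[OF c c]
    by (subst (1 2) lext_superset[of ?B]) (use B in auto)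
  finally show ?thesis .
qed

lemma lext_zero [simp]: "lext W m 0 = \<zero>"
  by (simp add: lext_def)

lemma lext_single: "x \<in> A \<Longrightarrow> lext W m (Poly_Mapping.single x c) = c \<odot> m x"
  by (cases "c = 0") (use m module_complexD(12)[OF W] module_complexD(7)[OF W] in \<open>auto simp: lext_def\<close>)

lemma lext_scale:
  assumes "Poly_Mapping.keys p \<subseteq> A"
  shows "lext W m (Poly_Mapping.map ((*) c) p) = c \<odot> lext W m p"
  using assms
proof (induction p rule: pm_induct)
  case (add x d p)
  have k: "Poly_Mapping.keys (Poly_Mapping.single x e) \<subseteq> A" for e :: complex using add by simp
  have "Poly_Mapping.keys (Poly_Mapping.map ((*) c) p) \<subseteq> A"
    using add(2) keys_scale_subset[of c p] by blast
  with add k show ?case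
    using module_complexD(7,9,10)[OF W] m
    by (simp add: scale_add scale_single lext_add lext_single lext_closed)
qed (use module_complexD(13)[OF W] in simp)

end

text \<open>A total linear relation contains the graph of a linear map. It is obtained by Zorn's
  lemma on single-valued linear subrelations, which amounts to choosing values on a basis. Its
  purpose is to choose elements that represent polynomial functions linearly, without first proving
  them unique.\<close>

lemma linear_selection:
  fixes V :: "(complex, 'v, 'x) module_scheme" and W :: "(complex, 'w, 'y) module_scheme"
  assumes V: "Module.module complex_ring V" and W: "Module.module complex_ring W"
    and total: "\<And>v. v \<in> carrier V \<Longrightarrow> \<exists>w\<in>carrier W. R v w"
    and add: "\<And>v w v' w'. R v w \<Longrightarrow> R v' w' \<Longrightarrow> v \<in> carrier V \<Longrightarrow> w \<in> carrier W \<Longrightarrow>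
       v' \<in> carrier V \<Longrightarrow> w' \<in> carrier W \<Longrightarrow> R (v \<oplus>\<^bsub>V\<^esub> v') (w \<oplus>\<^bsub>W\<^esub> w')"
    and scale: "\<And>c v w. R v w \<Longrightarrow> v \<in> carrier V \<Longrightarrow> w \<in> carrier W \<Longrightarrow> R (c \<odot>\<^bsub>V\<^esub> v) (c \<odot>\<^bsub>W\<^esub> w)"
  obtains s where "\<And>v. v \<in> carrier V \<Longrightarrow> s v \<in> carrier W \<and> R v (s v)"
    "\<And>v v'. v \<in> carrier V \<Longrightarrow> v' \<in> carrier V \<Longrightarrow> s (v \<oplus>\<^bsub>V\<^esub> v') = s v \<oplus>\<^bsub>W\<^esub> s v'"
    "\<And>c v. v \<in> carrier V \<Longrightarrow> s (c \<odot>\<^bsub>V\<^esub> v) = c \<odot>\<^bsub>W\<^esub> s v"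
proof -
  note v = module_complexD[OF V] and w = module_complexD[OF W]
  define graph where "graph G \<longleftrightarrow> (\<zero>\<^bsub>V\<^esub>, \<zero>\<^bsub>W\<^esub>) \<in> G \<and>
    (\<forall>v w. (v, w) \<in> G \<longrightarrow> v \<in> carrier V \<and> w \<in> carrier W \<and> R v w) \<and>
    (\<forall>v w v' w'. (v, w) \<in> G \<longrightarrow> (v', w') \<in> G \<longrightarrow> (v \<oplus>\<^bsub>V\<^esub> v', w \<oplus>\<^bsub>W\<^esub> w') \<in> G) \<and>
    (\<forall>c v w. (v, w) \<in> G \<longrightarrow> (c \<odot>\<^bsub>V\<^esub> v, c \<odot>\<^bsub>W\<^esub> w) \<in> G) \<and>
    (\<forall>v w w'. (v, w) \<in> G \<longrightarrow> (v, w') \<in> G \<longrightarrow> w = w')" for G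
  have "\<exists>M\<in>Collect graph. \<forall>X\<in>Collect graph. M \<subseteq> X \<longrightarrow> X = M"
  proof (rule subset_Zorn_nonempty)
    \<comment> \<open>Totality gives some value at zero; scaling it by 0 shows that zero itself is
      an admissible value.\<close>
    obtain w0 where "w0 \<in> carrier W" "R \<zero>\<^bsub>V\<^esub> w0" using total v(1) by blast
    then have "R \<zero>\<^bsub>V\<^esub> \<zero>\<^bsub>W\<^esub>" using scale[of "\<zero>\<^bsub>V\<^esub>" w0 0] v(1,13) w(12) by simp
    then have "graph {(\<zero>\<^bsub>V\<^esub>, \<zero>\<^bsub>W\<^esub>)}" by (simp add: graph_def v(1,5,13) w(1,5,13))
    then show "Collect graph \<noteq> {}" by blast
  next
    fix C assume ne: "C \<noteq> {}" and C: "subset.chain (Collect graph) C"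
    then have g: "\<And>G. G \<in> C \<Longrightarrow> graph G" by (auto simp: subset.chain_def)
    have two: "\<exists>G\<in>C. a \<in> G \<and> b \<in> G" if ab: "a \<in> \<Union>C" "b \<in> \<Union>C" for a b
    proof -
      obtain G H where GH: "G \<in> C" "a \<in> G" "H \<in> C" "b \<in> H" using ab by blast
      then have "G \<subseteq> H \<or> H \<subseteq> G" using C by (simp add: subset_chain_def)
      then show ?thesis using GH by (meson subsetD)
    qed
    show "\<Union>C \<in> Collect graph"
      unfolding graph_def mem_Collect_eq
    proof (intro conjI impI allI)
      show "(\<zero>\<^bsub>V\<^esub>, \<zero>\<^bsub>W\<^esub>) \<in> \<Union>C" using ne g by (auto simp: graph_def)
    next
      fix a b assume "(a, b) \<in> \<Union>C"
      then obtain G where "graph G" "(a, b) \<in> G" using g by blast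
      then show "a \<in> carrier V" "b \<in> carrier W" "R a b" unfolding graph_def by simp_all
    next
      fix a b a' b' assume "(a, b) \<in> \<Union>C" "(a', b') \<in> \<Union>C"
      then obtain H where "H \<in> C" "(a, b) \<in> H" "(a', b') \<in> H" using two by blast
      then show "(a \<oplus>\<^bsub>V\<^esub> a', b \<oplus>\<^bsub>W\<^esub> b') \<in> \<Union>C" using g[of H] unfolding graph_def by (metis UnionI)
    next
      fix c a b assume "(a, b) \<in> \<Union>C"
      then obtain G where "G \<in> C" "graph G" "(a, b) \<in> G" using g by blast
      then show "(c \<odot>\<^bsub>V\<^esub> a, c \<odot>\<^bsub>W\<^esub> b) \<in> \<Union>C" unfolding graph_def by (metis UnionI)
    next
      fix a b b' assume "(a, b) \<in> \<Union>C" "(a, b') \<in> \<Union>C"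
      then obtain H where "H \<in> C" "(a, b) \<in> H" "(a, b') \<in> H" using two by blast
      then show "b = b'" using g[of H] unfolding graph_def by (metis UnionI)
    qed
  qed
  then obtain G where G: "graph G" and max: "\<And>X. graph X \<Longrightarrow> G \<subseteq> X \<Longrightarrow> X = G" by blast
  from G have G0: "(\<zero>\<^bsub>V\<^esub>, \<zero>\<^bsub>W\<^esub>) \<in> G"
    and Gc: "\<And>v w. (v, w) \<in> G \<Longrightarrow> v \<in> carrier V" "\<And>v w. (v, w) \<in> G \<Longrightarrow> w \<in> carrier W"
      "\<And>v w. (v, w) \<in> G \<Longrightarrow> R v w"
    and Ga: "\<And>v w v' w'. (v, w) \<in> G \<Longrightarrow> (v', w') \<in> G \<Longrightarrow> (v \<oplus>\<^bsub>V\<^esub> v', w \<oplus>\<^bsub>W\<^esub> w') \<in> G"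
    and Gs: "\<And>c v w. (v, w) \<in> G \<Longrightarrow> (c \<odot>\<^bsub>V\<^esub> v, c \<odot>\<^bsub>W\<^esub> w) \<in> G"
    and Gf: "\<And>v w w'. (v, w) \<in> G \<Longrightarrow> (v, w') \<in> G \<Longrightarrow> w = w'"
    unfolding graph_def by simp_all
  have dom: "\<exists>w. (v0, w) \<in> G" if v0: "v0 \<in> carrier V" for v0
  proof (rule ccontr)
    assume no: "\<nexists>w. (v0, w) \<in> G"
    obtain w0 where w0: "w0 \<in> carrier W" "R v0 w0" using total v0 by blast
    interpret V: Module.module complex_ring V by (fact V)
    interpret W: Module.module complex_ring W by (fact W)
    \<comment> \<open>Extension of a maximal graph by one dimension, sending \<open>v0\<close> to
      \<open>w0\<close>.\<close>
    define H where "H = {(a \<oplus>\<^bsub>V\<^esub> c \<odot>\<^bsub>V\<^esub> v0, b \<oplus>\<^bsub>W\<^esub> c \<odot>\<^bsub>W\<^esub> w0) |a b c. (a, b) \<in> G}"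
    have HI: "(a \<oplus>\<^bsub>V\<^esub> c \<odot>\<^bsub>V\<^esub> v0, b \<oplus>\<^bsub>W\<^esub> c \<odot>\<^bsub>W\<^esub> w0) \<in> H" if "(a, b) \<in> G" for a b c
      using that H_def by blast
    \<comment> \<open>Two different representations would put a nonzero multiple of
      \<open>v0\<close>, hence \<open>v0\<close> itself, into the domain of G.\<close>
    have unique: "c = c' \<and> a = a'"
      if ab: "(a, b) \<in> G" "(a', b') \<in> G" and eq: "a \<oplus>\<^bsub>V\<^esub> c \<odot>\<^bsub>V\<^esub> v0 = a' \<oplus>\<^bsub>V\<^esub> c' \<odot>\<^bsub>V\<^esub> v0"
      for a b c a' b' c'
    proof -
      have cV: "a \<in> carrier V" "a' \<in> carrier V" using Gc(1)[OF ab(1)] Gc(1)[OF ab(2)] .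
      have "(c - c') \<odot>\<^bsub>V\<^esub> v0 = a' \<oplus>\<^bsub>V\<^esub> (-1) \<odot>\<^bsub>V\<^esub> a"
      proof -
        have e1: "(-c') \<odot>\<^bsub>V\<^esub> v0 \<oplus>\<^bsub>V\<^esub> c' \<odot>\<^bsub>V\<^esub> v0 = \<zero>\<^bsub>V\<^esub>" "(-1) \<odot>\<^bsub>V\<^esub> a \<oplus>\<^bsub>V\<^esub> a = \<zero>\<^bsub>V\<^esub>"
          using v(8)[of v0 "-c'" c', symmetric] v(8)[of a "-1" 1, symmetric] v0 cV v(11,12) by auto
        have "(c - c') \<odot>\<^bsub>V\<^esub> v0 = c \<odot>\<^bsub>V\<^esub> v0 \<oplus>\<^bsub>V\<^esub> (-c') \<odot>\<^bsub>V\<^esub> v0"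
          using v(8)[of v0 c "-c'"] v0 by simp
        also have "\<dots> = ((-1) \<odot>\<^bsub>V\<^esub> a \<oplus>\<^bsub>V\<^esub> a) \<oplus>\<^bsub>V\<^esub> (c \<odot>\<^bsub>V\<^esub> v0 \<oplus>\<^bsub>V\<^esub> (-c') \<odot>\<^bsub>V\<^esub> v0)"
          using e1 v0 cV v(2,5,7) by simp
        also have "\<dots> = (a \<oplus>\<^bsub>V\<^esub> c \<odot>\<^bsub>V\<^esub> v0) \<oplus>\<^bsub>V\<^esub> ((-1) \<odot>\<^bsub>V\<^esub> a \<oplus>\<^bsub>V\<^esub> (-c') \<odot>\<^bsub>V\<^esub> v0)"
          using v0 cV v(7) by (simp add: V.M.a_ac)
        also have "\<dots> = ((-c') \<odot>\<^bsub>V\<^esub> v0 \<oplus>\<^bsub>V\<^esub> c' \<odot>\<^bsub>V\<^esub> v0) \<oplus>\<^bsub>V\<^esub> (a' \<oplus>\<^bsub>V\<^esub> (-1) \<odot>\<^bsub>V\<^esub> a)"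
          unfolding eq using v0 cV v(7) by (simp add: V.M.a_ac)
        finally show ?thesis using e1 v0 cV v(2,5,7) by simp
      qed
      then have "((c - c') \<odot>\<^bsub>V\<^esub> v0, b' \<oplus>\<^bsub>W\<^esub> (-1) \<odot>\<^bsub>W\<^esub> b) \<in> G" using Ga[OF ab(2) Gs[OF ab(1)]] by simp
      from Gs[OF this, of "1 / (c - c')"] have "c = c'"
        using no v(10)[OF v0, of "1 / (c - c')" "c - c'"] v(11)[OF v0]
        by (cases "c = c'") auto
      then show ?thesis using eq V.M.add.right_cancel[of "c' \<odot>\<^bsub>V\<^esub> v0" a a'] cV v0 v(7) by simp
    qed
    have "graph H"
      unfolding graph_def
    proof (intro conjI impI allI)
      show "(\<zero>\<^bsub>V\<^esub>, \<zero>\<^bsub>W\<^esub>) \<in> H" using HI[OF G0, of 0] v0 w0 v(1,5,12) w(1,5,12) by simp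
    next
      fix a b assume "(a, b) \<in> H"
      then obtain x y c where xy: "(x, y) \<in> G" and ab: "a = x \<oplus>\<^bsub>V\<^esub> c \<odot>\<^bsub>V\<^esub> v0" "b = y \<oplus>\<^bsub>W\<^esub> c \<odot>\<^bsub>W\<^esub> w0"
        by (auto simp: H_def)
      then show "a \<in> carrier V" "b \<in> carrier W" "R a b"
        using v0 w0 v(2,7) w(2,7) Gc[OF xy] add[OF Gc(3)[OF xy] scale[OF w0(2) v0 w0(1)]] by simp_all
    next
      fix a b a' b' assume "(a, b) \<in> H" "(a', b') \<in> H"
      then obtain x y c x' y' c' where xy: "(x, y) \<in> G" "(x', y') \<in> G" and ab:
        "a = x \<oplus>\<^bsub>V\<^esub> c \<odot>\<^bsub>V\<^esub> v0" "b = y \<oplus>\<^bsub>W\<^esub> c \<odot>\<^bsub>W\<^esub> w0"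
        "a' = x' \<oplus>\<^bsub>V\<^esub> c' \<odot>\<^bsub>V\<^esub> v0" "b' = y' \<oplus>\<^bsub>W\<^esub> c' \<odot>\<^bsub>W\<^esub> w0"
        by (auto simp: H_def)
      have "a \<oplus>\<^bsub>V\<^esub> a' = (x \<oplus>\<^bsub>V\<^esub> x') \<oplus>\<^bsub>V\<^esub> (c + c') \<odot>\<^bsub>V\<^esub> v0"
        "b \<oplus>\<^bsub>W\<^esub> b' = (y \<oplus>\<^bsub>W\<^esub> y') \<oplus>\<^bsub>W\<^esub> (c + c') \<odot>\<^bsub>W\<^esub> w0"
        using ab Gc[OF xy(1)] Gc[OF xy(2)] v0 w0 v(7) w(7)
        by (simp_all add: v(8) w(8) V.M.a_ac W.M.a_ac)
      then show "(a \<oplus>\<^bsub>V\<^esub> a', b \<oplus>\<^bsub>W\<^esub> b') \<in> H" using HI[OF Ga[OF xy]] by simp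
    next
      fix d a b assume "(a, b) \<in> H"
      then obtain x y c where xy: "(x, y) \<in> G" and ab: "a = x \<oplus>\<^bsub>V\<^esub> c \<odot>\<^bsub>V\<^esub> v0" "b = y \<oplus>\<^bsub>W\<^esub> c \<odot>\<^bsub>W\<^esub> w0"
        by (auto simp: H_def)
      have "d \<odot>\<^bsub>V\<^esub> a = d \<odot>\<^bsub>V\<^esub> x \<oplus>\<^bsub>V\<^esub> (d * c) \<odot>\<^bsub>V\<^esub> v0" "d \<odot>\<^bsub>W\<^esub> b = d \<odot>\<^bsub>W\<^esub> y \<oplus>\<^bsub>W\<^esub> (d * c) \<odot>\<^bsub>W\<^esub> w0"
        using ab Gc[OF xy] v0 w0 v(7,9,10) w(7,9,10) by simp_all
      then show "(d \<odot>\<^bsub>V\<^esub> a, d \<odot>\<^bsub>W\<^esub> b) \<in> H" using HI[OF Gs[OF xy]] by simp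
    next
      fix a b b' assume "(a, b) \<in> H" "(a, b') \<in> H"
      then obtain x y c x' y' c' where xy: "(x, y) \<in> G" "(x', y') \<in> G" and ab:
        "a = x \<oplus>\<^bsub>V\<^esub> c \<odot>\<^bsub>V\<^esub> v0" "b = y \<oplus>\<^bsub>W\<^esub> c \<odot>\<^bsub>W\<^esub> w0"
        "a = x' \<oplus>\<^bsub>V\<^esub> c' \<odot>\<^bsub>V\<^esub> v0" "b' = y' \<oplus>\<^bsub>W\<^esub> c' \<odot>\<^bsub>W\<^esub> w0"
        unfolding H_def by blast
      have "x \<oplus>\<^bsub>V\<^esub> c \<odot>\<^bsub>V\<^esub> v0 = x' \<oplus>\<^bsub>V\<^esub> c' \<odot>\<^bsub>V\<^esub> v0" using ab(1,3) by metis
      then have "c = c' \<and> x = x'" by (rule unique[OF xy])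
      then show "b = b'" using Gf xy ab by blast
    qed
    moreover have "G \<subseteq> H"
    proof
      fix x assume x: "x \<in> G"
      obtain a b where "x = (a, b)" by (cases x)
      then show "x \<in> H" using HI[of a b 0] x Gc[of a b] v0 w0 v(6,12) w(6,12) by simp
    qed
    ultimately have "H = G" by (rule max)
    moreover have "(v0, w0) \<in> H" using HI[OF G0, of 1] v0 w0 v(5,11) w(5,11) by simp
    ultimately show False using no by blast
  qed
  define s where "s v = (THE w. (v, w) \<in> G)" for v
  have s: "(v, w) \<in> G \<Longrightarrow> s v = w" for v w unfolding s_def using Gf by (intro the_equality) auto
  show ?thesis
  proof (rule that)
    show "s v \<in> carrier W \<and> R v (s v)" if v: "v \<in> carrier V" for v
      using dom[OF v] s Gc by auto
    show "s (v \<oplus>\<^bsub>V\<^esub> v') = s v \<oplus>\<^bsub>W\<^esub> s v'" if "v \<in> carrier V" "v' \<in> carrier V" for v v'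
    proof -
      obtain w w' where "(v, w) \<in> G" "(v', w') \<in> G" using dom \<open>v \<in> carrier V\<close> \<open>v' \<in> carrier V\<close> by metis
      then show ?thesis using s[OF Ga] s by simp
    qed
    show "s (c \<odot>\<^bsub>V\<^esub> v) = c \<odot>\<^bsub>W\<^esub> s v" if v: "v \<in> carrier V" for c v
    proof -
      obtain w where "(v, w) \<in> G" using dom[OF v] by blast
      then show ?thesis using s[OF Gs] s by simp
    qed
  qed
qed

definition sym_monom :: "(complex, 'w, 'y) module_scheme \<Rightarrow> ('v \<Rightarrow> 'w) \<Rightarrow> 'v multiset \<Rightarrow> 'w" where
  "sym_monom W s M = finprod W (\<lambda>v. s v [^]\<^bsub>W\<^esub> count M v) (set_mset M)"

text \<open>The universal property of S(V) for commutative algebras: evaluate monomials, extend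
  linearly, and descend because linearity of s kills the relations.\<close>

lemma Sym_extension:
  fixes V :: "(complex, 'v, 'x) module_scheme" and W :: "(complex, 'w) module"
  assumes V: "Module.module complex_ring V" and W: "algebra complex_ring W"
    and s: "\<And>v. v \<in> carrier V \<Longrightarrow> s v \<in> carrier W"
    "\<And>v v'. v \<in> carrier V \<Longrightarrow> v' \<in> carrier V \<Longrightarrow> s (v \<oplus>\<^bsub>V\<^esub> v') = s v \<oplus>\<^bsub>W\<^esub> s v'"
    "\<And>c v. v \<in> carrier V \<Longrightarrow> s (c \<odot>\<^bsub>V\<^esub> v) = c \<odot>\<^bsub>W\<^esub> s v"
  obtains h where "unital_alg_hom (Sym V) W h" "\<And>v. v \<in> carrier V \<Longrightarrow> h (sym_emb V v) = s v"
proof -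
  interpret W: cring W by (rule algebra.M_cring[OF W])
  note Wm = algebra.module[OF W] and sa2 = algebra.smult_assoc2[OF W, simplified]
  note w = module_complexD[OF Wm]
  let ?A = "{M. set_mset M \<subseteq> carrier V}"
  have pow: "s v [^]\<^bsub>W\<^esub> (n::nat) \<in> carrier W" if "v \<in> carrier V" for v n using s(1)[OF that] by simp
  have mon: "sym_monom W s M \<in> carrier W" if "M \<in> ?A" for M
    using that pow unfolding sym_monom_def by (intro W.finprod_closed) auto
  \<comment> \<open>Enlarging the index set adds only factors with exponent 0, so two monomials can
    be multiplied over the union of their supports.\<close>
  have mon_super: "sym_monom W s M = finprod W (\<lambda>v. s v [^]\<^bsub>W\<^esub> count M v) B"
    if "finite B" "set_mset M \<subseteq> B" "B \<subseteq> carrier V" for M B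
    unfolding sym_monom_def
    by (rule W.finprod_mono_neutral_cong_left) (use that pow in \<open>auto simp: not_in_iff\<close>)
  have mon_add: "sym_monom W s (M + N) = sym_monom W s M \<otimes>\<^bsub>W\<^esub> sym_monom W s N" if MN: "M \<in> ?A" "N \<in> ?A" for M N
  proof -
    let ?B = "set_mset M \<union> set_mset N"
    have B: "finite ?B" "?B \<subseteq> carrier V" using MN by auto
    have c: "(\<lambda>v. s v [^]\<^bsub>W\<^esub> count K v) \<in> ?B \<rightarrow> carrier W" for K using B pow by auto
    have "sym_monom W s (M + N) = finprod W (\<lambda>v. s v [^]\<^bsub>W\<^esub> count (M + N) v) ?B"
      by (rule mon_super) (use B in auto)
    also have "\<dots> = finprod W (\<lambda>v. s v [^]\<^bsub>W\<^esub> count M v \<otimes>\<^bsub>W\<^esub> s v [^]\<^bsub>W\<^esub> count N v) ?B"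
      by (rule W.finprod_cong') (use B s(1) pow in \<open>auto simp: W.nat_pow_mult\<close>)
    also have "\<dots> = sym_monom W s M \<otimes>\<^bsub>W\<^esub> sym_monom W s N"
      unfolding W.finprod_multf[OF c c] by (subst (1 2) mon_super[of ?B]) (use B in auto)
    finally show ?thesis .
  qed
  have mon_1: "sym_monom W s {#v#} = s v" if "v \<in> carrier V" for v
    using s(1)[OF that] by (simp add: sym_monom_def)
  have mon_0: "sym_monom W s {#} = \<one>\<^bsub>W\<^esub>" by (simp add: sym_monom_def)
  let ?h = "lext W (sym_monom W s)"
  note L = Wm mon
  have keys: "Poly_Mapping.keys p \<subseteq> ?A" if "p \<in> carrier (polys V)" for p using that by simp
  have hc: "?h p \<in> carrier W" if "p \<in> carrier (polys V)" for p
    using lext_closed[OF L keys[OF that]] .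
  have ha: "?h (p + q) = ?h p \<oplus>\<^bsub>W\<^esub> ?h q" if "p \<in> carrier (polys V)" "q \<in> carrier (polys V)" for p q
    using lext_add[OF L keys[OF that(1)] keys[OF that(2)]] .
  have hs: "?h (Poly_Mapping.map ((*) c) p) = c \<odot>\<^bsub>W\<^esub> ?h p" if "p \<in> carrier (polys V)" for c p
    using lext_scale[OF L keys[OF that]] .
  have h1: "?h (Poly_Mapping.single M c) = c \<odot>\<^bsub>W\<^esub> sym_monom W s M" if "M \<in> ?A" for M c
    using lext_single[OF L that] .
  have h0: "?h 0 = \<zero>\<^bsub>W\<^esub>" by (rule lext_zero[OF L])
  have sg: "Poly_Mapping.single M c \<in> carrier (polys V)" if "M \<in> ?A" for M c using that by auto
  have hm: "?h (p \<otimes>\<^bsub>polys V\<^esub> q) = ?h p \<otimes>\<^bsub>W\<^esub> ?h q"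
    if p: "p \<in> carrier (polys V)" and q: "q \<in> carrier (polys V)" for p q
    using keys[OF p]
  proof (induction p rule: pm_induct)
    case (add M c p)
    have p: "p \<in> carrier (polys V)" using add(2) by simp
    have "?h (Poly_Mapping.single M c \<otimes>\<^bsub>polys V\<^esub> q) = ?h (Poly_Mapping.single M c) \<otimes>\<^bsub>W\<^esub> ?h q"
      using keys[OF q]
    proof (induction q rule: pm_induct)
      case (add N d q)
      have q: "q \<in> carrier (polys V)" using add(2) by simp
      have MN: "M \<in> ?A" "N \<in> ?A" "M + N \<in> ?A" using add(1) \<open>M \<in> ?A\<close> by auto
      have "?h (Poly_Mapping.single M c \<otimes>\<^bsub>polys V\<^esub> (Poly_Mapping.single N d + q)) =
         ?h (Poly_Mapping.single (M + N) (c * d) + Poly_Mapping.single M c \<otimes>\<^bsub>polys V\<^esub> q)"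
        by (simp add: monoid_alg_distrib_left monoid_alg_mult_single)
      also have "\<dots> = (c * d) \<odot>\<^bsub>W\<^esub> (sym_monom W s M \<otimes>\<^bsub>W\<^esub> sym_monom W s N) \<oplus>\<^bsub>W\<^esub>
          ?h (Poly_Mapping.single M c) \<otimes>\<^bsub>W\<^esub> ?h q"
        unfolding ha[OF sg[OF MN(3)] polys_mult_closed[OF V sg[OF MN(1)] q]] h1[OF MN(3)] mon_add[OF MN(1,2)]
          add(3) ..
      also have "(c * d) \<odot>\<^bsub>W\<^esub> (sym_monom W s M \<otimes>\<^bsub>W\<^esub> sym_monom W s N) =
          ?h (Poly_Mapping.single M c) \<otimes>\<^bsub>W\<^esub> ?h (Poly_Mapping.single N d)"
      proof -
        note m = mon[OF MN(1)] mon[OF MN(2)]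
        have "(c \<odot>\<^bsub>W\<^esub> sym_monom W s M) \<otimes>\<^bsub>W\<^esub> (d \<odot>\<^bsub>W\<^esub> sym_monom W s N) =
            c \<odot>\<^bsub>W\<^esub> (sym_monom W s M \<otimes>\<^bsub>W\<^esub> (d \<odot>\<^bsub>W\<^esub> sym_monom W s N))"
          using m w(7) sa2 by blast
        also have "\<dots> = c \<odot>\<^bsub>W\<^esub> ((d \<odot>\<^bsub>W\<^esub> sym_monom W s N) \<otimes>\<^bsub>W\<^esub> sym_monom W s M)"
          using m w(7) W.m_comm by metis
        also have "\<dots> = c \<odot>\<^bsub>W\<^esub> (d \<odot>\<^bsub>W\<^esub> (sym_monom W s N \<otimes>\<^bsub>W\<^esub> sym_monom W s M))"
          using m sa2 by metis
        also have "\<dots> = (c * d) \<odot>\<^bsub>W\<^esub> (sym_monom W s M \<otimes>\<^bsub>W\<^esub> sym_monom W s N)"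
          using m w(10) W.m_comm W.m_closed by metis
        finally show ?thesis unfolding h1[OF MN(1)] h1[OF MN(2)] by (rule sym)
      qed
      also have "\<dots> \<oplus>\<^bsub>W\<^esub> ?h (Poly_Mapping.single M c) \<otimes>\<^bsub>W\<^esub> ?h q =
          ?h (Poly_Mapping.single M c) \<otimes>\<^bsub>W\<^esub> ?h (Poly_Mapping.single N d + q)"
        unfolding ha[OF sg[OF MN(2)] q] using hc[OF sg] MN hc[OF q] by (simp add: W.r_distr)
      finally show ?case .
    qed (simp add: h0 hc[OF sg[OF add(1)]])
    then show ?case
      using add(3) ha[OF sg[OF add(1)] p] hc[OF sg[OF add(1)]] hc[OF p] hc[OF q]
        ha[OF polys_mult_closed[OF V sg[OF add(1)] q] polys_mult_closed[OF V p q]]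
      by (simp add: monoid_alg_distrib_right W.l_distr)
  qed (simp add: h0 hc[OF q])
  have van: "Idl\<^bsub>polys V\<^esub> (sym_rels V) \<subseteq> {p \<in> carrier (polys V). ?h p = \<zero>\<^bsub>W\<^esub>}"
  proof (rule Sym_Idl_subsetI[OF V])
    note v = module_complexD[OF V]
    have var: "sym_var v \<in> carrier (polys V)" "?h (sym_var v) = s v" if "v \<in> carrier V" for v
      using that h1[of "{#v#}" 1] mon_1[OF that] s(1)[OF that] w(11) by (auto simp: sym_var_def)
    have sub: "?h (p - q) = \<zero>\<^bsub>W\<^esub>" if "p - q \<in> carrier (polys V)" "q \<in> carrier (polys V)" "?h p = ?h q" for p q
      using ha[OF that(1,2)] that(3) hc[OF that(1)] hc[OF that(2)] by simp
    have "?h r = \<zero>\<^bsub>W\<^esub>" if r: "r \<in> sym_rels V" for r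
    proof -
      have rc: "r \<in> carrier (polys V)" using r sym_rels_carrier[OF V] by blast
      from r consider v w where "r = sym_var (v \<oplus>\<^bsub>V\<^esub> w) - (sym_var v + sym_var w)" "v \<in> carrier V" "w \<in> carrier V"
        | c v where "r = sym_var (c \<odot>\<^bsub>V\<^esub> v) - Poly_Mapping.map ((*) c) (sym_var v)" "v \<in> carrier V"
        by (auto simp: sym_rels_def)
      then show ?thesis
      proof cases
        case 1
        then show ?thesis
          using sub[of "sym_var (v \<oplus>\<^bsub>V\<^esub> w)" "sym_var v + sym_var w"] rc polys_add_closed[OF V] var v(2) s(2) ha
          by simp
      next
        case 2
        have "Poly_Mapping.map ((*) c) (sym_var v) \<in> carrier (polys V)"
          using var(1)[OF 2(2)] keys_scale_subset[of c "sym_var v"] by auto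
        with 2 show ?thesis
          using sub[of "sym_var (c \<odot>\<^bsub>V\<^esub> v)" "Poly_Mapping.map ((*) c) (sym_var v)"] rc var v(7) s(3) hs
          by simp
      qed
    qed
    then show "sym_rels V \<subseteq> {p \<in> carrier (polys V). ?h p = \<zero>\<^bsub>W\<^esub>}"
      using sym_rels_carrier[OF V] by blast
  qed (use h0 ha hm hc polys_add_closed[OF V] polys_mult_closed[OF V] in
        \<open>auto simp del: monoid_alg_simps(1)\<close>, simp)
  define h where "h X = the_elem (?h ` X)" for X
  have h: "h (sym_class V p) = ?h p" if p: "p \<in> carrier (polys V)" for p
    unfolding h_def sym_class_eq[OF V]
  proof (rule the_elem_coset[OF polys_algebra sym_rels_carrier[OF V] p])
    fix i assume "i \<in> Idl\<^bsub>polys V\<^esub> (sym_rels V)"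
    then have "i \<in> carrier (polys V)" "?h i = \<zero>\<^bsub>W\<^esub>" using van by blast+
    then show "?h (i \<oplus>\<^bsub>polys V\<^esub> p) = ?h p" using ha[OF _ p] hc[OF p] by simp
  qed
  show ?thesis
  proof
    have cl: "Poly_Mapping.map ((*) c) p \<in> carrier (polys V)" if "p \<in> carrier (polys V)" for c p
      using that keys_scale_subset[of c p] by auto
    show "unital_alg_hom (Sym V) W h"
      unfolding unital_alg_hom_def alg_hom_def Sym_simps[OF V]
    proof (intro conjI ballI allI)
      show "h (sym_class V (Poly_Mapping.single {#} 1)) = \<one>\<^bsub>W\<^esub>"
        using h[OF sg[of "{#}" 1]] h1[of "{#}" 1] mon_0 w(11) by simp
    qed (auto simp: Sym_ops[OF V] h hc ha hs hm cl polys_add_closed[OF V] polys_mult_closed[OF V]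
          simp del: monoid_alg_simps(1))
    show "h (sym_emb V v) = s v" if "v \<in> carrier V" for v
      using h[OF sg[of "{#v#}" 1]] h1[of "{#v#}" 1] mon_1[OF that] that s(1)[OF that] w(11)
      by (simp add: sym_emb_def sym_var_def)
  qed
qed

text \<open>S(V) is generated by V. This identifies a character such as the one composed with
  \<open>sigma\<close>, of which only the values on generators are known.\<close>

lemma character_Sym_eq:
  assumes V: "Module.module complex_ring V" and g: "character (Sym V) g"
    and f: "lin_fun V f" "\<And>v. v \<in> carrier V \<Longrightarrow> g (sym_emb V v) = f v"
    and x: "x \<in> carrier (Sym V)"
  shows "g x = sym_fun f x"
proof -
  have gl: "g (x \<oplus>\<^bsub>Sym V\<^esub> y) = g x + g y" "g (x \<otimes>\<^bsub>Sym V\<^esub> y) = g x * g y" "g (c \<odot>\<^bsub>Sym V\<^esub> x) = c * g x"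
    "g \<one>\<^bsub>Sym V\<^esub> = 1"
    if "x \<in> carrier (Sym V)" "y \<in> carrier (Sym V)" for x y c
    using g that by (auto simp: character_def lin_fun_def)
  have cl: "sym_class V p \<in> carrier (Sym V)" if "p \<in> carrier (polys V)" for p
    using that Sym_simps(1)[OF V] by blast
  have m: "g (sym_class V (Poly_Mapping.single M 1)) = (\<Prod>v\<in>#M. f v)" if "set_mset M \<subseteq> carrier V" for M
    using that
  proof (induction M)
    case empty
    show ?case using gl(4)[OF cl cl, of 0 0] by (simp add: Sym_simps[OF V])
  next
    case (add v M)
    have *: "sym_var v \<in> carrier (polys V)" "Poly_Mapping.single M 1 \<in> carrier (polys V)"
      using add(2) by (auto simp: sym_var_def)
    have "sym_class V (Poly_Mapping.single (add_mset v M) 1) =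
        sym_emb V v \<otimes>\<^bsub>Sym V\<^esub> sym_class V (Poly_Mapping.single M 1)"
      unfolding sym_emb_def Sym_ops(2)[OF V *] by (simp add: sym_var_def monoid_alg_mult_single)
    then show ?case using gl(2)[OF cl[OF *(1)] cl[OF *(2)]] add f(2)
      by (simp add: sym_emb_def)
  qed
  obtain p where p: "p \<in> carrier (polys V)" "x = sym_class V p" using x by (auto simp: Sym_simps[OF V])
  from p(1) have "Poly_Mapping.keys p \<subseteq> {M. set_mset M \<subseteq> carrier V}" by simp
  then have "g (sym_class V p) = lin_ext (\<lambda>M. \<Prod>v\<in>#M. f v) p"
  proof (induction p rule: pm_induct)
    case zero
    have "g (sym_class V (Poly_Mapping.map ((*) 0) 0)) = 0 * g (sym_class V 0)"
      using gl(3)[OF cl cl, of 0 0 0] Sym_ops(3)[OF V, of 0 0 0] by simp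
    then show ?case by simp
  next
    case (add M c p)
    have *: "Poly_Mapping.single M d \<in> carrier (polys V)" "p \<in> carrier (polys V)" for d
      using add(1,2) by auto
    have "g (sym_class V (Poly_Mapping.single M c)) = c * (\<Prod>v\<in>#M. f v)"
      using gl(3)[OF cl[OF *(1)[of 1]] cl[OF *(2)], of c] Sym_ops(3)[OF V *(1)[of 1] *(2), of c] m[of M] add(1)
      by (simp add: scale_single)
    then show ?case
      using gl(1)[OF cl[OF *(1)[of c]] cl[OF *(2)]] Sym_ops(1)[OF V *(1)[of c] *(2)] add(3)
      by (simp add: lin_ext_add)
  qed
  then show ?thesis using p sym_fun_class[OF V f(1)] by simp
qed

lemma character_sym_fun:
  assumes V: "Module.module complex_ring V" and f: "lin_fun V f"
  shows "character (Sym V) (sym_fun f)"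
  unfolding character_def lin_fun_def Sym_simps[OF V]
proof (intro conjI ballI allI)
  show "sym_fun f (sym_class V (Poly_Mapping.single {#} 1)) = 1"
    by (subst sym_fun_class[OF V f], simp, simp only: lin_ext_single, simp)
next
  fix c x assume "x \<in> sym_class V ` carrier (polys V)"
  then obtain p where p: "p \<in> carrier (polys V)" "x = sym_class V p" by auto
  have "Poly_Mapping.map ((*) c) p \<in> carrier (polys V)" using p(1) keys_scale_subset[of c p] by auto
  then show "sym_fun f (c \<odot>\<^bsub>Sym V\<^esub> x) = c * sym_fun f x"
    using p by (simp add: Sym_ops(3)[OF V p(1) p(1)] sym_fun_class[OF V f] lin_ext_scale del: monoid_alg_simps(1))
qed (auto simp: Sym_ops[OF V] sym_fun_class[OF V f] lin_ext_add lin_ext_prod_mult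
      polys_add_closed[OF V] polys_mult_closed[OF V] simp del: monoid_alg_simps(1))

lemma sym_fun_emb:
  assumes V: "Module.module complex_ring V" and f: "lin_fun V f" and v: "v \<in> carrier V"
  shows "sym_fun f (sym_emb V v) = f v"
  unfolding sym_emb_def by (subst sym_fun_class[OF V f]) (use v in \<open>auto simp: sym_var_def\<close>)

lemma lin_fun_sym_der:
  assumes V: "Module.module complex_ring V" and f: "lin_fun V f"
  shows "lin_fun (Sym V) (sym_der f)"
  unfolding lin_fun_def Sym_simps[OF V]
proof (intro conjI ballI allI)
  fix c x assume "x \<in> sym_class V ` carrier (polys V)"
  then obtain p where p: "p \<in> carrier (polys V)" "x = sym_class V p" by auto
  have "Poly_Mapping.map ((*) c) p \<in> carrier (polys V)" using p(1) keys_scale_subset[of c p] by auto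
  then show "sym_der f (c \<odot>\<^bsub>Sym V\<^esub> x) = c * sym_der f x"
    using p by (simp add: Sym_ops(3)[OF V p(1) p(1)] sym_der_class[OF V f] lin_ext_scale der_ext_def
        del: monoid_alg_simps(1))
qed (auto simp: Sym_ops[OF V] sym_der_class[OF V f] lin_ext_add der_ext_def
      polys_add_closed[OF V] polys_mult_closed[OF V] simp del: monoid_alg_simps(1))

lemma sym_fun_derivative:
  assumes V: "Module.module complex_ring V" and f: "lin_fun V f" and x: "x \<in> carrier (Sym V)"
  shows "((\<lambda>s. sym_fun (\<lambda>v. s * f v) x) has_field_derivative sym_der f x) (at 0)"
proof -
  obtain p where p: "p \<in> carrier (polys V)" "x = sym_class V p" using x by (auto simp: Sym_simps[OF V])
  have "lin_fun V (\<lambda>v. s * f v)" for s using f by (simp add: lin_fun_def algebra_simps)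
  then show ?thesis
    using der_ext_derivative[of f p] p(1)
    by (simp add: p(2) sym_fun_class[OF V] sym_der_class[OF V f p(1)] del: monoid_alg_simps(1))
qed

section \<open>Algebras and coproducts\<close>

lemma nu_algebraD:
  assumes "nu_algebra A"
  shows "Module.module complex_ring A"
    "x \<in> carrier A \<Longrightarrow> y \<in> carrier A \<Longrightarrow> x \<otimes>\<^bsub>A\<^esub> y \<in> carrier A"
    "x \<in> carrier A \<Longrightarrow> y \<in> carrier A \<Longrightarrow> z \<in> carrier A \<Longrightarrow>
       (x \<otimes>\<^bsub>A\<^esub> y) \<otimes>\<^bsub>A\<^esub> z = x \<otimes>\<^bsub>A\<^esub> (y \<otimes>\<^bsub>A\<^esub> z)"
    "x \<in> carrier A \<Longrightarrow> y \<in> carrier A \<Longrightarrow> z \<in> carrier A \<Longrightarrow>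
       (x \<oplus>\<^bsub>A\<^esub> y) \<otimes>\<^bsub>A\<^esub> z = x \<otimes>\<^bsub>A\<^esub> z \<oplus>\<^bsub>A\<^esub> y \<otimes>\<^bsub>A\<^esub> z"
    "x \<in> carrier A \<Longrightarrow> y \<in> carrier A \<Longrightarrow> z \<in> carrier A \<Longrightarrow>
       z \<otimes>\<^bsub>A\<^esub> (x \<oplus>\<^bsub>A\<^esub> y) = z \<otimes>\<^bsub>A\<^esub> x \<oplus>\<^bsub>A\<^esub> z \<otimes>\<^bsub>A\<^esub> y"
    "x \<in> carrier A \<Longrightarrow> y \<in> carrier A \<Longrightarrow> (c \<odot>\<^bsub>A\<^esub> x) \<otimes>\<^bsub>A\<^esub> y = c \<odot>\<^bsub>A\<^esub> (x \<otimes>\<^bsub>A\<^esub> y)"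
    "x \<in> carrier A \<Longrightarrow> y \<in> carrier A \<Longrightarrow> x \<otimes>\<^bsub>A\<^esub> (c \<odot>\<^bsub>A\<^esub> y) = c \<odot>\<^bsub>A\<^esub> (x \<otimes>\<^bsub>A\<^esub> y)"
  using assms unfolding nu_algebra_def by blast+

lemma nu_algebra_zero_mult:
  assumes A: "nu_algebra A" and x: "x \<in> carrier A"
  shows "\<zero>\<^bsub>A\<^esub> \<otimes>\<^bsub>A\<^esub> x = \<zero>\<^bsub>A\<^esub>" "x \<otimes>\<^bsub>A\<^esub> \<zero>\<^bsub>A\<^esub> = \<zero>\<^bsub>A\<^esub>"
proof -
  note m = module_complexD[OF nu_algebraD(1)[OF A]]
  show "\<zero>\<^bsub>A\<^esub> \<otimes>\<^bsub>A\<^esub> x = \<zero>\<^bsub>A\<^esub>"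
    using nu_algebraD(6)[OF A m(1) x, of 0] m(1,12,13) nu_algebraD(2)[OF A m(1) x] by simp
  show "x \<otimes>\<^bsub>A\<^esub> \<zero>\<^bsub>A\<^esub> = \<zero>\<^bsub>A\<^esub>"
    using nu_algebraD(7)[OF A x m(1), of 0] m(1,12,13) nu_algebraD(2)[OF A x m(1)] by simp
qed

text \<open>Lets an algebra change its record type, as happens with \<open>module.extend\<close> and
  \<open>module.truncate\<close>.\<close>

lemma nu_algebra_cong:
  fixes A :: "(complex, 'a, 'x) module_scheme" and B :: "(complex, 'a, 'y) module_scheme"
  assumes A: "nu_algebra A"
    and eq: "carrier B = carrier A" "mult B = mult A" "\<zero>\<^bsub>B\<^esub> = \<zero>\<^bsub>A\<^esub>" "add B = add A" "smult B = smult A"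
  shows "nu_algebra B"
proof -
  have "Module.module complex_ring B"
    by (rule module_complexI; unfold eq; (rule module_complexD[OF nu_algebraD(1)[OF A]]; assumption)?)
  then show ?thesis using A by (simp add: nu_algebra_def eq)
qed

lemma nu_algebra_subalg:
  assumes A: "nu_algebra A" and T: "subalg T A"
  shows "nu_algebra (A\<lparr>carrier := T\<rparr>)"
proof -
  have T': "\<zero>\<^bsub>A\<^esub> \<in> T" "\<And>x. x \<in> T \<Longrightarrow> x \<in> carrier A" "\<And>x y. x \<in> T \<Longrightarrow> y \<in> T \<Longrightarrow> x \<oplus>\<^bsub>A\<^esub> y \<in> T"
    "\<And>x y. x \<in> T \<Longrightarrow> y \<in> T \<Longrightarrow> x \<otimes>\<^bsub>A\<^esub> y \<in> T" "\<And>c x. x \<in> T \<Longrightarrow> c \<odot>\<^bsub>A\<^esub> x \<in> T"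
    using T by (auto simp: subalg_def)
  note m = module_complexD[OF nu_algebraD(1)[OF A]]
  have "Module.module complex_ring (A\<lparr>carrier := T\<rparr>)"
  proof (rule module_complexI)
    show "x \<oplus>\<^bsub>A\<lparr>carrier := T\<rparr>\<^esub> y = y \<oplus>\<^bsub>A\<lparr>carrier := T\<rparr>\<^esub> x"
      if "x \<in> carrier (A\<lparr>carrier := T\<rparr>)" "y \<in> carrier (A\<lparr>carrier := T\<rparr>)" for x y
      using that m(4) T' by simp
  qed (use m(3,5,8-12) T' in simp_all)
  then show ?thesis using nu_algebraD(2-)[OF A] T' by (simp add: nu_algebra_def)
qed

lemma alg_homD:
  assumes "alg_hom A B h"
  shows "x \<in> carrier A \<Longrightarrow> h x \<in> carrier B"
    "x \<in> carrier A \<Longrightarrow> y \<in> carrier A \<Longrightarrow> h (x \<oplus>\<^bsub>A\<^esub> y) = h x \<oplus>\<^bsub>B\<^esub> h y"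
    "x \<in> carrier A \<Longrightarrow> y \<in> carrier A \<Longrightarrow> h (x \<otimes>\<^bsub>A\<^esub> y) = h x \<otimes>\<^bsub>B\<^esub> h y"
    "x \<in> carrier A \<Longrightarrow> h (c \<odot>\<^bsub>A\<^esub> x) = c \<odot>\<^bsub>B\<^esub> h x"
  using assms unfolding alg_hom_def by blast+

lemma alg_hom_zero:
  assumes "nu_algebra A" "nu_algebra B" "alg_hom A B h"
  shows "h \<zero>\<^bsub>A\<^esub> = \<zero>\<^bsub>B\<^esub>"
proof -
  note a = module_complexD[OF nu_algebraD(1)[OF assms(1)]] and b = module_complexD[OF nu_algebraD(1)[OF assms(2)]]
  show ?thesis using alg_homD(4)[OF assms(3) a(1), of 0] a(13) b(12)[OF alg_homD(1)[OF assms(3) a(1)]] by simp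
qed

lemma alg_hom_comp:
  "alg_hom A B f \<Longrightarrow> alg_hom B C g \<Longrightarrow> alg_hom A C (\<lambda>x. g (f x))"
  by (simp add: alg_hom_def)

lemma alg_hom_id: "alg_hom A A (\<lambda>x. x)"
  by (simp add: alg_hom_def)

lemma subalg_gen_subalg:
  assumes A: "nu_algebra A" and S: "S \<subseteq> carrier A"
  shows "subalg (subalg_gen A S) A"
proof -
  have "subalg (carrier A) A"
    using nu_algebraD(2)[OF A] module_complexD(1,2,7)[OF nu_algebraD(1)[OF A]] by (simp add: subalg_def)
  then have "subalg_gen A S \<subseteq> carrier A" using S unfolding subalg_gen_def by blast
  then show ?thesis unfolding subalg_gen_def subalg_def by blast
qed

lemma subalg_gen_superset: "S \<subseteq> subalg_gen A S"
  unfolding subalg_gen_def by blast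

lemma subalg_gen_minimal: "subalg T A \<Longrightarrow> S \<subseteq> T \<Longrightarrow> subalg_gen A S \<subseteq> T"
  unfolding subalg_gen_def by blast

text \<open>The equalizer of two homomorphisms is a subalgebra.\<close>

lemma alg_hom_eq_on_gen:
  assumes A: "nu_algebra A" and B: "nu_algebra B" and h: "alg_hom A B h" "alg_hom A B h'"
    and S: "S \<subseteq> carrier A" "\<And>x. x \<in> S \<Longrightarrow> h x = h' x" and x: "x \<in> subalg_gen A S"
  shows "h x = h' x"
proof -
  have "subalg {x \<in> carrier A. h x = h' x} A"
    using nu_algebraD(2)[OF A] module_complexD(1,2,7)[OF nu_algebraD(1)[OF A]] alg_homD[OF h(1)] alg_homD[OF h(2)]
      alg_hom_zero[OF A B h(1)] alg_hom_zero[OF A B h(2)]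
    by (simp add: subalg_def)
  from subalg_gen_minimal[OF this, of S] show ?thesis using S x by blast
qed

section \<open>Products of words and their linear combinations\<close>

fun lprod :: "(complex, 'a, 'x) module_scheme \<Rightarrow> 'a list \<Rightarrow> 'a" where
  "lprod A [] = \<zero>\<^bsub>A\<^esub>"
| "lprod A [x] = x"
| "lprod A (x # y # xs) = x \<otimes>\<^bsub>A\<^esub> lprod A (y # xs)"

text \<open>Fails for the empty word, which has the value zero as there is no unit; hence the
  separate clause for one letter and the recurring condition that words are nonempty.\<close>

lemma lprod_Cons: "xs \<noteq> [] \<Longrightarrow> lprod A (x # xs) = x \<otimes>\<^bsub>A\<^esub> lprod A xs"
  by (cases xs) auto

lemma lprod_closed:
  assumes "nu_algebra A"
  shows "set xs \<subseteq> carrier A \<Longrightarrow> lprod A xs \<in> carrier A"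
proof (induction xs)
  case (Cons x xs)
  then show ?case using nu_algebraD(2)[OF assms] by (cases "xs = []") (auto simp: lprod_Cons)
qed (use module_complexD(1)[OF nu_algebraD(1)[OF assms]] in simp)

lemma lprod_append:
  assumes A: "nu_algebra A" and "xs \<noteq> []" "ys \<noteq> []" "set xs \<subseteq> carrier A" "set ys \<subseteq> carrier A"
  shows "lprod A (xs @ ys) = lprod A xs \<otimes>\<^bsub>A\<^esub> lprod A ys"
  using assms(2,4)
proof (induction xs)
  case (Cons x xs)
  then show ?case using assms(3,5) lprod_closed[OF A] nu_algebraD(3)[OF A]
    by (cases "xs = []") (auto simp: lprod_Cons)
qed simp

lemma alg_hom_lprod:
  assumes A: "nu_algebra A" and B: "nu_algebra B" and h: "alg_hom A B h"
  shows "set xs \<subseteq> carrier A \<Longrightarrow> h (lprod A xs) = lprod B (map h xs)"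
proof (induction xs)
  case (Cons x xs)
  then show ?case using lprod_closed[OF A] alg_homD(3)[OF h]
    by (cases "xs = []") (auto simp: lprod_Cons)
qed (use alg_hom_zero[OF A B h] in simp)

fun lcomb :: "(complex, 'a, 'x) module_scheme \<Rightarrow> (complex \<times> 'a list) list \<Rightarrow> 'a" where
  "lcomb A [] = \<zero>\<^bsub>A\<^esub>"
| "lcomb A ((c, w) # ts) = c \<odot>\<^bsub>A\<^esub> lprod A w \<oplus>\<^bsub>A\<^esub> lcomb A ts"

text \<open>The combinations of nonempty words over S form a subalgebra containing S. Having them as
  explicit lists serves two purposes: induction on elements, and an estimate of the size of the
  subalgebra.\<close>

lemma subalg_gen_lcomb:
  assumes A: "nu_algebra A" and S: "S \<subseteq> carrier A" and x: "x \<in> subalg_gen A S"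
  obtains ts where "\<forall>(c, w)\<in>set ts. w \<noteq> [] \<and> set w \<subseteq> S" "x = lcomb A ts"
proof -
  define ok where "ok ts \<longleftrightarrow> (\<forall>(c, w)\<in>set ts. w \<noteq> [] \<and> set w \<subseteq> S)" for ts :: "(complex \<times> 'a list) list"
  have ok_simps: "ok []" "ok ((c, w) # ts) \<longleftrightarrow> w \<noteq> [] \<and> set w \<subseteq> S \<and> ok ts" "ok (ts @ us) \<longleftrightarrow> ok ts \<and> ok us"
    for c w ts us by (auto simp: ok_def)
  note a = nu_algebraD[OF A] and m = module_complexD[OF nu_algebraD(1)[OF A]]
  interpret Module.module complex_ring A by (rule a(1))
  have pc: "lprod A w \<in> carrier A" if "set w \<subseteq> S" for w using lprod_closed[OF A] S that by blast
  have cl: "lcomb A ts \<in> carrier A" if "ok ts" for ts using that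
    by (induction ts) (auto simp: ok_simps m(1) intro!: m(2,7) pc)
  have add: "lcomb A (ts @ us) = lcomb A ts \<oplus>\<^bsub>A\<^esub> lcomb A us" if "ok ts" "ok us" for ts us
    using that by (induction ts) (auto simp: ok_simps m(3,5,7) pc cl)
  have sc: "\<exists>us. ok us \<and> lcomb A us = c \<odot>\<^bsub>A\<^esub> lcomb A ts" if "ok ts" for c ts
    using that
  proof (induction ts)
    case Nil
    show ?case by (rule exI[of _ "[]"]) (simp add: ok_simps m(13))
  next
    case (Cons t ts)
    obtain d w where t: "t = (d, w)" by (cases t)
    obtain us where "ok us" "lcomb A us = c \<odot>\<^bsub>A\<^esub> lcomb A ts" using Cons by (auto simp: t ok_simps)
    then show ?case using Cons.prems
      by (intro exI[of _ "(c * d, w) # us"]) (simp add: t ok_simps m(7,9,10) pc cl)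
  qed
  \<comment> \<open>Products are expanded in two rounds: a single word times a combination here, two
    combinations in \<open>mu\<close>.\<close>
  have wm: "\<exists>us. ok us \<and> lcomb A us = (c \<odot>\<^bsub>A\<^esub> lprod A v) \<otimes>\<^bsub>A\<^esub> lcomb A ts"
    if v: "v \<noteq> []" "set v \<subseteq> S" and "ok ts" for c v ts
    using \<open>ok ts\<close>
  proof (induction ts)
    case Nil
    show ?case by (rule exI[of _ "[]"]) (simp add: ok_simps nu_algebra_zero_mult[OF A] pc v m(7))
  next
    case (Cons t ts)
    obtain d w where t: "t = (d, w)" by (cases t)
    obtain us where "ok us" "lcomb A us = (c \<odot>\<^bsub>A\<^esub> lprod A v) \<otimes>\<^bsub>A\<^esub> lcomb A ts"
      using Cons by (auto simp: t ok_simps)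
    moreover have "lprod A (v @ w) = lprod A v \<otimes>\<^bsub>A\<^esub> lprod A w"
      using Cons.prems v S by (intro lprod_append[OF A]) (auto simp: t ok_simps)
    moreover have "c \<odot>\<^bsub>A\<^esub> (d \<odot>\<^bsub>A\<^esub> (lprod A v \<otimes>\<^bsub>A\<^esub> lprod A w)) = d \<odot>\<^bsub>A\<^esub> (c \<odot>\<^bsub>A\<^esub> (lprod A v \<otimes>\<^bsub>A\<^esub> lprod A w))"
      using m(10)[OF a(2)[OF pc pc], of v w] v Cons.prems by (simp add: t ok_simps mult.commute flip: m(10)[OF a(2)[OF pc pc]])
    ultimately show ?case using Cons.prems v
      by (intro exI[of _ "(c * d, v @ w) # us"]) (simp add: t ok_simps m(2,7,10) a pc cl)
  qed
  have mu: "\<exists>us. ok us \<and> lcomb A us = lcomb A ts \<otimes>\<^bsub>A\<^esub> lcomb A ts'" if "ok ts'" "ok ts" for ts ts'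
    using \<open>ok ts\<close>
  proof (induction ts)
    case Nil
    show ?case by (rule exI[of _ "[]"]) (simp add: ok_simps nu_algebra_zero_mult[OF A] cl \<open>ok ts'\<close>)
  next
    case (Cons t ts)
    obtain d w where t: "t = (d, w)" by (cases t)
    obtain us where us: "ok us" "lcomb A us = lcomb A ts \<otimes>\<^bsub>A\<^esub> lcomb A ts'"
      using Cons by (auto simp: t ok_simps)
    obtain us' where us': "ok us'" "lcomb A us' = (d \<odot>\<^bsub>A\<^esub> lprod A w) \<otimes>\<^bsub>A\<^esub> lcomb A ts'"
      using wm[OF _ _ \<open>ok ts'\<close>, of w d] Cons.prems by (auto simp: t ok_simps)
    show ?case using us us' Cons.prems \<open>ok ts'\<close>
      by (intro exI[of _ "us' @ us"]) (simp add: t ok_simps add a(4) m(7) pc cl)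
  qed
  have "subalg {lcomb A ts |ts. ok ts} A"
    unfolding subalg_def
  proof (intro conjI ballI allI)
    show "{lcomb A ts |ts. ok ts} \<subseteq> carrier A" using cl by blast
    show "\<zero>\<^bsub>A\<^esub> \<in> {lcomb A ts |ts. ok ts}" using lcomb.simps(1)[of A] ok_simps(1) by (metis (mono_tags) mem_Collect_eq)
  next
    fix x y assume "x \<in> {lcomb A ts |ts. ok ts}" "y \<in> {lcomb A ts |ts. ok ts}"
    then obtain ts us where tu: "x = lcomb A ts" "ok ts" "y = lcomb A us" "ok us" by blast
    show "x \<oplus>\<^bsub>A\<^esub> y \<in> {lcomb A ts |ts. ok ts}" using add[OF tu(2,4)] tu ok_simps(3)
      by (metis (mono_tags, lifting) mem_Collect_eq)
    show "x \<otimes>\<^bsub>A\<^esub> y \<in> {lcomb A ts |ts. ok ts}" using mu[OF tu(4,2)] tu by (metis (mono_tags) mem_Collect_eq)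
  next
    fix c x assume "x \<in> {lcomb A ts |ts. ok ts}"
    then obtain ts where "x = lcomb A ts" "ok ts" by blast
    then show "c \<odot>\<^bsub>A\<^esub> x \<in> {lcomb A ts |ts. ok ts}" using sc[of ts c] by (metis (mono_tags) mem_Collect_eq)
  qed
  moreover have "S \<subseteq> {lcomb A ts |ts. ok ts}"
  proof
    fix s assume "s \<in> S"
    then have "ok [(1, [s])]" "lcomb A [(1, [s])] = s" using S m(6,11) by (auto simp: ok_simps)
    then show "s \<in> {lcomb A ts |ts. ok ts}" by (metis (mono_tags, lifting) mem_Collect_eq)
  qed
  ultimately have "x \<in> {lcomb A ts |ts. ok ts}" using subalg_gen_minimal x by blast
  then show ?thesis using that unfolding ok_def by blast
qed

section \<open>Transport of structure along an injection\<close>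

definition transport ::
  "('a \<Rightarrow> 'u) \<Rightarrow> (complex, 'a, 'x) module_scheme \<Rightarrow> (complex, 'u) module" where
  "transport e A =
     \<lparr>carrier = e ` carrier A,
      mult = (\<lambda>x y. e (inv_into (carrier A) e x \<otimes>\<^bsub>A\<^esub> inv_into (carrier A) e y)),
      one = undefined, zero = e \<zero>\<^bsub>A\<^esub>,
      add = (\<lambda>x y. e (inv_into (carrier A) e x \<oplus>\<^bsub>A\<^esub> inv_into (carrier A) e y)),
      smult = (\<lambda>c x. e (c \<odot>\<^bsub>A\<^esub> inv_into (carrier A) e x))\<rparr>"

lemma transport_simps:
  assumes "inj_on e (carrier A)"
  shows "carrier (transport e A) = e ` carrier A"
    "\<zero>\<^bsub>transport e A\<^esub> = e \<zero>\<^bsub>A\<^esub>"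
    "x \<in> carrier A \<Longrightarrow> y \<in> carrier A \<Longrightarrow> e x \<otimes>\<^bsub>transport e A\<^esub> e y = e (x \<otimes>\<^bsub>A\<^esub> y)"
    "x \<in> carrier A \<Longrightarrow> y \<in> carrier A \<Longrightarrow> e x \<oplus>\<^bsub>transport e A\<^esub> e y = e (x \<oplus>\<^bsub>A\<^esub> y)"
    "x \<in> carrier A \<Longrightarrow> c \<odot>\<^bsub>transport e A\<^esub> e x = e (c \<odot>\<^bsub>A\<^esub> x)"
  using assms by (simp_all add: transport_def)

lemma transport_nu_algebra:
  assumes A: "nu_algebra A" and e: "inj_on e (carrier A)"
  shows "nu_algebra (transport e A)"
proof -
  note m = module_complexD[OF nu_algebraD(1)[OF A]]
  have "Module.module complex_ring (transport e A)"
  proof (rule module_complexI)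
    show "x \<oplus>\<^bsub>transport e A\<^esub> y = y \<oplus>\<^bsub>transport e A\<^esub> x"
      if "x \<in> carrier (transport e A)" "y \<in> carrier (transport e A)" for x y
      using that m(4) by (auto simp: transport_simps[OF e])
  qed (use m(1-3,5-12) in \<open>auto simp: transport_simps[OF e]\<close>)
  then show ?thesis
    unfolding nu_algebra_def using m nu_algebraD(2-)[OF A]
    by (simp add: transport_simps[OF e])
qed

lemma transport_hom:
  assumes "nu_algebra A" "inj_on e (carrier A)"
  shows "alg_hom A (transport e A) e" "alg_hom (transport e A) A (inv_into (carrier A) e)"
proof -
  note m = module_complexD[OF nu_algebraD(1)[OF assms(1)]] and n = nu_algebraD(2)[OF assms(1)]
  show "alg_hom A (transport e A) e" "alg_hom (transport e A) A (inv_into (carrier A) e)"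
    using m(2,7) n by (auto simp: alg_hom_def transport_simps[OF assms(2)] inv_into_f_f[OF assms(2)])
qed

section \<open>Existence of coproducts\<close>

text \<open>An infinite type has a pairing function; folding it over a list is injective among lists
  of equal length, so the length is stored as well.\<close>

lemma infinite_list_injection:
  assumes "infinite (UNIV :: 'u set)"
  obtains f :: "'u list \<Rightarrow> 'u" where "inj f"
proof -
  obtain p :: "'u \<times> 'u \<Rightarrow> 'u" where p: "inj p"
    using card_of_Times_same_infinite[OF assms] unfolding card_of_ordIso[symmetric]
    by (auto simp: bij_betw_def)
  obtain n :: "nat \<Rightarrow> 'u" where n: "inj n" using assms infinite_countable_subset by blast
  define g where "g = foldr (\<lambda>x a. p (x, a))"
  have "xs = ys" if "length xs = length ys" "g xs a = g ys a" for xs ys a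
    using that by (induction xs ys rule: list_induct2) (auto simp: g_def dest: injD[OF p])
  then have "inj (\<lambda>xs. p (n (length xs), g xs (n 0)))"
    by (intro injI) (auto dest!: injD[OF p] dest: injD[OF n])
  then show ?thesis using that by blast
qed

text \<open>The source of all size estimates: the multiples of a nonzero element form a copy of the
  complex numbers, so a universe that carries a nonzero algebra is infinite and at least that
  large.\<close>

lemma nu_algebra_scalar_inj:
  assumes A: "nu_algebra A" and a: "a \<in> carrier A" "a \<noteq> \<zero>\<^bsub>A\<^esub>"
  shows "inj (\<lambda>c. c \<odot>\<^bsub>A\<^esub> a)"
proof (rule injI, rule ccontr)
  fix c d assume eq: "c \<odot>\<^bsub>A\<^esub> a = d \<odot>\<^bsub>A\<^esub> a" and ne: "c \<noteq> d"
  note m = module_complexD[OF nu_algebraD(1)[OF A]]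
  have "(c - d) \<odot>\<^bsub>A\<^esub> a = c \<odot>\<^bsub>A\<^esub> a \<oplus>\<^bsub>A\<^esub> (-d) \<odot>\<^bsub>A\<^esub> a" using m(8)[OF a(1), of c "-d"] by simp
  also have "\<dots> = \<zero>\<^bsub>A\<^esub>" unfolding eq using m(8)[OF a(1), of d "-d"] m(12)[OF a(1)] by simp
  finally have "(1 / (c - d)) \<odot>\<^bsub>A\<^esub> ((c - d) \<odot>\<^bsub>A\<^esub> a) = \<zero>\<^bsub>A\<^esub>" using m(13) by simp
  then show False using m(10)[OF a(1), of "1 / (c - d)" "c - d"] m(11)[OF a(1)] ne a(2) by simp
qed

text \<open>Families are fixed to be \<open>undefined\<close> outside J, so that a family is
  determined by its members at J.\<close>

definition prod_alg ::
  "('j \<Rightarrow> (complex, 'u) module) \<Rightarrow> 'j set \<Rightarrow> (complex, 'j \<Rightarrow> 'u) module" where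
  "prod_alg D J =
     \<lparr>carrier = {F. \<forall>x. if x \<in> J then F x \<in> carrier (D x) else F x = undefined},
      mult = (\<lambda>F G x. if x \<in> J then F x \<otimes>\<^bsub>D x\<^esub> G x else undefined), one = undefined,
      zero = (\<lambda>x. if x \<in> J then \<zero>\<^bsub>D x\<^esub> else undefined),
      add = (\<lambda>F G x. if x \<in> J then F x \<oplus>\<^bsub>D x\<^esub> G x else undefined),
      smult = (\<lambda>c F x. if x \<in> J then c \<odot>\<^bsub>D x\<^esub> F x else undefined)\<rparr>"

lemma prod_alg_simps [simp]:
  "F \<in> carrier (prod_alg D J) \<longleftrightarrow> (\<forall>x. if x \<in> J then F x \<in> carrier (D x) else F x = undefined)"
  "F \<otimes>\<^bsub>prod_alg D J\<^esub> G = (\<lambda>x. if x \<in> J then F x \<otimes>\<^bsub>D x\<^esub> G x else undefined)"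
  "F \<oplus>\<^bsub>prod_alg D J\<^esub> G = (\<lambda>x. if x \<in> J then F x \<oplus>\<^bsub>D x\<^esub> G x else undefined)"
  "c \<odot>\<^bsub>prod_alg D J\<^esub> F = (\<lambda>x. if x \<in> J then c \<odot>\<^bsub>D x\<^esub> F x else undefined)"
  "\<zero>\<^bsub>prod_alg D J\<^esub> = (\<lambda>x. if x \<in> J then \<zero>\<^bsub>D x\<^esub> else undefined)"
  by (simp_all add: prod_alg_def)

lemma prod_alg_nu_algebra:
  assumes "\<And>x. x \<in> J \<Longrightarrow> nu_algebra (D x)"
  shows "nu_algebra (prod_alg D J)"
proof -
  let ?P = "prod_alg D J"
  have n: "nu_algebra (D j)" if "j \<in> J" for j using assms[OF that] .
  note m = module_complexD[OF nu_algebraD(1)[OF n]]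
  have c: "x j \<in> carrier (D j)" if "x \<in> carrier ?P" "j \<in> J" for x j
    using spec[OF that(1)[unfolded prod_alg_simps(1)], of j] that(2) by simp
  have u: "x j = undefined" if "x \<in> carrier ?P" "j \<notin> J" for x j
    using spec[OF that(1)[unfolded prod_alg_simps(1)], of j] that(2) by simp
  have eqI: "x = y" if "\<And>j. j \<in> J \<Longrightarrow> x j = y j" "\<And>j. j \<notin> J \<Longrightarrow> x j = y j" for x y :: "'a \<Rightarrow> 'b"
    by (rule ext) (use that in blast)
  have "Module.module complex_ring ?P"
  proof (rule module_complexI)
    show "x \<oplus>\<^bsub>?P\<^esub> y = y \<oplus>\<^bsub>?P\<^esub> x" if "x \<in> carrier ?P" "y \<in> carrier ?P" for x y
      by (rule eqI) (use m(4)[OF _ c[OF that(1)] c[OF that(2)]] in simp_all)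
    show "(x \<oplus>\<^bsub>?P\<^esub> y) \<oplus>\<^bsub>?P\<^esub> z = x \<oplus>\<^bsub>?P\<^esub> (y \<oplus>\<^bsub>?P\<^esub> z)"
      if "x \<in> carrier ?P" "y \<in> carrier ?P" "z \<in> carrier ?P" for x y z
      by (rule eqI) (use m(3)[OF _ c[OF that(1)] c[OF that(2)] c[OF that(3)]] in simp_all)
    show "\<zero>\<^bsub>?P\<^esub> \<oplus>\<^bsub>?P\<^esub> x = x" "1 \<odot>\<^bsub>?P\<^esub> x = x" "0 \<odot>\<^bsub>?P\<^esub> x = \<zero>\<^bsub>?P\<^esub>" if "x \<in> carrier ?P" for x
      by (rule eqI; use m(5,11,12)[OF _ c[OF that]] u[OF that] in simp)+
    show "c \<odot>\<^bsub>?P\<^esub> (x \<oplus>\<^bsub>?P\<^esub> y) = c \<odot>\<^bsub>?P\<^esub> x \<oplus>\<^bsub>?P\<^esub> c \<odot>\<^bsub>?P\<^esub> y"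
      if "x \<in> carrier ?P" "y \<in> carrier ?P" for x y c
      by (rule eqI) (use m(9)[OF _ c[OF that(1)] c[OF that(2)]] in simp_all)
    show "(a + b) \<odot>\<^bsub>?P\<^esub> x = a \<odot>\<^bsub>?P\<^esub> x \<oplus>\<^bsub>?P\<^esub> b \<odot>\<^bsub>?P\<^esub> x"
      "(a * b) \<odot>\<^bsub>?P\<^esub> x = a \<odot>\<^bsub>?P\<^esub> (b \<odot>\<^bsub>?P\<^esub> x)" if "x \<in> carrier ?P" for x a b
      by (rule eqI; use m(8,10)[OF _ c[OF that]] in simp)+
    show "x \<oplus>\<^bsub>?P\<^esub> y \<in> carrier ?P" if "x \<in> carrier ?P" "y \<in> carrier ?P" for x y
      using m(2)[OF _ c[OF that(1)] c[OF that(2)]] by simp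
    show "a \<odot>\<^bsub>?P\<^esub> x \<in> carrier ?P" if "x \<in> carrier ?P" for x a
      using m(7)[OF _ c[OF that]] by simp
    show "\<zero>\<^bsub>?P\<^esub> \<in> carrier ?P" using m(1) by simp
  qed
  moreover have "x \<otimes>\<^bsub>?P\<^esub> y \<in> carrier ?P"
    "c \<odot>\<^bsub>?P\<^esub> x \<otimes>\<^bsub>?P\<^esub> y = c \<odot>\<^bsub>?P\<^esub> (x \<otimes>\<^bsub>?P\<^esub> y)"
    "x \<otimes>\<^bsub>?P\<^esub> (c \<odot>\<^bsub>?P\<^esub> y) = c \<odot>\<^bsub>?P\<^esub> (x \<otimes>\<^bsub>?P\<^esub> y)"
    if "x \<in> carrier ?P" "y \<in> carrier ?P" for x y c
    using nu_algebraD(2,6,7)[OF n c[OF that(1)] c[OF that(2)]] by (simp_all add: fun_eq_iff)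
  moreover have "(x \<otimes>\<^bsub>?P\<^esub> y) \<otimes>\<^bsub>?P\<^esub> z = x \<otimes>\<^bsub>?P\<^esub> (y \<otimes>\<^bsub>?P\<^esub> z)"
    "(x \<oplus>\<^bsub>?P\<^esub> y) \<otimes>\<^bsub>?P\<^esub> z = x \<otimes>\<^bsub>?P\<^esub> z \<oplus>\<^bsub>?P\<^esub> y \<otimes>\<^bsub>?P\<^esub> z"
    "z \<otimes>\<^bsub>?P\<^esub> (x \<oplus>\<^bsub>?P\<^esub> y) = z \<otimes>\<^bsub>?P\<^esub> x \<oplus>\<^bsub>?P\<^esub> z \<otimes>\<^bsub>?P\<^esub> y"
    if "x \<in> carrier ?P" "y \<in> carrier ?P" "z \<in> carrier ?P" for x y z
    using nu_algebraD(3,4,5)[OF n c[OF that(1)] c[OF that(2)] c[OF that(3)]] by (simp_all add: fun_eq_iff)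
  ultimately show ?thesis unfolding nu_algebra_def by (intro conjI ballI allI) metis+
qed

text \<open>
  The coproduct is the subalgebra generated by the canonical images in the product of all algebras
  on \<^typ>\<open>'u\<close> receiving homomorphisms from the given ones. Unless it is zero, the type \<^typ>\<open>'u\<close>
  is infinite and at least as large as \<^typ>\<open>complex\<close>, so that this image of a set of lists embeds into it.
\<close>

lemma coproduct_exists:
  fixes A :: "bool \<Rightarrow> (complex, 'u, 'x) module_scheme"
  assumes A: "\<And>i. nu_algebra (A i)"
  shows "\<exists>(C :: (complex, 'u) module) \<iota>. is_coproduct A C \<iota>"
proof -
  \<comment> \<open>Targets and families of homomorphisms live on \<open>'u\<close>, so the pairs
    form a set of one type. The product over it need not fit into \<open>'u\<close>; only the
    generated subalgebra will.\<close>
  define J where "J = {(D :: (complex, 'u) module, f). nu_algebra D \<and> (\<forall>i. alg_hom (A i) D (f i))}"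
  define PA where "PA = prod_alg fst J"
  define gen where "gen i a = (\<lambda>x. if x \<in> J then snd x i a else undefined)" for i a
  define S where "S = (\<Union>i. gen i ` carrier (A i))"
  define C0 where "C0 = PA\<lparr>carrier := subalg_gen PA S\<rparr>"
  have PA: "nu_algebra PA" unfolding PA_def by (rule prod_alg_nu_algebra) (auto simp: J_def)
  have S: "S \<subseteq> carrier PA"
    by (auto simp: S_def PA_def gen_def J_def alg_hom_def)
  note sub = subalg_gen_subalg[OF PA S]
  have C0: "nu_algebra C0" unfolding C0_def by (rule nu_algebra_subalg[OF PA sub])
  have C0_carrier: "carrier C0 = subalg_gen PA S" by (simp add: C0_def)
  have gen_hom: "alg_hom (A i) C0 (gen i)" for i
    unfolding alg_hom_def C0_carrier
  proof (intro conjI ballI allI)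
    fix x assume "x \<in> carrier (A i)"
    then show "gen i x \<in> subalg_gen PA S" using subalg_gen_superset[of S PA] by (auto simp: S_def)
  qed (auto simp: gen_def C0_def PA_def J_def fun_eq_iff alg_homD(2-4))
  have proj: "alg_hom C0 D (\<lambda>F. F (D, f))" if "(D, f) \<in> J" for D f
    using that sub by (auto simp: alg_hom_def C0_def PA_def subalg_def)
      (metis (no_types, lifting) fst_conv prod_alg_simps(1) subsetD)
  \<comment> \<open>Two homomorphisms that agree on the canonical images have an equalizer
    containing the generators.\<close>
  have unique: "h F = h' F"
    if h: "alg_hom C0 D h" "alg_hom C0 D h'" and D: "nu_algebra D"
      and eq: "\<And>i a. a \<in> carrier (A i) \<Longrightarrow> h (gen i a) = h' (gen i a)" and F: "F \<in> carrier C0"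
    for D :: "(complex, 'u) module" and h h' F
  proof -
    have "subalg_gen PA S \<subseteq> {F \<in> carrier C0. h F = h' F}"
    proof (rule subalg_gen_minimal)
      show "subalg {F \<in> carrier C0. h F = h' F} PA"
        using sub alg_homD(2-4)[OF h(1)] alg_homD(2-4)[OF h(2)] alg_hom_zero[OF C0 D h(1)]
          alg_hom_zero[OF C0 D h(2)]
        by (auto simp: subalg_def C0_def)
      show "S \<subseteq> {F \<in> carrier C0. h F = h' F}"
      proof
        fix F assume F: "F \<in> S"
        then have "F \<in> carrier C0" using subalg_gen_superset[of S PA] by (auto simp: C0_carrier)
        then show "F \<in> {F \<in> carrier C0. h F = h' F}" using F eq by (auto simp: S_def)
      qed
    qed
    then show ?thesis using F by (auto simp: C0_carrier)
  qed
  have "\<exists>e :: _ \<Rightarrow> 'u. inj_on e (carrier C0)"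
  proof (cases "\<forall>i. carrier (A i) = {\<zero>\<^bsub>A i\<^esub>}")
    \<comment> \<open>Nothing forces \<open>'u\<close> to be infinite here, but the coproduct is a
      single point.\<close>
    case True
    have "S \<subseteq> {\<zero>\<^bsub>PA\<^esub>}"
      using True alg_hom_zero[OF A C0 gen_hom] by (auto simp: S_def C0_def)
    moreover have "subalg {\<zero>\<^bsub>PA\<^esub>} PA"
      using module_complexD(1,5,13)[OF nu_algebraD(1)[OF PA]]
      by (simp add: subalg_def nu_algebra_zero_mult[OF PA])
    ultimately have "carrier C0 \<subseteq> {\<zero>\<^bsub>PA\<^esub>}" unfolding C0_carrier by (intro subalg_gen_minimal)
    then have "inj_on (\<lambda>_. undefined :: 'u) (carrier C0)" by (auto simp: inj_on_def)
    then show ?thesis by blast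
  next
    case False
    then obtain i a where a: "a \<in> carrier (A i)" "a \<noteq> \<zero>\<^bsub>A i\<^esub>"
      using module_complexD(1)[OF nu_algebraD(1)[OF A]] by blast
    define j where "j c = c \<odot>\<^bsub>A i\<^esub> a" for c
    have j: "inj j" unfolding j_def by (rule nu_algebra_scalar_inj[OF A a])
    have "infinite (UNIV :: 'u set)"
      using finite_imageD[OF finite_subset[OF subset_UNIV], of j UNIV] j infinite_UNIV_char_0[where 'a = complex]
      by blast
    then obtain l :: "'u list \<Rightarrow> 'u" where l: "inj l" by (rule infinite_list_injection)
    \<comment> \<open>Two distinct elements of \<open>'u\<close>, the codes of 1 and 0, tell letters
      of the two factors apart.\<close>
    define b where "b i = j (if i then 1 else 0)" for i
    have b: "b i = b i' \<Longrightarrow> i = i'" for i i' using injD[OF j] by (force simp: b_def split: if_splits)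
    \<comment> \<open>A term becomes the code of its coefficient followed by its tagged letters.
      Every layer of lists is folded back into \<open>'u\<close> by \<open>l\<close>.\<close>
    define code where "code = (\<lambda>ts :: (complex \<times> (bool \<times> 'u) list) list.
      l (map (\<lambda>(c, w). l (j c # map (\<lambda>(i, x). l [b i, x]) w)) ts))"
    have letter: "inj (\<lambda>(i, x). l [b i, x])" by (rule injI) (auto dest!: injD[OF l] b)
    have "inj (\<lambda>(c, w). l (j c # map (\<lambda>(i, x). l [b i, x]) w))"
      by (rule injI) (auto dest!: injD[OF l] dest: injD[OF j] injD[OF inj_mapI[OF letter]])
    from inj_mapI[OF this] have code: "inj code"
      unfolding code_def by (auto simp: inj_def dest!: injD[OF l])
    define ev where "ev ts = lcomb PA (map (\<lambda>(c, w). (c, map (\<lambda>(i, x). gen i x) w)) ts)" for ts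
    have "carrier C0 \<subseteq> range ev"
    proof
      fix F assume "F \<in> carrier C0"
      then obtain ts where ts: "\<forall>(c, w)\<in>set ts. w \<noteq> [] \<and> set w \<subseteq> S" "F = lcomb PA ts"
        unfolding C0_carrier by (rule subalg_gen_lcomb[OF PA S])
      define g where "g = (\<lambda>(i, x). gen i x)"
      define G where "G = (\<lambda>(c :: complex, w). (c, map g w))"
      have Sg: "S \<subseteq> range g" by (force simp: S_def g_def)
      have "t \<in> range G" if t: "t \<in> set ts" for t
      proof -
        obtain c w where cw: "t = (c, w)" by (cases t)
        with t ts(1) Sg have "set w \<subseteq> range g" by blast
        then obtain v where "w = map g v" using ex_map_conv[of w g] by blast
        then show ?thesis using cw by (auto simp: G_def image_iff)
      qed
      then obtain us where "ts = map G us" using ex_map_conv[of ts G] by blast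
      then show "F \<in> range ev" using ts(2) by (auto simp: ev_def G_def g_def)
    qed
    \<comment> \<open>Each element is coded through one chosen combination that evaluates to
      it.\<close>
    then have "inj_on (\<lambda>F. code (inv_into UNIV ev F)) (carrier C0)"
      using inj_on_subset[OF inj_on_inv_into[of "range ev" ev UNIV]] code
      by (auto simp: inj_on_def dest!: injD[OF code])
    then show ?thesis by blast
  qed
  then obtain e :: "_ \<Rightarrow> 'u" where e: "inj_on e (carrier C0)" by blast
  let ?C = "transport e C0"
  have C: "nu_algebra ?C" by (rule transport_nu_algebra[OF C0 e])
  note th = transport_hom[OF C0 e]
  have "is_coproduct A ?C (\<lambda>i a. e (gen i a))"
    unfolding is_coproduct_def
  proof (intro conjI allI impI C)
    show "alg_hom (A i) ?C (\<lambda>a. e (gen i a))" for i by (rule alg_hom_comp[OF gen_hom th(1)])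
    fix D :: "(complex, 'u) module" and f
    assume "nu_algebra D \<and> (\<forall>i. alg_hom (A i) D (f i))"
    then have Df: "(D, f) \<in> J" and D: "nu_algebra D" by (auto simp: J_def)
    have inv: "inv_into (carrier C0) e (e (gen i a)) = gen i a" if "a \<in> carrier (A i)" for i a
      using alg_homD(1)[OF gen_hom that] by (rule inv_into_f_f[OF e])
    show "\<exists>h. alg_hom ?C D h \<and> (\<forall>i. \<forall>a\<in>carrier (A i). h (e (gen i a)) = f i a) \<and>
        (\<forall>h'. alg_hom ?C D h' \<and> (\<forall>i. \<forall>a\<in>carrier (A i). h' (e (gen i a)) = f i a) \<longrightarrow>
           (\<forall>x\<in>carrier ?C. h' x = h x))"
    proof (intro exI[of _ "\<lambda>y. inv_into (carrier C0) e y (D, f)"] conjI ballI allI impI)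
      show "alg_hom ?C D (\<lambda>y. inv_into (carrier C0) e y (D, f))"
        by (rule alg_hom_comp[OF th(2) proj[OF Df]])
      show "inv_into (carrier C0) e (e (gen i a)) (D, f) = f i a" if "a \<in> carrier (A i)" for i a
        using inv[OF that] Df by (simp add: gen_def)
      fix h' x
      assume h': "alg_hom ?C D h' \<and> (\<forall>i. \<forall>a\<in>carrier (A i). h' (e (gen i a)) = f i a)" and x: "x \<in> carrier ?C"
      then obtain F where F: "F \<in> carrier C0" "x = e F" by (auto simp: transport_simps[OF e])
      have "h' (e F) = F (D, f)"
        by (rule unique[OF alg_hom_comp[OF th(1)] proj[OF Df] D _ F(1)]) (use h' Df in \<open>auto simp: gen_def\<close>)
      then show "h' x = inv_into (carrier C0) e x (D, f)" using F e by simp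
    qed
  qed
  then show ?thesis by blast
qed

section \<open>Free products\<close>

text \<open>The definition of a coproduct quantifies over plain module records; truncation makes
  targets with further fields, such as faced algebras, available.\<close>

lemma coproduct_lift:
  fixes C :: "(complex, 'u, 'y) module_scheme" and D :: "(complex, 'u, 'z) module_scheme"
  assumes C: "is_coproduct A C \<iota>" and D: "nu_algebra D" and f: "\<And>i. alg_hom (A i) D (f i)"
  obtains h where "alg_hom C D h" "\<And>i a. a \<in> carrier (A i) \<Longrightarrow> h (\<iota> i a) = f i a"
proof -
  let ?D = "module.truncate D"
  have hom: "alg_hom X ?D g \<longleftrightarrow> alg_hom X D g" for X :: "(complex, 'u, 'w) module_scheme" and g
    by (simp add: alg_hom_def module.truncate_def)
  have "nu_algebra ?D" using D by (rule nu_algebra_cong) (simp_all add: module.truncate_def)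
  moreover have "alg_hom (A i) ?D (f i)" for i using f[of i] by (simp add: alg_hom_def module.truncate_def)
  ultimately obtain h where "alg_hom C ?D h" "\<forall>i. \<forall>a\<in>carrier (A i). h (\<iota> i a) = f i a"
    using C unfolding is_coproduct_def by metis
  then show ?thesis using that by (simp add: alg_hom_def module.truncate_def)
qed

lemma coproduct_unique:
  fixes C :: "(complex, 'u, 'y) module_scheme" and D :: "(complex, 'u, 'z) module_scheme"
  assumes C: "is_coproduct A C \<iota>" and D: "nu_algebra D"
    and h: "alg_hom C D h" "alg_hom C D h'" "\<And>i a. a \<in> carrier (A i) \<Longrightarrow> h (\<iota> i a) = h' (\<iota> i a)"
    and x: "x \<in> carrier C"
  shows "h x = h' x"
proof -
  let ?D = "module.truncate D"
  have nu: "nu_algebra ?D" using D by (rule nu_algebra_cong) (simp_all add: module.truncate_def)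
  have hom: "alg_hom C ?D h" "alg_hom C ?D h'"
    using h(1,2) by (simp_all add: alg_hom_def module.truncate_def)
  have "alg_hom (A i) ?D (\<lambda>a. h (\<iota> i a))" for i
    using C hom(1) unfolding is_coproduct_def by (blast intro: alg_hom_comp)
  with nu C have "\<exists>g. (\<forall>h'. alg_hom C ?D h' \<and> (\<forall>i. \<forall>a\<in>carrier (A i). h' (\<iota> i a) = h (\<iota> i a)) \<longrightarrow>
      (\<forall>x\<in>carrier C. h' x = g x))"
    unfolding is_coproduct_def by (elim conjE) (drule spec[of _ ?D], drule spec[of _ "\<lambda>i a. h (\<iota> i a)"], blast)
  then obtain g where "\<And>h'. alg_hom C ?D h' \<Longrightarrow> (\<And>i a. a \<in> carrier (A i) \<Longrightarrow> h' (\<iota> i a) = h (\<iota> i a)) \<Longrightarrow> h' x = g x"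
    using x by blast
  from this[OF hom(1)] this[OF hom(2)] h(3) show ?thesis by simp
qed

text \<open>The canonical maps factor through the subalgebra generated by their images. Followed by
  the inclusion, this factorization is an endomorphism fixing the images, hence the identity, and so
  every element lies in the subalgebra.\<close>

lemma coproduct_generated:
  fixes C :: "(complex, 'u, 'y) module_scheme"
  assumes C: "is_coproduct A C \<iota>"
  shows "carrier C = subalg_gen C (\<Union>i. \<iota> i ` carrier (A i))"
proof
  let ?S = "\<Union>i. \<iota> i ` carrier (A i)"
  have nu: "nu_algebra C" and \<iota>: "\<And>i. alg_hom (A i) C (\<iota> i)" using C by (simp_all add: is_coproduct_def)
  have S: "?S \<subseteq> carrier C" using \<iota> by (auto simp: alg_hom_def)
  note sub = subalg_gen_subalg[OF nu S]
  show "subalg_gen C ?S \<subseteq> carrier C" using sub by (simp add: subalg_def)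
  let ?D = "C\<lparr>carrier := subalg_gen C ?S\<rparr>"
  have D: "nu_algebra ?D" by (rule nu_algebra_subalg[OF nu sub])
  have "alg_hom (A i) ?D (\<iota> i)" for i
    using \<iota>[of i] subalg_gen_superset[of ?S C] by (auto simp: alg_hom_def)
  then obtain h where h: "alg_hom C ?D h" "\<And>i a. a \<in> carrier (A i) \<Longrightarrow> h (\<iota> i a) = \<iota> i a"
    by (rule coproduct_lift[OF C D]) blast
  have h': "alg_hom C C h" using h(1) sub by (auto simp: alg_hom_def subalg_def)
  show "carrier C \<subseteq> subalg_gen C ?S"
  proof
    fix x assume x: "x \<in> carrier C"
    have "h x = x" by (rule coproduct_unique[OF C nu h' alg_hom_id _ x]) (simp add: h)
    then show "x \<in> subalg_gen C ?S" using alg_homD(1)[OF h(1) x] by simp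
  qed
qed

lemma faced_algebraD:
  assumes "faced_algebra A"
  shows "nu_algebra A" "subalg (face A k) A" "face A k \<subseteq> carrier A"
    "is_coproduct (\<lambda>k. A\<lparr>carrier := face A k\<rparr>) A (\<lambda>k x. x)"
  using assms unfolding faced_algebra_def subalg_def by auto

lemma faced_generated:
  assumes "faced_algebra A"
  shows "carrier A = subalg_gen A (\<Union>k. face A k)"
  using coproduct_generated[OF faced_algebraD(4)[OF assms]] by simp

context
  fixes A B :: "('u, 'm) faced"
  assumes A: "nu_algebra A" and B: "nu_algebra B"
begin

text \<open>Existence gives the choice by \<open>SOME\<close> its meaning; \<open>True\<close>
  indexes the left factor and \<open>False\<close> the right one.\<close>

lemma coproduct_choice_coproduct:
  "is_coproduct (case_bool A B) (fst (coproduct_choice A B)) (case_bool (inl A B) (inr A B))"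
proof -
  obtain C :: "(complex, 'u) module" and \<iota> where "is_coproduct (case_bool A B) C \<iota>"
    using coproduct_exists[of "case_bool A B"] A B by (metis (full_types) bool.case_eq_if)
  moreover have "case_bool (\<iota> True) (\<iota> False) = \<iota>" by (auto split: bool.split)
  ultimately have "is_coproduct (case_bool A B) C (case_bool (\<iota> True) (\<iota> False))" by simp
  then have "\<exists>x. (\<lambda>(C :: (complex, 'u) module, i, j). is_coproduct (case_bool A B) C (case_bool i j)) x"
    by (intro exI[of _ "(C, \<iota> True, \<iota> False)"]) simp
  then have "case coproduct_choice A B of (C, i, j) \<Rightarrow> is_coproduct (case_bool A B) C (case_bool i j)"
    unfolding coproduct_choice_def by (rule someI_ex)
  then show ?thesis by (simp add: inl_def inr_def split_beta)
qed

lemma free_product_fields: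
  "carrier (A \<squnion>\<^sub>f B) = carrier (fst (coproduct_choice A B))"
  "mult (A \<squnion>\<^sub>f B) = mult (fst (coproduct_choice A B))"
  "\<zero>\<^bsub>A \<squnion>\<^sub>f B\<^esub> = \<zero>\<^bsub>fst (coproduct_choice A B)\<^esub>"
  "add (A \<squnion>\<^sub>f B) = add (fst (coproduct_choice A B))"
  "smult (A \<squnion>\<^sub>f B) = smult (fst (coproduct_choice A B))"
  by (simp_all add: free_product_def Let_def module.extend_def)

lemma free_product_face:
  "face (A \<squnion>\<^sub>f B) k = subalg_gen (A \<squnion>\<^sub>f B) (inl A B ` face A k \<union> inr A B ` face B k)"
proof -
  have "face (A \<squnion>\<^sub>f B) k = subalg_gen (fst (coproduct_choice A B)) (inl A B ` face A k \<union> inr A B ` face B k)"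
    by (simp add: free_product_def Let_def module.extend_def faced.fields_def)
  then show ?thesis by (simp add: subalg_gen_def subalg_def free_product_fields)
qed

lemma free_product_coproduct:
  "is_coproduct (case_bool A B) (A \<squnion>\<^sub>f B) (case_bool (inl A B) (inr A B))"
proof -
  have "nu_algebra (A \<squnion>\<^sub>f B)"
    using coproduct_choice_coproduct unfolding is_coproduct_def
    by (elim conjE, rule_tac nu_algebra_cong) (simp_all add: free_product_fields)
  then show ?thesis
    using coproduct_choice_coproduct by (simp add: is_coproduct_def alg_hom_def free_product_fields)
qed

lemma free_product_nu_algebra: "nu_algebra (A \<squnion>\<^sub>f B)"
  using free_product_coproduct by (simp add: is_coproduct_def)

lemma inl_hom: "alg_hom A (A \<squnion>\<^sub>f B) (inl A B)"
  using free_product_coproduct unfolding is_coproduct_def by (metis (full_types) bool.case(1))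

lemma inr_hom: "alg_hom B (A \<squnion>\<^sub>f B) (inr A B)"
  using free_product_coproduct unfolding is_coproduct_def by (metis (full_types) bool.case(2))

lemma free_product_lift:
  fixes D :: "(complex, 'u, 'z) module_scheme"
  assumes D: "nu_algebra D" and f: "alg_hom A D f" and g: "alg_hom B D g"
  obtains h where "alg_hom (A \<squnion>\<^sub>f B) D h" "\<And>a. a \<in> carrier A \<Longrightarrow> h (inl A B a) = f a"
    "\<And>b. b \<in> carrier B \<Longrightarrow> h (inr A B b) = g b"
proof -
  have "alg_hom (case_bool A B i) D (case_bool f g i)" for i using f g by (cases i) auto
  from coproduct_lift[OF free_product_coproduct D this] obtain h where
    h: "alg_hom (A \<squnion>\<^sub>f B) D h"
    "\<And>i a. a \<in> carrier (case_bool A B i) \<Longrightarrow> h (case_bool (inl A B) (inr A B) i a) = case_bool f g i a"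
    by blast
  from that[OF h(1)] h(2)[of _ True] h(2)[of _ False] show ?thesis by simp
qed

lemma free_product_hom_eq:
  fixes D :: "(complex, 'u, 'z) module_scheme"
  assumes D: "nu_algebra D" and h: "alg_hom (A \<squnion>\<^sub>f B) D h" "alg_hom (A \<squnion>\<^sub>f B) D h'"
    and "\<And>a. a \<in> carrier A \<Longrightarrow> h (inl A B a) = h' (inl A B a)"
    "\<And>b. b \<in> carrier B \<Longrightarrow> h (inr A B b) = h' (inr A B b)" and x: "x \<in> carrier (A \<squnion>\<^sub>f B)"
  shows "h x = h' x"
proof (rule coproduct_unique[OF free_product_coproduct D h _ x])
  fix i a assume "a \<in> carrier (case_bool A B i)"
  then show "h (case_bool (inl A B) (inr A B) i a) = h' (case_bool (inl A B) (inr A B) i a)"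
    using assms(4,5) by (cases i) auto
qed

lemma copair_hom:
  fixes D :: "('u, 'm) faced"
  assumes D: "nu_algebra D" and f: "alg_hom A D f" and g: "alg_hom B D g"
  shows "alg_hom (A \<squnion>\<^sub>f B) D (copair A B D f g)"
    "a \<in> carrier A \<Longrightarrow> copair A B D f g (inl A B a) = f a"
    "b \<in> carrier B \<Longrightarrow> copair A B D f g (inr A B b) = g b"
proof -
  have "\<exists>h. alg_hom (A \<squnion>\<^sub>f B) D h \<and>
      (\<forall>a\<in>carrier A. h (inl A B a) = f a) \<and> (\<forall>b\<in>carrier B. h (inr A B b) = g b)"
    using free_product_lift[OF assms] by metis
  from someI_ex[OF this] show "alg_hom (A \<squnion>\<^sub>f B) D (copair A B D f g)"
    "a \<in> carrier A \<Longrightarrow> copair A B D f g (inl A B a) = f a"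
    "b \<in> carrier B \<Longrightarrow> copair A B D f g (inr A B b) = g b"
    unfolding copair_def by blast+
qed

end

lemma fp_map_hom:
  fixes A1 A2 B1 B2 :: "('u, 'm) faced"
  assumes "nu_algebra A1" "nu_algebra A2" "nu_algebra B1" "nu_algebra B2"
    and "alg_hom B1 A1 j1" "alg_hom B2 A2 j2"
  shows "alg_hom (B1 \<squnion>\<^sub>f B2) (A1 \<squnion>\<^sub>f A2) (fp_map B1 B2 A1 A2 j1 j2)"
    "a \<in> carrier B1 \<Longrightarrow> fp_map B1 B2 A1 A2 j1 j2 (inl B1 B2 a) = inl A1 A2 (j1 a)"
    "b \<in> carrier B2 \<Longrightarrow> fp_map B1 B2 A1 A2 j1 j2 (inr B1 B2 b) = inr A1 A2 (j2 b)"
  unfolding fp_map_def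
  using copair_hom[OF assms(3,4) free_product_nu_algebra[OF assms(1,2)]
      alg_hom_comp[OF assms(5) inl_hom[OF assms(1,2)]] alg_hom_comp[OF assms(6) inr_hom[OF assms(1,2)]]]
  by blast+

text \<open>Homomorphisms on the faces of the free product restrict to the faces of A and of B.
  There the coproduct properties of A and B produce \<open>hA\<close> and \<open>hB\<close>, which
  glue to one homomorphism h.\<close>

lemma free_product_faced:
  fixes A B :: "('u, 'm::finite) faced"
  assumes A: "faced_algebra A" and B: "faced_algebra B"
  shows "faced_algebra (A \<squnion>\<^sub>f B)"
proof -
  note nA = faced_algebraD(1)[OF A] and nB = faced_algebraD(1)[OF B]
  note nC = free_product_nu_algebra[OF nA nB]
  note l = inl_hom[OF nA nB] and r = inr_hom[OF nA nB]
  let ?C = "A \<squnion>\<^sub>f B" and ?S = "\<lambda>k. inl A B ` face A k \<union> inr A B ` face B k"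
  have S: "?S k \<subseteq> carrier ?C" for k
    using faced_algebraD(3)[OF A, of k] faced_algebraD(3)[OF B, of k] alg_homD(1)[OF l] alg_homD(1)[OF r] by blast
  have face: "face ?C k = subalg_gen ?C (?S k)" for k by (rule free_product_face[OF nA nB])
  have sub: "subalg (face ?C k) ?C" for k unfolding face by (rule subalg_gen_subalg[OF nC S])
  have Sf: "?S k \<subseteq> face ?C k" for k unfolding face by (rule subalg_gen_superset)
  have "is_coproduct (\<lambda>k. ?C\<lparr>carrier := face ?C k\<rparr>) ?C (\<lambda>k x. x)"
    unfolding is_coproduct_def
  proof (intro conjI allI impI nC)
    show "alg_hom (?C\<lparr>carrier := face ?C k\<rparr>) ?C (\<lambda>x. x)" for k
      using sub[of k] by (auto simp: alg_hom_def subalg_def)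
    fix D :: "(complex, 'u) module" and f :: "'m \<Rightarrow> 'u \<Rightarrow> 'u"
    assume Df: "nu_algebra D \<and> (\<forall>k. alg_hom (?C\<lparr>carrier := face ?C k\<rparr>) D (f k))"
    then have D: "nu_algebra D" and f: "\<And>k. alg_hom (?C\<lparr>carrier := face ?C k\<rparr>) D (f k)" by auto
    have "alg_hom (A\<lparr>carrier := face A k\<rparr>) (?C\<lparr>carrier := face ?C k\<rparr>) (inl A B)" for k
      using l faced_algebraD(3)[OF A, of k] Sf[of k] by (auto simp: alg_hom_def subset_iff)
    from alg_hom_comp[OF this f] obtain hA where
      hA: "alg_hom A D hA" "\<And>k a. a \<in> face A k \<Longrightarrow> hA a = f k (inl A B a)"
      by (rule coproduct_lift[OF faced_algebraD(4)[OF A] D]) auto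
    have "alg_hom (B\<lparr>carrier := face B k\<rparr>) (?C\<lparr>carrier := face ?C k\<rparr>) (inr A B)" for k
      using r faced_algebraD(3)[OF B, of k] Sf[of k] by (auto simp: alg_hom_def subset_iff)
    from alg_hom_comp[OF this f] obtain hB where
      hB: "alg_hom B D hB" "\<And>k b. b \<in> face B k \<Longrightarrow> hB b = f k (inr A B b)"
      by (rule coproduct_lift[OF faced_algebraD(4)[OF B] D]) auto
    obtain h where h: "alg_hom ?C D h" "\<And>a. a \<in> carrier A \<Longrightarrow> h (inl A B a) = hA a"
      "\<And>b. b \<in> carrier B \<Longrightarrow> h (inr A B b) = hB b"
      by (rule free_product_lift[OF nA nB D hA(1) hB(1)]) blast
    \<comment> \<open>So far h agrees with \<open>f k\<close> only on images from A and B; the face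
      of the free product is generated by these.\<close>
    have hf: "h x = f k x" if x: "x \<in> face ?C k" for k x
    proof -
      have "subalg_gen ?C (?S k) \<subseteq> {x \<in> face ?C k. h x = f k x}"
      proof (rule subalg_gen_minimal)
        have z: "f k \<zero>\<^bsub>?C\<^esub> = \<zero>\<^bsub>D\<^esub>"
          using alg_hom_zero[OF nu_algebra_subalg[OF nC sub] D f] by simp
        have "face ?C k \<subseteq> carrier ?C" using sub[of k] by (simp add: subalg_def)
        then show "subalg {x \<in> face ?C k. h x = f k x} ?C"
          using sub[of k] z alg_hom_zero[OF nC D h(1)] alg_homD(2-4)[OF f[of k]] alg_homD(2-4)[OF h(1)]
          by (auto simp: subalg_def subset_iff)
        show "?S k \<subseteq> {x \<in> face ?C k. h x = f k x}"
          using Sf[of k] h(2,3) hA(2) hB(2) faced_algebraD(3)[OF A, of k] faced_algebraD(3)[OF B, of k] by auto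
      qed
      then show ?thesis using x face by blast
    qed
    show "\<exists>h. alg_hom ?C D h \<and> (\<forall>k. \<forall>a\<in>carrier (?C\<lparr>carrier := face ?C k\<rparr>). h a = f k a) \<and>
      (\<forall>h'. alg_hom ?C D h' \<and> (\<forall>k. \<forall>a\<in>carrier (?C\<lparr>carrier := face ?C k\<rparr>). h' a = f k a) \<longrightarrow>
        (\<forall>x\<in>carrier ?C. h' x = h x))"
    proof (intro exI[of _ h] conjI allI ballI impI h(1))
      show "h a = f k a" if "a \<in> carrier (?C\<lparr>carrier := face ?C k\<rparr>)" for k a using hf that by simp
      fix h' x
      assume h': "alg_hom ?C D h' \<and> (\<forall>k. \<forall>a\<in>carrier (?C\<lparr>carrier := face ?C k\<rparr>). h' a = f k a)"
        and x: "x \<in> carrier ?C"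
      have eq: "h' x = h x" if "x \<in> face ?C k" for x k using h' hf that by simp
      have lf: "inl A B a \<in> face ?C k" if "a \<in> face A k" for a k using that Sf[of k] by blast
      have rf: "inr A B b \<in> face ?C k" if "b \<in> face B k" for b k using that Sf[of k] by blast
      show "h' x = h x"
      proof (rule free_product_hom_eq[OF nA nB D _ h(1) _ _ x])
        show hh: "alg_hom ?C D h'" using h' by blast
        show "h' (inl A B a) = h (inl A B a)" if "a \<in> carrier A" for a
          by (rule coproduct_unique[OF faced_algebraD(4)[OF A] D alg_hom_comp[OF l hh] alg_hom_comp[OF l h(1)] _ that])
             (use eq[OF lf] in auto)
        show "h' (inr A B b) = h (inr A B b)" if "b \<in> carrier B" for b
          by (rule coproduct_unique[OF faced_algebraD(4)[OF B] D alg_hom_comp[OF r hh] alg_hom_comp[OF r h(1)] _ that])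
             (use eq[OF rf] in auto)
      qed
    qed
  qed
  then show ?thesis using nC sub by (simp add: faced_algebra_def)
qed

lemma zero_alg_simps [simp]:
  "carrier zero_alg = {undefined}" "x \<otimes>\<^bsub>zero_alg\<^esub> y = undefined" "x \<oplus>\<^bsub>zero_alg\<^esub> y = undefined"
  "c \<odot>\<^bsub>zero_alg\<^esub> x = undefined" "\<zero>\<^bsub>zero_alg\<^esub> = undefined" "face zero_alg k = {undefined}"
  by (simp_all add: zero_alg_def)

lemma zero_alg_faced: "faced_algebra (zero_alg :: ('u, 'm::finite) faced)"
proof -
  let ?Z = "zero_alg :: ('u, 'm) faced"
  have mod: "Module.module complex_ring ?Z" by (rule module_complexI) auto
  have nu: "nu_algebra ?Z" unfolding nu_algebra_def by (simp add: mod)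
  have "is_coproduct (\<lambda>k. ?Z\<lparr>carrier := face ?Z k\<rparr>) ?Z (\<lambda>k x. x)"
    unfolding is_coproduct_def
  proof (intro conjI allI impI nu)
    show "alg_hom (?Z\<lparr>carrier := face ?Z k\<rparr>) ?Z (\<lambda>x. x)" for k by (simp add: alg_hom_def)
    fix D :: "(complex, 'u) module" and f :: "'m \<Rightarrow> 'u \<Rightarrow> 'u"
    assume Df: "nu_algebra D \<and> (\<forall>k. alg_hom (?Z\<lparr>carrier := face ?Z k\<rparr>) D (f k))"
    then have D: "nu_algebra D" by simp
    note d = module_complexD[OF nu_algebraD(1)[OF D]]
    \<comment> \<open>A homomorphism on a one-point algebra has a value fixed by multiplication by
      0.\<close>
    have hz: "h undefined = \<zero>\<^bsub>D\<^esub>" if h: "alg_hom (?Z\<lparr>carrier := {undefined}\<rparr>) D h" for h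
    proof -
      have "h undefined \<in> carrier D" "h undefined = 0 \<odot>\<^bsub>D\<^esub> h undefined"
        using h unfolding alg_hom_def by auto
      then show ?thesis using d(12) by simp
    qed
    have e: "?Z\<lparr>carrier := {undefined}\<rparr> = ?Z" by (simp add: zero_alg_def)
    show "\<exists>h. alg_hom ?Z D h \<and> (\<forall>k. \<forall>a\<in>carrier (?Z\<lparr>carrier := face ?Z k\<rparr>). h a = f k a) \<and>
      (\<forall>h'. alg_hom ?Z D h' \<and> (\<forall>k. \<forall>a\<in>carrier (?Z\<lparr>carrier := face ?Z k\<rparr>). h' a = f k a) \<longrightarrow>
        (\<forall>x\<in>carrier ?Z. h' x = h x))"
    proof (intro exI[of _ "\<lambda>_. \<zero>\<^bsub>D\<^esub>"] conjI allI ballI impI)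
      show "alg_hom ?Z D (\<lambda>_. \<zero>\<^bsub>D\<^esub>)"
        using d(1,5,13) nu_algebra_zero_mult[OF D d(1)] by (simp add: alg_hom_def)
      show "\<zero>\<^bsub>D\<^esub> = f k a" if "a \<in> carrier (?Z\<lparr>carrier := face ?Z k\<rparr>)" for k a
        using hz[of "f k"] Df that by simp
      show "h' x = \<zero>\<^bsub>D\<^esub>"
        if "alg_hom ?Z D h' \<and> (\<forall>k. \<forall>a\<in>carrier (?Z\<lparr>carrier := face ?Z k\<rparr>). h' a = f k a)" "x \<in> carrier ?Z" for h' x
        using hz[of h'] that by (simp add: e)
    qed
  qed
  then show ?thesis using nu by (simp add: faced_algebra_def subalg_def)
qed

section \<open>Free faced algebras\<close>

text \<open>The free nonunital algebra on the letters, as the semigroup algebra of nonempty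
  words.\<close>

definition word_alg :: "(complex, 'l list \<Rightarrow>\<^sub>0 complex) module" where
  "word_alg = monoid_alg \<lparr>carrier = {w. w \<noteq> []}, mult = (@), one = []\<rparr>"

lemma word_alg_simps [simp]:
  "carrier word_alg = {p. Poly_Mapping.keys p \<subseteq> {w. w \<noteq> []}}"
  "p \<oplus>\<^bsub>word_alg\<^esub> q = p + q" "\<zero>\<^bsub>word_alg\<^esub> = 0" "c \<odot>\<^bsub>word_alg\<^esub> p = Poly_Mapping.map ((*) c) p"
  "Poly_Mapping.single v a \<otimes>\<^bsub>word_alg\<^esub> Poly_Mapping.single w b = Poly_Mapping.single (v @ w) (a * b)"
  by (simp_all add: word_alg_def monoid_alg_mult_single)

lemma word_alg_distrib:
  "(p + p') \<otimes>\<^bsub>word_alg\<^esub> q = p \<otimes>\<^bsub>word_alg\<^esub> q + p' \<otimes>\<^bsub>word_alg\<^esub> q"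
  "q \<otimes>\<^bsub>word_alg\<^esub> (p + p') = q \<otimes>\<^bsub>word_alg\<^esub> p + q \<otimes>\<^bsub>word_alg\<^esub> p'"
  "0 \<otimes>\<^bsub>word_alg\<^esub> q = 0" "q \<otimes>\<^bsub>word_alg\<^esub> 0 = 0"
  by (simp_all add: word_alg_def monoid_alg_distrib_left monoid_alg_distrib_right)

lemma word_alg_nu_algebra: "nu_algebra word_alg"
proof -
  let ?M = "\<lparr>carrier = {w. w \<noteq> []}, mult = (@), one = []\<rparr>"
  have mod: "Module.module complex_ring word_alg" unfolding word_alg_def by (rule monoid_alg_module)
  have "x \<otimes>\<^bsub>word_alg\<^esub> y \<in> carrier word_alg" if "x \<in> carrier word_alg" "y \<in> carrier word_alg"
    for x y :: "'a list \<Rightarrow>\<^sub>0 complex"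
    using that monoid_alg_closed[of ?M x y] by (simp add: word_alg_def)
  moreover have "(x \<otimes>\<^bsub>word_alg\<^esub> y) \<otimes>\<^bsub>word_alg\<^esub> z = x \<otimes>\<^bsub>word_alg\<^esub> (y \<otimes>\<^bsub>word_alg\<^esub> z)"
    if "x \<in> carrier word_alg" "y \<in> carrier word_alg" "z \<in> carrier word_alg" for x y z :: "'a list \<Rightarrow>\<^sub>0 complex"
    using that monoid_alg_assoc[of ?M x y z] by (simp add: word_alg_def)
  ultimately show ?thesis
    unfolding nu_algebra_def
    by (simp add: mod word_alg_distrib) (simp add: word_alg_def monoid_alg_scale)
qed

lemma lprod_word_alg: "w \<noteq> [] \<Longrightarrow> lprod word_alg (map (\<lambda>l. Poly_Mapping.single [l] 1) w) = Poly_Mapping.single w 1"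
proof (induction w)
  case (Cons l w)
  then show ?case by (cases "w = []") (simp_all add: lprod_Cons)
qed simp

lemma lprod_subalg: "lprod (A\<lparr>carrier := T\<rparr>) xs = lprod A xs"
proof (induction xs)
  case (Cons x xs)
  then show ?case by (cases "xs = []") (simp_all add: lprod_Cons)
qed simp

lemma module_smult_commute:
  assumes "Module.module complex_ring A" "x \<in> carrier A"
  shows "c \<odot>\<^bsub>A\<^esub> (d \<odot>\<^bsub>A\<^esub> x) = d \<odot>\<^bsub>A\<^esub> (c \<odot>\<^bsub>A\<^esub> x)"
  using module_complexD(10)[OF assms(1,2)] by (metis mult.commute)

text \<open>The free faced algebra on letters coloured by faces, moved into the universe along
  \<open>e\<close>. Any choice of images in the faces of the right colours gives a faced
  homomorphism; this makes substitution available as a source of naturality.\<close>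

locale free_faced =
  fixes e :: "('l list \<Rightarrow>\<^sub>0 complex) \<Rightarrow> 'u" and \<kappa> :: "'l \<Rightarrow> 'm::finite"
  assumes e: "inj e"
begin

definition face_words :: "'m \<Rightarrow> 'l list set" where
  "face_words k = {w. w \<noteq> [] \<and> (\<forall>l\<in>set w. \<kappa> l = k)}"

definition F :: "('u, 'm) faced" where
  "F = module.extend (transport e word_alg)
     (faced.fields (\<lambda>k. e ` {p. Poly_Mapping.keys p \<subseteq> face_words k}))"

definition letter :: "'l \<Rightarrow> 'u" where
  "letter l = e (Poly_Mapping.single [l] 1)"

lemma e_on: "inj_on e (carrier word_alg)"
  using e by (rule inj_on_subset) simp

lemma F_fields:
  "carrier F = carrier (transport e word_alg)" "mult F = mult (transport e word_alg)"
  "\<zero>\<^bsub>F\<^esub> = \<zero>\<^bsub>transport e word_alg\<^esub>" "add F = add (transport e word_alg)"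
  "smult F = smult (transport e word_alg)"
  by (simp_all add: F_def module.extend_def)

lemma F_face: "face F k = e ` {p. Poly_Mapping.keys p \<subseteq> face_words k}"
  by (simp add: F_def module.extend_def faced.fields_def)

lemma F_carrier: "carrier F = e ` {p. Poly_Mapping.keys p \<subseteq> {w. w \<noteq> []}}"
  unfolding F_fields transport_simps(1)[OF e_on] by simp

lemma F_nu_algebra: "nu_algebra F"
  by (rule nu_algebra_cong[OF transport_nu_algebra[OF word_alg_nu_algebra e_on]]) (simp_all add: F_fields)

lemma e_hom: "alg_hom word_alg F e"
  using transport_hom(1)[OF word_alg_nu_algebra e_on] by (simp add: alg_hom_def F_fields)

lemma F_ops:
  assumes "Poly_Mapping.keys p \<subseteq> {w. w \<noteq> []}" "Poly_Mapping.keys q \<subseteq> {w. w \<noteq> []}"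
  shows "e p \<oplus>\<^bsub>F\<^esub> e q = e (p + q)" "e p \<otimes>\<^bsub>F\<^esub> e q = e (p \<otimes>\<^bsub>word_alg\<^esub> q)"
    "c \<odot>\<^bsub>F\<^esub> e p = e (Poly_Mapping.map ((*) c) p)"
  using alg_homD(2-4)[OF e_hom, of p] assms by auto

lemma F_zero: "\<zero>\<^bsub>F\<^esub> = e 0"
  using alg_hom_zero[OF word_alg_nu_algebra F_nu_algebra e_hom] by simp

lemma F_word:
  assumes "w \<noteq> []"
  shows "lprod F (map letter w) = e (Poly_Mapping.single w 1)"
proof -
  have "set (map (\<lambda>l. Poly_Mapping.single [l] 1) w) \<subseteq> carrier word_alg" by auto
  from alg_hom_lprod[OF word_alg_nu_algebra F_nu_algebra e_hom this] show ?thesis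
    unfolding lprod_word_alg[OF assms] map_map by (simp add: comp_def letter_def[abs_def])
qed

lemma letter_closed: "letter l \<in> carrier F"
  unfolding letter_def F_carrier by (intro imageI) simp

lemma letter_face: "letter l \<in> face F (\<kappa> l)"
  unfolding letter_def F_face by (intro imageI) (simp add: face_words_def)

lemma F_induct [consumes 1, case_names zero add]:
  assumes "x \<in> carrier F" "P (e 0)"
    and "\<And>w c p. w \<noteq> [] \<Longrightarrow> Poly_Mapping.keys p \<subseteq> {w. w \<noteq> []} \<Longrightarrow> P (e p) \<Longrightarrow>
       P ((c \<odot>\<^bsub>F\<^esub> lprod F (map letter w)) \<oplus>\<^bsub>F\<^esub> e p)"
  shows "P x"
proof -
  obtain p where p: "Poly_Mapping.keys p \<subseteq> {w. w \<noteq> []}" "x = e p" using assms(1) by (auto simp: F_carrier)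
  from p(1) have "P (e p)"
  proof (induction p rule: pm_induct)
    case (add w c p)
    then have "e (Poly_Mapping.single w c + p) = (c \<odot>\<^bsub>F\<^esub> lprod F (map letter w)) \<oplus>\<^bsub>F\<^esub> e p"
      by (simp add: F_word F_ops scale_single)
    then show ?case using assms(3) add by simp
  qed (use assms in simp)
  then show ?thesis using p by simp
qed

lemma F_lin_eq:
  assumes "lin_fun F f" "lin_fun F g" "x \<in> carrier F"
    and "\<And>w. w \<noteq> [] \<Longrightarrow> f (lprod F (map letter w)) = g (lprod F (map letter w))"
  shows "f x = g x"
  using assms(3)
proof (induction x rule: F_induct)
  case zero
  have 0: "h (e 0) = 0" if "lin_fun F h" for h
    using that F_ops(3)[of 0 0 0] letter_closed F_nu_algebra module_complexD(1)[OF nu_algebraD(1)[OF F_nu_algebra]]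
    unfolding lin_fun_def F_zero by (metis keys_zero empty_subsetI scale_zero mult_zero_left)
  show ?case by (simp add: 0[OF assms(1)] 0[OF assms(2)])
next
  case (add w c p)
  have l: "lprod F (map letter w) \<in> carrier F"
    using letter_closed by (intro lprod_closed[OF F_nu_algebra]) auto
  have p: "e p \<in> carrier F" using add(2) by (auto simp: F_carrier)
  have eq: "h (c \<odot>\<^bsub>F\<^esub> lprod F (map letter w) \<oplus>\<^bsub>F\<^esub> e p) = c * h (lprod F (map letter w)) + h (e p)" if "lin_fun F h" for h
    using that l p module_complexD(7)[OF nu_algebraD(1)[OF F_nu_algebra] l] by (simp add: lin_fun_def)
  show ?case by (simp add: eq[OF assms(1)] eq[OF assms(2)] assms(4) add)
qed

definition free_hom :: "(complex, 'u, 'z) module_scheme \<Rightarrow> ('l \<Rightarrow> 'u) \<Rightarrow> 'u \<Rightarrow> 'u" where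
  "free_hom D g x = lext D (\<lambda>w. lprod D (map g w)) (inv_into UNIV e x)"

lemma free_hom:
  fixes D :: "(complex, 'u, 'z) module_scheme"
  assumes D: "nu_algebra D" and g: "\<And>l. g l \<in> carrier D"
  shows "alg_hom F D (free_hom D g)" "free_hom D g (letter l) = g l"
proof -
  let ?A = "{w :: 'l list. w \<noteq> []}" and ?m = "\<lambda>w. lprod D (map g w)"
  note d = nu_algebraD[OF D] and dm = module_complexD[OF nu_algebraD(1)[OF D]]
  have m: "?m w \<in> carrier D" for w using g by (intro lprod_closed[OF D]) auto
  note L = d(1) m
  have h: "free_hom D g (e p) = lext D ?m p" for p by (simp add: free_hom_def e)
  have mult: "lext D ?m (p \<otimes>\<^bsub>word_alg\<^esub> q) = lext D ?m p \<otimes>\<^bsub>D\<^esub> lext D ?m q"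
    if p: "Poly_Mapping.keys p \<subseteq> ?A" and q: "Poly_Mapping.keys q \<subseteq> ?A" for p q
    using p
  proof (induction p rule: pm_induct)
    case zero
    show ?case using lext_zero[where m = ?m, OF L] lext_closed[where m = ?m, OF L q] nu_algebra_zero_mult[OF D]
      by (simp add: word_alg_distrib)
  next
    case (add v a p)
    have "lext D ?m (Poly_Mapping.single v a \<otimes>\<^bsub>word_alg\<^esub> q) = (a \<odot>\<^bsub>D\<^esub> ?m v) \<otimes>\<^bsub>D\<^esub> lext D ?m q"
      using q
    proof (induction q rule: pm_induct)
      case zero
      show ?case using lext_zero[where m = ?m, OF L] nu_algebra_zero_mult[OF D] dm(7)[OF m]
        by (simp add: word_alg_distrib)
    next
      case (add w b q)
      have "(a * b) \<odot>\<^bsub>D\<^esub> lprod D (map g (v @ w)) = (a \<odot>\<^bsub>D\<^esub> ?m v) \<otimes>\<^bsub>D\<^esub> (b \<odot>\<^bsub>D\<^esub> ?m w)"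
        using lprod_append[OF D, of "map g v" "map g w"] add(1) \<open>v \<in> ?A\<close> g m dm(7,10) d(2,6,7)
          module_smult_commute[OF d(1) d(2)[OF m m], of a b v w]
        by (simp add: image_subset_iff)
      then show ?case
        using add(3) lext_closed[where m = ?m, OF L add(2)] dm(7)[OF m] d(5)
        by (simp add: word_alg_distrib lext_add[where m = ?m and A = UNIV, OF L] lext_single[where m = ?m and A = UNIV, OF L])
    qed
    then show ?case
      using add(3) lext_closed[where m = ?m, OF L add(2)] lext_closed[where m = ?m, OF L q] dm(7)[OF m] d(4)
      by (simp add: word_alg_distrib lext_add[where m = ?m and A = UNIV, OF L] lext_single[where m = ?m and A = UNIV, OF L])
  qed
  show "alg_hom F D (free_hom D g)"
    unfolding alg_hom_def F_carrier
    by (auto simp: F_ops h mult lext_add[where m = ?m and A = UNIV, OF L] lext_scale[where m = ?m and A = UNIV, OF L]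
        intro: lext_closed[where m = ?m and A = UNIV, OF L])
  show "free_hom D g (letter l) = g l"
    unfolding letter_def h using lext_single[where m = ?m and A = UNIV, OF L] dm(11)[OF g] by simp
qed

text \<open>The face of a colour is generated by the letters of that colour. A family of
  homomorphisms on the faces therefore amounts to one value for each letter, and
  \<open>free_hom\<close> realises these values.\<close>

lemma F_faced: "faced_algebra F"
proof -
  have sub: "subalg (face F k) F" for k
    unfolding subalg_def
  proof (intro conjI ballI allI)
    show "face F k \<subseteq> carrier F" unfolding F_face F_carrier by (intro image_mono) (auto simp: face_words_def)
    show "\<zero>\<^bsub>F\<^esub> \<in> face F k" by (simp add: F_zero F_face)
  next
    fix x y assume "x \<in> face F k" "y \<in> face F k"
    then obtain p q where pq: "x = e p" "y = e q" "Poly_Mapping.keys p \<subseteq> face_words k" "Poly_Mapping.keys q \<subseteq> face_words k"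
      by (auto simp: F_face)
    have ne: "Poly_Mapping.keys p \<subseteq> {w. w \<noteq> []}" "Poly_Mapping.keys q \<subseteq> {w. w \<noteq> []}"
      using pq(3,4) by (auto simp: face_words_def)
    show "x \<oplus>\<^bsub>F\<^esub> y \<in> face F k"
      unfolding pq F_ops[OF ne] F_face using pq(3,4) Poly_Mapping.keys_add[of p q] by blast
    have "Poly_Mapping.keys (p \<otimes>\<^bsub>word_alg\<^esub> q) \<subseteq> face_words k"
      using monoid_alg_closed[of "\<lparr>carrier = face_words k, mult = (@), one = []\<rparr>" p q] pq(3,4)
      by (simp add: word_alg_def monoid_alg_mult) (auto simp: face_words_def)
    then show "x \<otimes>\<^bsub>F\<^esub> y \<in> face F k" unfolding pq F_ops[OF ne] F_face by blast
  next
    fix c x assume "x \<in> face F k"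
    then obtain p where p: "x = e p" "Poly_Mapping.keys p \<subseteq> face_words k" by (auto simp: F_face)
    then have ne: "Poly_Mapping.keys p \<subseteq> {w. w \<noteq> []}" by (auto simp: face_words_def)
    show "c \<odot>\<^bsub>F\<^esub> x \<in> face F k"
      unfolding p F_ops[OF ne ne] F_face using p(2) keys_scale_subset[of c p] by blast
  qed
  have "is_coproduct (\<lambda>k. F\<lparr>carrier := face F k\<rparr>) F (\<lambda>k x. x)"
    unfolding is_coproduct_def
  proof (intro conjI allI impI F_nu_algebra)
    show "alg_hom (F\<lparr>carrier := face F k\<rparr>) F (\<lambda>x. x)" for k
      using sub[of k] by (auto simp: alg_hom_def subalg_def)
    fix D :: "(complex, 'u) module" and f :: "'m \<Rightarrow> 'u \<Rightarrow> 'u"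
    assume Df: "nu_algebra D \<and> (\<forall>k. alg_hom (F\<lparr>carrier := face F k\<rparr>) D (f k))"
    then have D: "nu_algebra D" and f: "\<And>k. alg_hom (F\<lparr>carrier := face F k\<rparr>) D (f k)" by auto
    let ?g = "\<lambda>l. f (\<kappa> l) (letter l)"
    have g: "?g l \<in> carrier D" for l using alg_homD(1)[OF f] letter_face by simp
    note h = free_hom[OF D, of ?g, OF g]
    have gen: "face F k = subalg_gen F (letter ` {l. \<kappa> l = k})" for k
    proof
      have S: "letter ` {l. \<kappa> l = k} \<subseteq> carrier F" using letter_closed by auto
      note sg = subalg_gen_subalg[OF F_nu_algebra S]
      show "subalg_gen F (letter ` {l. \<kappa> l = k}) \<subseteq> face F k"
        using letter_face by (intro subalg_gen_minimal[OF sub]) auto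
      have w: "lprod F (map letter w) \<in> subalg_gen F (letter ` {l. \<kappa> l = k})" if "w \<in> face_words k" for w
      proof -
        have "set (map letter w) \<subseteq> carrier (F\<lparr>carrier := subalg_gen F (letter ` {l. \<kappa> l = k})\<rparr>)"
          using subalg_gen_superset[of "letter ` {l. \<kappa> l = k}" F] that by (auto simp: face_words_def)
        from lprod_closed[OF nu_algebra_subalg[OF F_nu_algebra sg] this] show ?thesis
          by (simp add: lprod_subalg)
      qed
      show "face F k \<subseteq> subalg_gen F (letter ` {l. \<kappa> l = k})"
      proof
        fix x assume "x \<in> face F k"
        then obtain p where p: "x = e p" "Poly_Mapping.keys p \<subseteq> face_words k" by (auto simp: F_face)
        from p(2) show "x \<in> subalg_gen F (letter ` {l. \<kappa> l = k})" unfolding p(1)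
        proof (induction p rule: pm_induct)
          case zero
          then show ?case using sg by (simp add: subalg_def F_zero)
        next
          case (add v c p)
          then have "v \<noteq> []" "Poly_Mapping.keys p \<subseteq> {w. w \<noteq> []}" by (auto simp: face_words_def)
          then have "e (Poly_Mapping.single v c + p) = (c \<odot>\<^bsub>F\<^esub> lprod F (map letter v)) \<oplus>\<^bsub>F\<^esub> e p"
            by (simp add: F_word F_ops scale_single)
          then show ?case using sg w[OF add(1)] add(3) by (simp add: subalg_def)
        qed
      qed
    qed
    have lf: "letter ` {l. \<kappa> l = k} \<subseteq> carrier F" for k using letter_closed by auto
    have hom_k: "alg_hom (F\<lparr>carrier := face F k\<rparr>) D h'" if "alg_hom F D h'" for h' k
      using that sub[of k] by (auto simp: alg_hom_def subalg_def subset_iff)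
    \<comment> \<open>The same generation statement inside the face taken as an algebra, since
      \<open>f k\<close> is a homomorphism on the face only.\<close>
    have gen': "subalg_gen (F\<lparr>carrier := face F k\<rparr>) (letter ` {l. \<kappa> l = k}) = face F k" for k
    proof
      let ?S = "letter ` {l. \<kappa> l = k}" and ?Fk = "F\<lparr>carrier := face F k\<rparr>"
      have S: "?S \<subseteq> carrier ?Fk" using letter_face by auto
      note sg = subalg_gen_subalg[OF nu_algebra_subalg[OF F_nu_algebra sub] S]
      show "subalg_gen ?Fk ?S \<subseteq> face F k" using sg by (simp add: subalg_def)
      have "subalg (subalg_gen ?Fk ?S) F" using sg sub[of k] by (auto simp: subalg_def)
      then show "face F k \<subseteq> subalg_gen ?Fk ?S" using subalg_gen_minimal[OF _ subalg_gen_superset] gen[of k] by blast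
    qed
    have hf: "free_hom D ?g x = f k x" if "x \<in> face F k" for k x
    proof (rule alg_hom_eq_on_gen[OF nu_algebra_subalg[OF F_nu_algebra sub] D hom_k[OF h(1)] f])
      show "x \<in> subalg_gen (F\<lparr>carrier := face F k\<rparr>) (letter ` {l. \<kappa> l = k})" using that gen' by simp
    qed (use letter_face h(2) in auto)
    show "\<exists>h. alg_hom F D h \<and> (\<forall>k. \<forall>a\<in>carrier (F\<lparr>carrier := face F k\<rparr>). h a = f k a) \<and>
      (\<forall>h'. alg_hom F D h' \<and> (\<forall>k. \<forall>a\<in>carrier (F\<lparr>carrier := face F k\<rparr>). h' a = f k a) \<longrightarrow>
        (\<forall>x\<in>carrier F. h' x = h x))"
    proof (intro exI[of _ "free_hom D ?g"] conjI allI ballI impI h(1))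
      show "free_hom D ?g a = f k a" if "a \<in> carrier (F\<lparr>carrier := face F k\<rparr>)" for k a using hf that by simp
      fix h' x
      assume h': "alg_hom F D h' \<and> (\<forall>k. \<forall>a\<in>carrier (F\<lparr>carrier := face F k\<rparr>). h' a = f k a)" and x: "x \<in> carrier F"
      have eq: "h' (letter l) = free_hom D ?g (letter l)" for l
        using h' letter_face[of l] hf[OF letter_face[of l]] by simp
      have hz: "h' \<zero>\<^bsub>F\<^esub> = \<zero>\<^bsub>D\<^esub>" "free_hom D ?g \<zero>\<^bsub>F\<^esub> = \<zero>\<^bsub>D\<^esub>"
        using alg_hom_zero[OF F_nu_algebra D] h' h(1) by blast+
      have lp: "k (lprod F (map letter w)) = lprod D (map (\<lambda>l. k (letter l)) w)" if "alg_hom F D k" for k w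
        using alg_hom_lprod[OF F_nu_algebra D that, of "map letter w"] letter_closed by (auto simp: comp_def)
      show "h' x = free_hom D ?g x"
        using x
      proof (induction x rule: F_induct)
        case (add w c p)
        have l: "lprod F (map letter w) \<in> carrier F"
          using letter_closed by (intro lprod_closed[OF F_nu_algebra]) auto
        have p: "e p \<in> carrier F" using add(2) by (auto simp: F_carrier)
        have eq': "k (c \<odot>\<^bsub>F\<^esub> lprod F (map letter w) \<oplus>\<^bsub>F\<^esub> e p) = c \<odot>\<^bsub>D\<^esub> lprod D (map (\<lambda>l. k (letter l)) w) \<oplus>\<^bsub>D\<^esub> k (e p)"
          if "alg_hom F D k" for k
          using alg_homD(2,4)[OF that] l p module_complexD(7)[OF nu_algebraD(1)[OF F_nu_algebra] l] lp[OF that] by simp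
        show ?case using eq'[of h'] eq'[OF h(1)] h' eq add(3) by simp
      qed (use hz in \<open>simp add: F_zero\<close>)
    qed
  qed
  then show ?thesis using F_nu_algebra sub by (simp add: faced_algebra_def)
qed

lemma free_hom_faced:
  assumes A: "faced_algebra A" and g: "\<And>l. g l \<in> face A (\<kappa> l)"
  shows "faced_hom F A (free_hom A g)"
proof -
  have gc: "g l \<in> carrier A" for l using g faced_algebraD(3)[OF A] by blast
  note h = free_hom[OF faced_algebraD(1)[OF A], of g, OF gc]
  have sub: "subalg (face A k) A" for k by (rule faced_algebraD(2)[OF A])
  have "free_hom A g x \<in> face A k" if x: "x \<in> face F k" for x k
  proof -
    obtain p where p: "x = e p" "Poly_Mapping.keys p \<subseteq> face_words k" using x by (auto simp: F_face)
    from p(2) show ?thesis unfolding p(1)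
    proof (induction p rule: pm_induct)
      case zero
      have "free_hom A g (e 0) = \<zero>\<^bsub>A\<^esub>"
        using alg_hom_zero[OF F_nu_algebra faced_algebraD(1)[OF A] h(1)] by (simp add: F_zero)
      then show ?case using sub[of k] by (simp add: subalg_def)
    next
      case (add v c p)
      then have v: "v \<noteq> []" "Poly_Mapping.keys p \<subseteq> {w. w \<noteq> []}" "\<forall>l\<in>set v. \<kappa> l = k" by (auto simp: face_words_def)
      then have eq: "e (Poly_Mapping.single v c + p) = (c \<odot>\<^bsub>F\<^esub> lprod F (map letter v)) \<oplus>\<^bsub>F\<^esub> e p"
        by (simp add: F_word F_ops scale_single)
      have l: "lprod F (map letter v) \<in> carrier F"
        using letter_closed by (intro lprod_closed[OF F_nu_algebra]) auto
      have pc: "e p \<in> carrier F" using v(2) by (auto simp: F_carrier)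
      have "lprod A (map g v) \<in> face A k"
      proof -
        have "set (map g v) \<subseteq> carrier (A\<lparr>carrier := face A k\<rparr>)" using g v(3) by force
        from lprod_closed[OF nu_algebra_subalg[OF faced_algebraD(1)[OF A] sub[of k]] this] show ?thesis
          by (simp add: lprod_subalg)
      qed
      moreover have "free_hom A g (lprod F (map letter v)) = lprod A (map g v)"
        using alg_hom_lprod[OF F_nu_algebra faced_algebraD(1)[OF A] h(1), of "map letter v"] letter_closed h(2)
        by (auto simp: comp_def)
      ultimately show ?case
        unfolding eq using alg_homD(2,4)[OF h(1)] l pc add(3) sub[of k]
          module_complexD(7)[OF nu_algebraD(1)[OF F_nu_algebra] l]
        by (simp add: subalg_def)
    qed
  qed
  then show ?thesis using h(1) by (auto simp: faced_hom_def)
qed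

text \<open>The nonempty words are a basis of \<open>F\<close>, so functionals on it can be
  prescribed at will on words.\<close>

definition lin_words :: "('l list \<Rightarrow> complex ^ 'd) \<Rightarrow> 'u \<Rightarrow> complex ^ 'd" where
  "lin_words \<phi> x = (\<chi> k. lin_ext (\<lambda>w. \<phi> w $ k) (inv_into UNIV e x))"

lemma lin_words_linear: "linear_map F (lin_words \<phi>)"
  unfolding linear_map_def F_carrier
  by (auto simp: lin_words_def F_ops e lin_ext_add lin_ext_scale vec_eq_iff)

lemma lin_words_word: "w \<noteq> [] \<Longrightarrow> lin_words \<phi> (lprod F (map letter w)) = \<phi> w"
  by (simp add: F_word lin_words_def e vec_eq_iff)

end

section \<open>Universal products are polynomial\<close>

lemma dsum_simps [simp]:
  "carrier (dsum A) = {a. \<forall>k. a $ k \<in> carrier A}" "\<zero>\<^bsub>dsum A\<^esub> = (\<chi> k. \<zero>\<^bsub>A\<^esub>)"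
  "a \<oplus>\<^bsub>dsum A\<^esub> b = (\<chi> k. a $ k \<oplus>\<^bsub>A\<^esub> b $ k)" "c \<odot>\<^bsub>dsum A\<^esub> a = (\<chi> k. c \<odot>\<^bsub>A\<^esub> a $ k)"
  by (simp_all add: dsum_def)

lemma dsum_module:
  assumes "Module.module complex_ring A"
  shows "Module.module complex_ring (dsum A :: (complex, 'a ^ 'd) module)"
proof -
  note m = module_complexD[OF assms]
  show ?thesis
  proof (rule module_complexI)
    fix x y :: "'a ^ 'd" assume "x \<in> carrier (dsum A)" "y \<in> carrier (dsum A)"
    then show "x \<oplus>\<^bsub>dsum A\<^esub> y = y \<oplus>\<^bsub>dsum A\<^esub> x" using m(4) by (simp add: vec_eq_iff)
  qed (use m(1-3,5-12) in \<open>simp_all add: vec_eq_iff\<close>)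
qed

lemma linear_map_zero:
  assumes "Module.module complex_ring A" "linear_map A \<phi>"
  shows "\<phi> \<zero>\<^bsub>A\<^esub> = 0"
  using assms(2) module_complexD(1,13)[OF assms(1)] unfolding linear_map_def by (metis vector_smult_lzero)

lemma linear_map_component: "linear_map A \<phi> \<Longrightarrow> lin_fun A (\<lambda>x. \<phi> x $ k)"
  by (simp add: linear_map_def lin_fun_def)

lemma transp_lin_fun: "linear_map A \<phi> \<Longrightarrow> lin_fun (dsum A) (transp \<phi>)"
  by (simp add: linear_map_def lin_fun_def transp_def sum.distrib sum_distrib_left)

definition dsum_unit :: "(complex, 'a, 'x) module_scheme \<Rightarrow> 'd \<Rightarrow> 'a \<Rightarrow> 'a ^ 'd" where
  "dsum_unit A k a = (\<chi> i. if i = k then a else \<zero>\<^bsub>A\<^esub>)"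

lemma dsum_unit_closed:
  "Module.module complex_ring A \<Longrightarrow> a \<in> carrier A \<Longrightarrow> dsum_unit A k a \<in> carrier (dsum A)"
  using module_complexD(1) by (auto simp: dsum_unit_def)

lemma transp_dsum_unit:
  assumes "Module.module complex_ring A" "linear_map A \<phi>"
  shows "transp \<phi> (dsum_unit A k a) = \<phi> a $ k"
proof -
  have "transp \<phi> (dsum_unit A k a) = (\<Sum>i\<in>UNIV. if i = k then \<phi> a $ k else 0)"
    unfolding transp_def dsum_unit_def
    by (rule sum.cong) (auto simp: linear_map_zero[OF assms])
  then show ?thesis by simp
qed

text \<open>The polynomial functions of a pair of functionals: evaluations at the characters
  belonging to the pair of one element of the tensor product. The defining formula of
  \<open>sigma\<close> requires the values of a universal product to be of this kind.\<close>

definition representable ::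
  "('u, 'm) faced \<Rightarrow> ('u, 'm) faced \<Rightarrow> (('u \<Rightarrow> complex ^ 'd) \<Rightarrow> ('u \<Rightarrow> complex ^ 'd) \<Rightarrow> complex) \<Rightarrow> bool" where
  "representable A1 A2 G \<longleftrightarrow>
     (\<exists>p\<in>carrier (tensor (Sym (dsum A1 :: (complex, 'u ^ 'd) module)) (Sym (dsum A2 :: (complex, 'u ^ 'd) module))).
        \<forall>\<phi>1 \<phi>2. linear_map A1 \<phi>1 \<longrightarrow> linear_map A2 \<phi>2 \<longrightarrow>
          G \<phi>1 \<phi>2 = tensor_fun (sym_fun (transp \<phi>1)) (sym_fun (transp \<phi>2)) p)"

context
  fixes A1 A2 :: "('u, 'm) faced" and d :: "'d::finite itself"
  assumes A1: "nu_algebra A1" and A2: "nu_algebra A2"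
begin

private abbreviation "dV1 \<equiv> (dsum A1 :: (complex, 'u ^ 'd) module)"
private abbreviation "dV2 \<equiv> (dsum A2 :: (complex, 'u ^ 'd) module)"

private abbreviation "rep \<equiv> (representable A1 A2 :: (('u \<Rightarrow> complex ^ 'd) \<Rightarrow> ('u \<Rightarrow> complex ^ 'd) \<Rightarrow> complex) \<Rightarrow> bool)"

private lemmas d1 = dsum_module[where 'd = 'd, OF nu_algebraD(1)[OF A1]]
  and d2 = dsum_module[where 'd = 'd, OF nu_algebraD(1)[OF A2]]

lemma eval_character:
  fixes \<phi>1 \<phi>2 :: "'u \<Rightarrow> complex ^ 'd"
  assumes "linear_map A1 \<phi>1" "linear_map A2 \<phi>2"
  shows "character (tensor (Sym dV1) (Sym dV2)) (tensor_fun (sym_fun (transp \<phi>1)) (sym_fun (transp \<phi>2)))"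
  by (rule character_tensor[OF Sym_algebra[OF d1] Sym_algebra[OF d2]
      character_sym_fun[OF d1 transp_lin_fun[OF assms(1)]] character_sym_fun[OF d2 transp_lin_fun[OF assms(2)]]])

lemma tensor_Sym_algebra: "algebra complex_ring (tensor (Sym dV1) (Sym dV2))"
  by (rule tensor_algebra[OF Sym_algebra[OF d1] Sym_algebra[OF d2]])

lemma representable_add:
  assumes "rep G" "rep H"
  shows "rep (\<lambda>\<phi>1 \<phi>2. G \<phi>1 \<phi>2 + H \<phi>1 \<phi>2)"
proof -
  obtain p where p: "p \<in> carrier (tensor (Sym dV1) (Sym dV2))"
    "\<forall>\<phi>1 \<phi>2 :: 'u \<Rightarrow> complex ^ 'd. linear_map A1 \<phi>1 \<longrightarrow> linear_map A2 \<phi>2 \<longrightarrow>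
       G \<phi>1 \<phi>2 = tensor_fun (sym_fun (transp \<phi>1)) (sym_fun (transp \<phi>2)) p"
    using assms(1) unfolding representable_def by (rule bexE)
  obtain q where q: "q \<in> carrier (tensor (Sym dV1) (Sym dV2))"
    "\<forall>\<phi>1 \<phi>2 :: 'u \<Rightarrow> complex ^ 'd. linear_map A1 \<phi>1 \<longrightarrow> linear_map A2 \<phi>2 \<longrightarrow>
       H \<phi>1 \<phi>2 = tensor_fun (sym_fun (transp \<phi>1)) (sym_fun (transp \<phi>2)) q"
    using assms(2) unfolding representable_def by (rule bexE)
  show ?thesis
    unfolding representable_def
  proof (intro bexI allI impI)
    fix \<phi>1 \<phi>2 :: "'u \<Rightarrow> complex ^ 'd" assume l: "linear_map A1 \<phi>1" "linear_map A2 \<phi>2"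
    show "G \<phi>1 \<phi>2 + H \<phi>1 \<phi>2 = tensor_fun (sym_fun (transp \<phi>1)) (sym_fun (transp \<phi>2)) (p \<oplus>\<^bsub>tensor (Sym dV1) (Sym dV2)\<^esub> q)"
      using eval_character[OF l] p q l by (simp add: character_def lin_fun_def)
  qed (rule module_complexD(2)[OF algebra.module[OF tensor_Sym_algebra] p(1) q(1)])
qed

lemma representable_mult:
  assumes "rep G" "rep H"
  shows "rep (\<lambda>\<phi>1 \<phi>2. G \<phi>1 \<phi>2 * H \<phi>1 \<phi>2)"
proof -
  interpret cring "tensor (Sym dV1) (Sym dV2)" by (rule algebra.M_cring[OF tensor_Sym_algebra])
  obtain p where p: "p \<in> carrier (tensor (Sym dV1) (Sym dV2))"
    "\<forall>\<phi>1 \<phi>2 :: 'u \<Rightarrow> complex ^ 'd. linear_map A1 \<phi>1 \<longrightarrow> linear_map A2 \<phi>2 \<longrightarrow>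
       G \<phi>1 \<phi>2 = tensor_fun (sym_fun (transp \<phi>1)) (sym_fun (transp \<phi>2)) p"
    using assms(1) unfolding representable_def by (rule bexE)
  obtain q where q: "q \<in> carrier (tensor (Sym dV1) (Sym dV2))"
    "\<forall>\<phi>1 \<phi>2 :: 'u \<Rightarrow> complex ^ 'd. linear_map A1 \<phi>1 \<longrightarrow> linear_map A2 \<phi>2 \<longrightarrow>
       H \<phi>1 \<phi>2 = tensor_fun (sym_fun (transp \<phi>1)) (sym_fun (transp \<phi>2)) q"
    using assms(2) unfolding representable_def by (rule bexE)
  show ?thesis
    unfolding representable_def
  proof (intro bexI allI impI)
    fix \<phi>1 \<phi>2 :: "'u \<Rightarrow> complex ^ 'd" assume l: "linear_map A1 \<phi>1" "linear_map A2 \<phi>2"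
    show "G \<phi>1 \<phi>2 * H \<phi>1 \<phi>2 = tensor_fun (sym_fun (transp \<phi>1)) (sym_fun (transp \<phi>2)) (p \<otimes>\<^bsub>tensor (Sym dV1) (Sym dV2)\<^esub> q)"
      using eval_character[OF l] p q l by (simp add: character_def lin_fun_def)
  qed (rule m_closed[OF p(1) q(1)])
qed

lemma representable_const: "rep (\<lambda>_ _. c)"
proof -
  interpret cring "tensor (Sym dV1) (Sym dV2)" by (rule algebra.M_cring[OF tensor_Sym_algebra])
  let ?p = "c \<odot>\<^bsub>tensor (Sym dV1) (Sym dV2)\<^esub> \<one>\<^bsub>tensor (Sym dV1) (Sym dV2)\<^esub>"
  show ?thesis
    unfolding representable_def
  proof (intro bexI allI impI)
    fix \<phi>1 \<phi>2 :: "'u \<Rightarrow> complex ^ 'd" assume l: "linear_map A1 \<phi>1" "linear_map A2 \<phi>2"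
    show "c = tensor_fun (sym_fun (transp \<phi>1)) (sym_fun (transp \<phi>2)) ?p"
      using eval_character[OF l] by (simp add: character_def lin_fun_def)
  qed (rule module_complexD(7)[OF algebra.module[OF tensor_Sym_algebra] one_closed])
qed

lemma sym_emb_closed:
  assumes "Module.module complex_ring V" "v \<in> carrier V"
  shows "sym_emb V v \<in> carrier (Sym V)"
  unfolding sym_emb_def Sym_simps(1)[OF assms(1)] using assms(2) by (intro imageI) (simp add: sym_var_def)

text \<open>The coordinate functions: a generator of one symmetric algebra tensored with the unit of
  the other.\<close>

lemma representable_eval:
  assumes "a \<in> carrier A1" "b \<in> carrier A2"
  shows "rep (\<lambda>\<phi>1 \<phi>2. \<phi>1 a $ k)" "rep (\<lambda>\<phi>1 \<phi>2. \<phi>2 b $ k)"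
proof -
  interpret S1: cring "Sym dV1" by (rule algebra.M_cring[OF Sym_algebra[OF d1]])
  interpret S2: cring "Sym dV2" by (rule algebra.M_cring[OF Sym_algebra[OF d2]])
  let ?T = "tensor (Sym dV1) (Sym dV2)"
  let ?c = "tensor_class (Sym dV1) (Sym dV2)"
  have pc: "pure x y \<in> carrier (tpolys (Sym dV1) (Sym dV2))" if "x \<in> carrier (Sym dV1)" "y \<in> carrier (Sym dV2)" for x y
    using that by (auto simp: pure_def DirProd_simps)
  have ev: "tensor_fun (sym_fun (transp \<phi>1)) (sym_fun (transp \<phi>2)) (?c (pure x y)) =
      sym_fun (transp \<phi>1) x * sym_fun (transp \<phi>2) y"
    if xy: "x \<in> carrier (Sym dV1)" "y \<in> carrier (Sym dV2)" and l: "linear_map A1 \<phi>1" "linear_map A2 \<phi>2"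
    for x y and \<phi>1 \<phi>2 :: "'u \<Rightarrow> complex ^ 'd"
    using character_sym_fun[OF d1 transp_lin_fun[OF l(1)]] character_sym_fun[OF d2 transp_lin_fun[OF l(2)]]
    by (subst tensor_fun_class[OF Sym_algebra[OF d1] Sym_algebra[OF d2] _ _ pc[OF xy]])
       (auto simp: character_def pure_def)
  have tc: "?c (pure x y) \<in> carrier ?T" if "x \<in> carrier (Sym dV1)" "y \<in> carrier (Sym dV2)" for x y
    unfolding tensor_simps(1)[OF Sym_algebra[OF d1] Sym_algebra[OF d2]] using pc[OF that] by (rule imageI)
  note e1 = sym_emb_closed[OF d1 dsum_unit_closed[OF nu_algebraD(1)[OF A1] assms(1)]]
    and e2 = sym_emb_closed[OF d2 dsum_unit_closed[OF nu_algebraD(1)[OF A2] assms(2)]]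
  show "rep (\<lambda>\<phi>1 \<phi>2. \<phi>1 a $ k)"
    unfolding representable_def
  proof (intro bexI allI impI)
    fix \<phi>1 \<phi>2 :: "'u \<Rightarrow> complex ^ 'd" assume l: "linear_map A1 \<phi>1" "linear_map A2 \<phi>2"
    show "\<phi>1 a $ k = tensor_fun (sym_fun (transp \<phi>1)) (sym_fun (transp \<phi>2))
        (?c (pure (sym_emb dV1 (dsum_unit A1 k a)) \<one>\<^bsub>Sym dV2\<^esub>))"
      using character_sym_fun[OF d2 transp_lin_fun[OF l(2)]]
      by (simp add: ev[OF e1 S2.one_closed l] sym_fun_emb[OF d1 transp_lin_fun[OF l(1)]
          dsum_unit_closed[OF nu_algebraD(1)[OF A1] assms(1)]] transp_dsum_unit[OF nu_algebraD(1)[OF A1] l(1)] character_def)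
  qed (rule tc[OF e1 S2.one_closed])
  show "rep (\<lambda>\<phi>1 \<phi>2. \<phi>2 b $ k)"
    unfolding representable_def
  proof (intro bexI allI impI)
    fix \<phi>1 \<phi>2 :: "'u \<Rightarrow> complex ^ 'd" assume l: "linear_map A1 \<phi>1" "linear_map A2 \<phi>2"
    show "\<phi>2 b $ k = tensor_fun (sym_fun (transp \<phi>1)) (sym_fun (transp \<phi>2))
        (?c (pure \<one>\<^bsub>Sym dV1\<^esub> (sym_emb dV2 (dsum_unit A2 k b))))"
      using character_sym_fun[OF d1 transp_lin_fun[OF l(1)]]
      by (simp add: ev[OF S1.one_closed e2 l] sym_fun_emb[OF d2 transp_lin_fun[OF l(2)]
          dsum_unit_closed[OF nu_algebraD(1)[OF A2] assms(2)]] transp_dsum_unit[OF nu_algebraD(1)[OF A2] l(2)] character_def)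
  qed (rule tc[OF S1.one_closed e2])
qed

lemma representable_sum:
  assumes "finite I" "\<And>i. i \<in> I \<Longrightarrow> rep (G i)"
  shows "rep (\<lambda>\<phi>1 \<phi>2. \<Sum>i\<in>I. G i \<phi>1 \<phi>2)"
  using assms by (induction I rule: finite_induct) (auto intro: representable_add representable_const)

lemma representable_prod_list:
  assumes "\<And>x. x \<in> set xs \<Longrightarrow> rep (G x)"
  shows "rep (\<lambda>\<phi>1 \<phi>2. prod_list (map (\<lambda>x. G x \<phi>1 \<phi>2) xs))"
  using assms by (induction xs) (auto intro: representable_mult representable_const)

lemma representable_cong:
  assumes "rep G"
    "\<And>\<phi>1 \<phi>2 :: 'u \<Rightarrow> complex ^ 'd. linear_map A1 \<phi>1 \<Longrightarrow> linear_map A2 \<phi>2 \<Longrightarrow> H \<phi>1 \<phi>2 = G \<phi>1 \<phi>2"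
  shows "rep H"
  using assms unfolding representable_def by simp

end

section \<open>Multilinear expansion of words\<close>

primrec labellings :: "('i \<Rightarrow> 'l set) \<Rightarrow> 'i list \<Rightarrow> 'l list set" where
  "labellings W [] = {[]}"
| "labellings W (i # ks) = (\<lambda>(l, ls). l # ls) ` (W i \<times> labellings W ks)"

lemma labellings_iff: "ls \<in> labellings W ks \<longleftrightarrow> list_all2 (\<lambda>i l. l \<in> W i) ks ls"
proof (induction ks arbitrary: ls)
  case (Cons i ks)
  then show ?case by (cases ls) auto
qed auto

lemma finite_labellings: "(\<And>i. finite (W i)) \<Longrightarrow> finite (labellings W ks)"
  by (induction ks) auto

text \<open>Substituting linear combinations for letters. The expansion of \<open>x i\<close> is
  assumed under every linear functional because the induction changes the functional: all factors
  but the current one are absorbed into it.\<close>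

lemma lprod_expand:
  fixes C :: "(complex, 'u, 'z) module_scheme"
  assumes C: "nu_algebra C" and q: "\<And>i l. q i l \<in> carrier C" and x: "\<And>i. x i \<in> carrier C"
    and lin: "\<And>N i. lin_fun C N \<Longrightarrow> N (x i) = (\<Sum>l\<in>W i. c i l * N (q i l))"
    and N: "lin_fun C N" and "ks \<noteq> []"
  shows "N (lprod C (map x ks)) =
    (\<Sum>ls\<in>labellings W ks. prod_list (map2 c ks ls) * N (lprod C (map2 q ks ls)))"
  using \<open>ks \<noteq> []\<close> N
proof (induction ks arbitrary: N)
  case (Cons i js)
  have inj: "inj_on (\<lambda>(l, ls). l # ls) B" for B :: "('b \<times> 'b list) set" by (auto simp: inj_on_def)
  have xc: "lprod C (map x js) \<in> carrier C" for js using x by (intro lprod_closed[OF C]) auto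
  show ?case
  proof (cases "js = []")
    case True
    have "labellings W [i] = (\<lambda>l. [l]) ` W i" by auto
    then have "(\<Sum>ls\<in>labellings W [i]. prod_list (map2 c [i] ls) * N (lprod C (map2 q [i] ls))) =
        (\<Sum>l\<in>W i. c i l * N (q i l))"
      by (simp add: sum.reindex inj_on_def del: labellings.simps)
    then show ?thesis using lin[OF Cons.prems(2), of i] True by (simp del: labellings.simps)
  next
    case False
    have qc: "lprod C (map2 q js ls) \<in> carrier C" for ls using q by (intro lprod_closed[OF C]) auto
    have lr: "lin_fun C (\<lambda>y. N (y \<otimes>\<^bsub>C\<^esub> z))" if "z \<in> carrier C" for z
      using Cons.prems(2) nu_algebraD(2,4,6)[OF C _ that] nu_algebraD(4)[OF C _ _ that] nu_algebraD(2)[OF C _ that]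
      by (simp add: lin_fun_def)
    have ll: "lin_fun C (\<lambda>y. N (z \<otimes>\<^bsub>C\<^esub> y))" if "z \<in> carrier C" for z
      using Cons.prems(2) nu_algebraD(2,7)[OF C that] nu_algebraD(5)[OF C _ _ that]
      by (simp add: lin_fun_def)
    have "N (lprod C (map x (i # js))) = N (x i \<otimes>\<^bsub>C\<^esub> lprod C (map x js))"
      using False by (simp add: lprod_Cons)
    also have "\<dots> = (\<Sum>l\<in>W i. c i l * N (q i l \<otimes>\<^bsub>C\<^esub> lprod C (map x js)))"
      by (rule lin[OF lr[OF xc]])
    also have "\<dots> = (\<Sum>l\<in>W i. \<Sum>ls\<in>labellings W js.
        c i l * (prod_list (map2 c js ls) * N (q i l \<otimes>\<^bsub>C\<^esub> lprod C (map2 q js ls))))"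
      by (simp add: Cons.IH[OF False ll[OF q]] sum_distrib_left)
    also have "\<dots> = (\<Sum>(l, ls)\<in>W i \<times> labellings W js.
        c i l * (prod_list (map2 c js ls) * N (q i l \<otimes>\<^bsub>C\<^esub> lprod C (map2 q js ls))))"
      by (rule sum.cartesian_product)
    also have "\<dots> = (\<Sum>(l, ls)\<in>W i \<times> labellings W js.
        prod_list (map2 c (i # js) (l # ls)) * N (lprod C (map2 q (i # js) (l # ls))))"
    proof (rule sum.cong[OF refl], clarify)
      fix l ls assume "ls \<in> labellings W js"
      then have "length ls = length js" by (auto simp: labellings_iff dest: list_all2_lengthD)
      then have "map2 q js ls \<noteq> []" using False by auto
      then show "c i l * (prod_list (map2 c js ls) * N (q i l \<otimes>\<^bsub>C\<^esub> lprod C (map2 q js ls))) =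
          prod_list (map2 c (i # js) (l # ls)) * N (lprod C (map2 q (i # js) (l # ls)))"
        by (simp add: lprod_Cons)
    qed
    also have "\<dots> = (\<Sum>ls\<in>labellings W (i # js). prod_list (map2 c (i # js) ls) * N (lprod C (map2 q (i # js) ls)))"
      unfolding labellings.simps sum.reindex[OF inj] by (simp add: split_beta)
    finally show ?thesis .
  qed
qed simp

text \<open>An element is determined by its graph, a finite set of pairs of a word and a
  coefficient. A chosen enumeration of the graph is a list, and lists of such pairs embed into
  \<open>'u\<close> with the help of the copy of the complex numbers given by j.\<close>

lemma poly_mapping_injection:
  fixes j :: "complex \<Rightarrow> 'u"
  assumes j: "inj j"
  obtains e :: "('l::countable list \<Rightarrow>\<^sub>0 complex) \<Rightarrow> 'u" where "inj e"
proof -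
  have inf: "infinite (UNIV :: 'u set)"
    using finite_imageD[OF finite_subset[OF subset_UNIV], of j UNIV] j infinite_UNIV_char_0[where 'a = complex]
    by blast
  then obtain l :: "'u list \<Rightarrow> 'u" where l: "inj l" by (rule infinite_list_injection)
  obtain n :: "nat \<Rightarrow> 'u" where n: "inj n" using inf infinite_countable_subset by blast
  define t where "t = (\<lambda>(w :: 'l list, c). l (j c # map (\<lambda>x. n (to_nat x)) w))"
  have "inj (\<lambda>x :: 'l. n (to_nat x))" by (rule injI) (auto dest!: injD[OF n])
  note letters = inj_mapI[OF this]
  have t: "inj t"
  proof (rule injI)
    fix x y assume eq: "t x = t y"
    obtain w c w' c' where xy: "x = (w, c)" "y = (w', c')" by (metis surj_pair)
    have "j c # map (\<lambda>x. n (to_nat x)) w = j c' # map (\<lambda>x. n (to_nat x)) w'"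
      using eq unfolding t_def xy by (auto dest!: injD[OF l])
    then show "x = y" unfolding xy using injD[OF j] injD[OF letters] by simp
  qed
  define gr where "gr p = (\<lambda>w. (w, Poly_Mapping.lookup p w)) ` Poly_Mapping.keys p" for p :: "'l list \<Rightarrow>\<^sub>0 complex"
  define enum where "enum p = (SOME xs. set xs = gr p)" for p
  have enum: "set (enum p) = gr p" for p
    unfolding enum_def by (rule someI_ex[of "\<lambda>xs. set xs = gr p"]) (simp add: gr_def finite_list)
  have gr: "p = q" if "gr p = gr q" for p q
  proof (rule poly_mapping_eqI)
    fix w
    have k: "Poly_Mapping.keys p = fst ` gr p" for p by (simp add: gr_def image_image)
    have kk: "Poly_Mapping.keys p = Poly_Mapping.keys q" unfolding k that ..
    show "Poly_Mapping.lookup p w = Poly_Mapping.lookup q w"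
    proof (cases "w \<in> Poly_Mapping.keys p")
      case True
      then have "(w, Poly_Mapping.lookup p w) \<in> gr p" by (simp add: gr_def)
      then have "(w, Poly_Mapping.lookup p w) \<in> gr q" by (simp only: that)
      then show ?thesis by (auto simp: gr_def)
    next
      case False
      then show ?thesis using kk by (auto simp: in_keys_iff)
    qed
  qed
  have "inj (\<lambda>p. l (map t (enum p)))"
  proof (rule injI)
    fix p q assume "l (map t (enum p)) = l (map t (enum q))"
    then have "map t (enum p) = map t (enum q)" by (rule injD[OF l])
    then have "enum p = enum q" by (rule injD[OF inj_mapI[OF t]])
    then have "gr p = gr q" using enum[of p] enum[of q] by simp
    then show "p = q" by (rule gr)
  qed
  then show ?thesis by (rule that)
qed

lemma universal_product_natural:
  assumes "universal_product P" "faced_algebra A1" "faced_algebra A2" "faced_algebra B1" "faced_algebra B2"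
    "linear_map A1 \<phi>1" "linear_map A2 \<phi>2" "faced_hom B1 A1 j1" "faced_hom B2 A2 j2"
    "\<And>b. b \<in> carrier B1 \<Longrightarrow> \<psi>1 b = \<phi>1 (j1 b)" "\<And>b. b \<in> carrier B2 \<Longrightarrow> \<psi>2 b = \<phi>2 (j2 b)"
    "x \<in> carrier (B1 \<squnion>\<^sub>f B2)"
  shows "P B1 \<psi>1 B2 \<psi>2 x = P A1 \<phi>1 A2 \<phi>2 (fp_map B1 B2 A1 A2 j1 j2 x)"
  by (rule assms(1)[unfolded universal_product_def, THEN conjunct2, THEN conjunct1, rule_format])
     (use assms in simp_all)

lemma universal_product_linear:
  assumes "universal_product P" "faced_algebra A1" "faced_algebra A2" "linear_map A1 \<phi>1" "linear_map A2 \<phi>2"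
  shows "linear_map (A1 \<squnion>\<^sub>f A2) (P A1 \<phi>1 A2 \<phi>2)"
  by (rule assms(1)[unfolded universal_product_def, THEN conjunct1, rule_format]) (use assms in simp)

section \<open>Labels for the generic substitution\<close>

type_synonym 'd label = "nat list \<times> bool \<times> 'd"

text \<open>Only repetition-free words over n letters serve as first components, which keeps the
  substituted sums finite. A letter of index n or above has no label and is thus replaced by
  zero.\<close>

definition label_set :: "nat \<Rightarrow> nat \<Rightarrow> 'd label set" where
  "label_set n i = (if i < n then {w. distinct w \<and> set w \<subseteq> {..<n}} \<times> UNIV else {})"

text \<open>The value of the functional is attached to the first letter of w alone, so that it
  enters the product over a repetition-free word exactly once.\<close>

definition label_coeff :: "(bool \<Rightarrow> nat list \<Rightarrow> complex ^ 'd) \<Rightarrow> nat \<Rightarrow> 'd label \<Rightarrow> complex" where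
  "label_coeff \<psi> i = (\<lambda>(w, \<delta>, k). if w \<noteq> [] \<and> hd w = i then \<psi> \<delta> w $ k else 1)"

text \<open>
  A labelling of a word with repeated letters in which two occurrences of the same letter carry
  different labels.
\<close>

definition mark :: "nat list \<Rightarrow> 'd label list" where
  "mark w = (replicate (length w) ([], False, undefined))
     [(SOME p. p < length w \<and> (\<exists>q<length w. q \<noteq> p \<and> w ! q = w ! p)) := ([], True, undefined)]"

text \<open>On a word without repetitions all letters must carry the label naming this word, the
  side and the component; the value then comes from the coefficients. On any other word the value is
  put in directly, at the marked labelling.\<close>

definition marked_fun ::
  "(bool \<Rightarrow> nat list \<Rightarrow> complex ^ 'd) \<Rightarrow> bool \<Rightarrow> (nat \<times> 'd label) list \<Rightarrow> complex ^ 'd" where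
  "marked_fun \<psi> \<delta> z = (\<chi> k. if distinct (map fst z)
     then if map snd z = replicate (length z) (map fst z, \<delta>, k) then 1 else 0
     else if map snd z = mark (map fst z) then \<psi> \<delta> (map fst z) $ k else 0)"

lemma finite_label_set: "finite (label_set n i :: 'd::finite label set)"
proof -
  have "{w. distinct w \<and> set w \<subseteq> {..<n}} = {w. set w \<subseteq> {..<n} \<and> distinct w}" by auto
  then show ?thesis by (simp add: label_set_def finite_subset_distinct)
qed

lemma mark_inconsistent:
  fixes f :: "nat \<Rightarrow> 'd label"
  assumes "\<not> distinct w"
  shows "mark w \<noteq> map f w"
proof
  assume eq: "mark w = map f w"
  define p where "p = (SOME p. p < length w \<and> (\<exists>q<length w. q \<noteq> p \<and> w ! q = w ! p))"
  have "\<exists>p. p < length w \<and> (\<exists>q<length w. q \<noteq> p \<and> w ! q = w ! p)"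
    using assms unfolding distinct_conv_nth by metis
  then have "p < length w \<and> (\<exists>q<length w. q \<noteq> p \<and> w ! q = w ! p)"
    unfolding p_def by (rule someI_ex)
  then obtain q where pq: "p < length w" "q < length w" "q \<noteq> p" "w ! q = w ! p" by blast
  have "(mark w :: 'd label list) ! p = ([], True, undefined)" "(mark w :: 'd label list) ! q = ([], False, undefined)"
    using pq by (auto simp: mark_def p_def[symmetric])
  moreover have "(mark w :: 'd label list) ! p = (mark w :: 'd label list) ! q" unfolding eq using pq by simp
  ultimately show False by simp
qed

text \<open>If the label depends on the letter alone, the marked labelling cannot occur, and \<psi>
  drops out. This is what makes the coefficients of the polynomial constants.\<close>

lemma marked_fun_consistent:
  "marked_fun \<psi> \<delta> (map (\<lambda>i. (i, f i)) w) =
     (\<chi> k. if distinct w \<and> map f w = replicate (length w) (w, \<delta>, k) then 1 else 0)"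
  using mark_inconsistent[of w f] by (auto simp: marked_fun_def comp_def vec_eq_iff)

text \<open>Substitution recovers \<psi>, because a single labelling contributes. For a
  repetition-free w it is the uniform one, with functional value 1 and coefficient product \<psi>;
  for other w it is the marked one, with coefficient product 1 and functional value \<psi>.\<close>

lemma marked_sum:
  fixes \<psi> :: "bool \<Rightarrow> nat list \<Rightarrow> complex ^ 'd::finite"
  assumes w: "w \<noteq> []" and out: "\<not> set w \<subseteq> {..<n} \<Longrightarrow> \<psi> \<delta> w = 0"
  shows "(\<Sum>ls\<in>labellings (label_set n) w. prod_list (map2 (label_coeff \<psi>) w ls) * marked_fun \<psi> \<delta> (zip w ls) $ k) =
    \<psi> \<delta> w $ k"
proof (cases "set w \<subseteq> {..<n}")
  case False
  then obtain i where "i \<in> set w" "\<not> i < n" by auto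
  have "ls \<notin> labellings (label_set n :: nat \<Rightarrow> 'd label set) w" for ls
  proof
    assume "ls \<in> labellings (label_set n :: nat \<Rightarrow> 'd label set) w"
    moreover obtain p where "p < length w" "w ! p = i" using \<open>i \<in> set w\<close> by (auto simp: in_set_conv_nth)
    ultimately have "ls ! p \<in> label_set n i" using list_all2_nthD by (fastforce simp: labellings_iff)
    then show False using \<open>\<not> i < n\<close> by (simp add: label_set_def)
  qed
  then have "labellings (label_set n :: nat \<Rightarrow> 'd label set) w = {}" by blast
  then show ?thesis using out[OF False] by simp
next
  case True
  define ls0 where "ls0 = (if distinct w then replicate (length w) (w, \<delta>, k) else mark w)"
  have len: "length ls0 = length w" by (simp add: ls0_def mark_def)
  have "ls0 \<in> labellings (label_set n) w"
  proof (cases "distinct w")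
    case d: True
    then show ?thesis using True
      by (auto simp: labellings_iff list_all2_conv_all_nth ls0_def label_set_def dest: nth_mem)
  next
    case False
    have m: "(mark w :: 'd label list) ! p \<in> {[]} \<times> UNIV" if "p < length w" for p
    proof -
      have "set (mark w :: 'd label list) \<subseteq> insert ([], True, undefined) (set (replicate (length w) ([], False, undefined)))"
        unfolding mark_def by (rule set_update_subset_insert)
      moreover have "(mark w :: 'd label list) ! p \<in> set (mark w)"
        using that by (intro nth_mem) (simp add: mark_def)
      ultimately have "(mark w :: 'd label list) ! p \<in> insert ([], True, undefined) (set (replicate (length w) ([], False, undefined)))"
        by blast
      then show ?thesis by (auto split: if_splits)
    qed
    have "ls0 ! p \<in> label_set n (w ! p)" if "p < length w" for p
    proof -
      have "w ! p < n" using True nth_mem[OF that] by auto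
      then show ?thesis using m[OF that] False by (auto simp: ls0_def label_set_def)
    qed
    then show ?thesis using len by (simp add: labellings_iff list_all2_conv_all_nth)
  qed
  moreover have zero: "marked_fun \<psi> \<delta> (zip w ls) $ k = 0"
    if "ls \<in> labellings (label_set n) w" "ls \<noteq> ls0" for ls
  proof -
    have "length ls = length w" using that(1) by (auto simp: labellings_iff dest: list_all2_lengthD)
    then show ?thesis using that(2) by (auto simp: marked_fun_def ls0_def)
  qed
  ultimately have "(\<Sum>ls\<in>labellings (label_set n) w. prod_list (map2 (label_coeff \<psi>) w ls) * marked_fun \<psi> \<delta> (zip w ls) $ k) =
      prod_list (map2 (label_coeff \<psi>) w ls0) * marked_fun \<psi> \<delta> (zip w ls0) $ k"
    by (subst sum.remove[OF finite_labellings[OF finite_label_set]]) (auto intro!: sum.neutral)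
  also have "\<dots> = \<psi> \<delta> w $ k"
  proof (cases "distinct w")
    case d: True
    obtain a v where av: "w = a # v" using w by (cases w) auto
    have c: "label_coeff \<psi> i (w, \<delta>, k) = (if i = a then \<psi> \<delta> w $ k else 1)" for i
      by (simp add: label_coeff_def av)
    have z: "zip w (replicate (length w) x) = map (\<lambda>i. (i, x)) w" for w :: "nat list" and x :: "'d label"
      by (induction w) auto
    have "prod_list (map (\<lambda>i. if i = a then b else 1) v) = 1" for b :: complex
      using d av by (induction v arbitrary: w) auto
    then have "prod_list (map2 (label_coeff \<psi>) w ls0) = \<psi> \<delta> w $ k"
      using d by (simp add: ls0_def z comp_def c) (simp add: av)
    then show ?thesis using d len by (simp add: marked_fun_def ls0_def)
  next
    case False
    have "fst x = []" if "x \<in> set (mark w :: 'd label list)" for x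
      using that set_update_subset_insert[of "replicate (length w) ([], False, undefined) :: 'd label list"]
      by (force simp: mark_def)
    then have "label_coeff \<psi> i x = 1" if "x \<in> set (mark w)" for i x
      using that by (fastforce simp: label_coeff_def split: prod.split)
    moreover have "prod_list (map2 (label_coeff \<psi>) w ls) = 1"
      if "\<And>i x. x \<in> set ls \<Longrightarrow> label_coeff \<psi> i x = 1" for w ls
      using that by (induction w ls rule: list_induct2') auto
    ultimately have "prod_list (map2 (label_coeff \<psi>) w ls0) = 1" using False by (simp add: ls0_def)
    then show ?thesis using False len by (simp add: marked_fun_def ls0_def)
  qed
  finally show ?thesis .
qed

lemma lin_fun_hom: "lin_fun C N \<Longrightarrow> alg_hom A C h \<Longrightarrow> lin_fun A (\<lambda>x. N (h x))"
  by (simp add: lin_fun_def alg_hom_def)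

context free_faced
begin

lemma lin_fun_letters:
  assumes N: "lin_fun F N" and "finite B"
  shows "N (e (\<Sum>l\<in>B. Poly_Mapping.single [l] (c l))) = (\<Sum>l\<in>B. c l * N (letter l))"
  using \<open>finite B\<close>
proof (induction B rule: finite_induct)
  case empty
  have "e 0 = 0 \<odot>\<^bsub>F\<^esub> e 0" using F_ops(3)[of 0 0 0] by simp
  moreover have "e 0 \<in> carrier F" by (auto simp: F_carrier)
  ultimately have "N (e 0) = 0 * N (e 0)" using N unfolding lin_fun_def by metis
  then show ?case by simp
next
  case (insert l B)
  have k: "Poly_Mapping.keys (\<Sum>l\<in>B. Poly_Mapping.single [l] (c l)) \<subseteq> {w. w \<noteq> []}"
    by (rule order_trans[OF keys_sum]) auto
  have 1: "Poly_Mapping.keys (Poly_Mapping.single [l] (1 :: complex)) \<subseteq> {w. w \<noteq> []}"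
    "Poly_Mapping.keys (Poly_Mapping.single [l] (c l)) \<subseteq> {w. w \<noteq> []}" by auto
  have "e (\<Sum>l\<in>insert l B. Poly_Mapping.single [l] (c l)) =
      c l \<odot>\<^bsub>F\<^esub> letter l \<oplus>\<^bsub>F\<^esub> e (\<Sum>l\<in>B. Poly_Mapping.single [l] (c l))"
    using insert F_ops(1)[OF 1(2) k] F_ops(3)[OF 1(1) 1(1), of "c l"]
    by (simp add: letter_def scale_single)
  moreover have "e (\<Sum>l\<in>B. Poly_Mapping.single [l] (c l)) \<in> carrier F" using k by (auto simp: F_carrier)
  ultimately show ?case
    using N insert letter_closed[of l] module_complexD(7)[OF nu_algebraD(1)[OF F_nu_algebra] letter_closed[of l]]
    by (simp add: lin_fun_def)
qed

end

text \<open>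
  Pulling back to a free algebra and substituting \<open>X\<^sub>i \<mapsto> \<Sum>\<^sub>l c\<^sub>i\<^sub>l Z\<^sub>i\<^sub>l\<close>, the value of the product on a
  word \<open>X\<^sub>0 \<cdots> X\<^sub>n\<^sub>-\<^sub>1\<close> becomes a polynomial in the \<open>c\<^sub>i\<^sub>l\<close>. The labels \<open>l = (w, \<delta>, k)\<close> and the functional
  \<^const>\<open>marked_fun\<close> are such that the substitution produces the given functionals, whereas the
  coefficients of the polynomial, in which all occurrences of a letter have the same label, do not
  depend on them.
\<close>

lemma universal_word_representable:
  fixes P :: "('u, 'm::finite, 'd::finite) functional_product"
    and e :: "((nat \<times> 'd label) list \<Rightarrow>\<^sub>0 complex) \<Rightarrow> 'u"
  assumes P: "universal_product P" and A1: "faced_algebra A1" and A2: "faced_algebra A2"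
    and e: "inj e" and n: "0 < n" and u: "\<And>i. i < n \<Longrightarrow> u i \<in> face (if \<epsilon> i then A1 else A2) (\<kappa>0 i)"
  shows "representable A1 A2 (\<lambda>\<phi>1 \<phi>2. P A1 \<phi>1 A2 \<phi>2
    (lprod (A1 \<squnion>\<^sub>f A2) (map (\<lambda>i. if \<epsilon> i then inl A1 A2 (u i) else inr A1 A2 (u i)) [0..<n])) $ k0)"
proof -
  \<comment> \<open>The colour of a letter ignores its label, so both relabelling and substitution
    respect the faces.\<close>
  interpret Fr: free_faced e "\<lambda>l. \<kappa>0 (fst l)" by unfold_locales (rule e)
  let ?F = "Fr.F" and ?C = "A1 \<squnion>\<^sub>f A2"
  let ?FF = "?F \<squnion>\<^sub>f ?F"
  note nA1 = faced_algebraD(1)[OF A1] and nA2 = faced_algebraD(1)[OF A2] and nF = Fr.F_nu_algebra and F = Fr.F_faced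
  note nFF = free_product_nu_algebra[OF nF nF] and nC = free_product_nu_algebra[OF nA1 nA2]
  define A where "A \<delta> = (if \<delta> then A1 else A2)" for \<delta>
  have A: "faced_algebra (A \<delta>)" for \<delta> using A1 A2 by (simp add: A_def)
  note nA = faced_algebraD(1)[OF A]
  \<comment> \<open>One free algebra serves both factors: a letter is sent to \<open>u i\<close> on
    its own side and to zero on the other.\<close>
  define v where "v \<delta> i = (if i < n \<and> \<epsilon> i = \<delta> then u i else \<zero>\<^bsub>A \<delta>\<^esub>)" for \<delta> i
  have v: "v \<delta> i \<in> face (A \<delta>) (\<kappa>0 i)" for \<delta> i
    using u[of i] faced_algebraD(2)[OF A, of \<delta> "\<kappa>0 i"] by (auto simp: v_def A_def subalg_def)
  have vc: "v \<delta> i \<in> carrier (A \<delta>)" for \<delta> i using v faced_algebraD(3)[OF A] by blast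
  define a where "a \<delta> w = lprod (A \<delta>) (map (v \<delta>) w)" for \<delta> w
  have ac: "a \<delta> w \<in> carrier (A \<delta>)" for \<delta> w unfolding a_def using vc by (intro lprod_closed[OF nA]) auto
  define j where "j \<delta> = Fr.free_hom (A \<delta>) (\<lambda>l. v \<delta> (fst l))" for \<delta>
  have jf: "faced_hom ?F (A \<delta>) (j \<delta>)" for \<delta> unfolding j_def by (rule Fr.free_hom_faced[OF A v])
  have jl: "j \<delta> (Fr.letter l) = v \<delta> (fst l)" for \<delta> l unfolding j_def by (rule Fr.free_hom(2)[OF nA vc])
  have jh: "alg_hom ?F (A \<delta>) (j \<delta>)" for \<delta> using jf by (simp add: faced_hom_def)
  define em where "em \<delta> = (if \<delta> then inl ?F ?F else inr ?F ?F)" for \<delta>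
  have em: "alg_hom ?F ?FF (em \<delta>)" for \<delta> using inl_hom[OF nF nF] inr_hom[OF nF nF] by (simp add: em_def)
  \<comment> \<open>The label is an arbitrary default: the homomorphisms \<open>j\<close> and
    \<open>s\<close> below look only at the index of a letter.\<close>
  define X where "X i = Fr.letter (i, ([], False, undefined) :: 'd label)" for i
  define x0 where "x0 = lprod ?FF (map (\<lambda>i. em (\<epsilon> i) (X i)) [0..<n])"
  have emc: "em \<delta> y \<in> carrier ?FF" if "y \<in> carrier ?F" for \<delta> y using alg_homD(1)[OF em that] .
  have x0: "x0 \<in> carrier ?FF"
    unfolding x0_def using emc Fr.letter_closed by (intro lprod_closed[OF nFF]) (auto simp: X_def)
  have fp: "fp_map ?F ?F B1 B2 g1 g2 x0 =
      lprod (B1 \<squnion>\<^sub>f B2) (map (\<lambda>i. if \<epsilon> i then inl B1 B2 (g1 (X i)) else inr B1 B2 (g2 (X i))) [0..<n])"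
    if B: "faced_algebra B1" "faced_algebra B2" and g: "alg_hom ?F B1 g1" "alg_hom ?F B2 g2" for B1 B2 g1 g2
  proof -
    note nB = faced_algebraD(1)[OF B(1)] faced_algebraD(1)[OF B(2)]
    note h = fp_map_hom[OF nB nF nF g]
    have "fp_map ?F ?F B1 B2 g1 g2 (em (\<epsilon> i) (X i)) =
        (if \<epsilon> i then inl B1 B2 (g1 (X i)) else inr B1 B2 (g2 (X i)))" for i
      using h(2,3) Fr.letter_closed by (simp add: em_def X_def)
    moreover have "set (map (\<lambda>i. em (\<epsilon> i) (X i)) [0..<n]) \<subseteq> carrier ?FF"
      using emc Fr.letter_closed by (auto simp: X_def)
    ultimately show ?thesis
      unfolding x0_def using alg_hom_lprod[OF nFF free_product_nu_algebra[OF nB] h(1)]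
      by (simp add: comp_def)
  qed
  \<comment> \<open>The marked functional pulled back along the relabelling \<open>ls\<close>,
    written out so that the given functionals visibly do not occur in it. The default label covers
    indices beyond the list.\<close>
  define const where "const ls \<delta> = Fr.lin_words (\<lambda>z. \<chi> k. if distinct (map fst z) \<and>
      map (\<lambda>i. if i < n then ls ! i else ([], False, undefined)) (map fst z) =
        replicate (length z) (map fst z, \<delta>, k :: 'd) then 1 else 0)" for ls :: "'d label list" and \<delta>
  define G where "G ls = P ?F (const ls True) ?F (const ls False) x0 $ k0" for ls
  let ?W = "label_set n :: nat \<Rightarrow> 'd label set"
  have formula: "P A1 \<phi>1 A2 \<phi>2 (lprod ?C (map (\<lambda>i. if \<epsilon> i then inl A1 A2 (u i) else inr A1 A2 (u i)) [0..<n])) $ k0 =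
      (\<Sum>ls\<in>labellings ?W [0..<n]. prod_list (map2
        (label_coeff (\<lambda>\<delta> w. if \<delta> then \<phi>1 (a True w) else \<phi>2 (a False w))) [0..<n] ls) * G ls)"
    if \<phi>1: "linear_map A1 \<phi>1" and \<phi>2: "linear_map A2 \<phi>2" for \<phi>1 \<phi>2
  proof -
    define \<phi> where "\<phi> \<delta> = (if \<delta> then \<phi>1 else \<phi>2)" for \<delta>
    have \<phi>: "linear_map (A \<delta>) (\<phi> \<delta>)" for \<delta> using \<phi>1 \<phi>2 by (simp add: \<phi>_def A_def)
    \<comment> \<open>The moments of the given functionals along all words, including those with
      repeated letters.\<close>
    define \<psi> where "\<psi> \<delta> w = \<phi> \<delta> (a \<delta> w)" for \<delta> w
    define c where "c = label_coeff \<psi>"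
    define S where "S i = e (\<Sum>l\<in>Pair i ` ?W i. Poly_Mapping.single [l] (c i (snd l)))" for i
    have S_lin: "N (S i) = (\<Sum>l\<in>?W i. c i l * N (Fr.letter (i, l)))" if "lin_fun ?F N" for N i
      unfolding S_def using Fr.lin_fun_letters[OF that finite_imageI[OF finite_label_set, of "Pair i" n i], of "\<lambda>l. c i (snd l)"]
      by (simp add: sum.reindex inj_on_def)
    have S_face: "S i \<in> face ?F (\<kappa>0 i)" for i
      unfolding S_def Fr.F_face
      by (intro imageI CollectI order_trans[OF keys_sum]) (auto simp: Fr.face_words_def)
    have Sc: "S i \<in> carrier ?F" for i using S_face faced_algebraD(3)[OF F] by blast
    define s where "s = Fr.free_hom ?F (\<lambda>l. S (fst l))"
    have sf: "faced_hom ?F ?F s" unfolding s_def by (rule Fr.free_hom_faced[OF F S_face])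
    have sh: "alg_hom ?F ?F s" using sf by (simp add: faced_hom_def)
    have sl: "s (Fr.letter l) = S (fst l)" for l unfolding s_def by (rule Fr.free_hom(2)[OF nF Sc])
    define \<Phi> where "\<Phi> \<delta> = Fr.lin_words (marked_fun \<psi> \<delta>)" for \<delta>
    have \<Phi>: "linear_map ?F (\<Phi> \<delta>)" for \<delta> unfolding \<Phi>_def by (rule Fr.lin_words_linear)
    \<comment> \<open>Matches the empty label sets of the indices from n on.\<close>
    have out: "\<psi> \<delta> w = 0" if w: "\<not> set w \<subseteq> {..<n}" for \<delta> w
    proof -
      obtain i where i: "i \<in> set w" "\<not> i < n" using w by auto
      have vi: "v \<delta> i = \<zero>\<^bsub>A \<delta>\<^esub>" using i(2) by (simp add: v_def)
      have "lprod (A \<delta>) (map (v \<delta>) w) = \<zero>\<^bsub>A \<delta>\<^esub>"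
        using i(1)
      proof (induction w)
        case (Cons i' w)
        have l: "lprod (A \<delta>) (map (v \<delta>) w) \<in> carrier (A \<delta>)" for w
          using vc by (intro lprod_closed[OF nA]) auto
        show ?case
        proof (cases "w = []")
          case True
          then show ?thesis using Cons.prems i(2) by (simp add: v_def)
        next
          case False
          have "v \<delta> i' = \<zero>\<^bsub>A \<delta>\<^esub> \<or> lprod (A \<delta>) (map (v \<delta>) w) = \<zero>\<^bsub>A \<delta>\<^esub>"
            using Cons vi by auto
          then show ?thesis using False nu_algebra_zero_mult[OF nA] vc l by (auto simp: lprod_Cons)
        qed
      qed simp
      then show ?thesis
        using linear_map_zero[OF nu_algebraD(1)[OF nA] \<phi>] by (simp add: \<psi>_def a_def)
    qed
    \<comment> \<open>Naturality needs this equality on the entire free algebra, not just on the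
      repetition-free words; here the marked values are required.\<close>
    have word: "\<Phi> \<delta> (s b) $ k = \<phi> \<delta> (j \<delta> b) $ k" if "b \<in> carrier ?F" for \<delta> b k
    proof (rule Fr.F_lin_eq[OF lin_fun_hom[OF linear_map_component[OF \<Phi>] sh]
          lin_fun_hom[OF linear_map_component[OF \<phi>] jh] that])
      fix z :: "(nat \<times> 'd label) list" assume z: "z \<noteq> []"
      define w where "w = map fst z"
      have w: "w \<noteq> []" using z by (simp add: w_def)
      have lc: "set (map Fr.letter z) \<subseteq> carrier ?F" using Fr.letter_closed by auto
      have "s (lprod ?F (map Fr.letter z)) = lprod ?F (map S w)"
        using alg_hom_lprod[OF nF nF sh lc] by (simp add: sl comp_def w_def)
      then have "\<Phi> \<delta> (s (lprod ?F (map Fr.letter z))) $ k =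
          (\<Sum>ls\<in>labellings ?W w. prod_list (map2 c w ls) *
             \<Phi> \<delta> (lprod ?F (map2 (\<lambda>i l. Fr.letter (i, l)) w ls)) $ k)"
        using lprod_expand[OF nF, where q = "\<lambda>i l. Fr.letter (i, l)" and x = S and W = ?W and c = c
            and N = "\<lambda>x. \<Phi> \<delta> x $ k" and ks = w]
          Fr.letter_closed Sc S_lin linear_map_component[OF \<Phi>] w by simp
      also have "\<dots> = (\<Sum>ls\<in>labellings ?W w. prod_list (map2 c w ls) * marked_fun \<psi> \<delta> (zip w ls) $ k)"
      proof (rule sum.cong[OF refl])
        fix ls assume "ls \<in> labellings ?W w"
        then have "length ls = length w" by (auto simp: labellings_iff dest: list_all2_lengthD)
        then have ne: "zip w ls \<noteq> []" using w by auto
        have "map2 (\<lambda>i l. Fr.letter (i, l)) w ls = map Fr.letter (zip w ls)" by auto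
        then show "prod_list (map2 c w ls) * \<Phi> \<delta> (lprod ?F (map2 (\<lambda>i l. Fr.letter (i, l)) w ls)) $ k =
            prod_list (map2 c w ls) * marked_fun \<psi> \<delta> (zip w ls) $ k"
          by (simp only: \<Phi>_def Fr.lin_words_word[OF ne])
      qed
      also have "\<dots> = \<psi> \<delta> w $ k" unfolding c_def by (rule marked_sum[OF w out])
      also have "\<psi> \<delta> w = \<phi> \<delta> (j \<delta> (lprod ?F (map Fr.letter z)))"
        using alg_hom_lprod[OF nF nA jh lc] by (simp add: \<psi>_def a_def jl w_def comp_def)
      finally show "\<Phi> \<delta> (s (lprod ?F (map Fr.letter z))) $ k = \<phi> \<delta> (j \<delta> (lprod ?F (map Fr.letter z))) $ k" .
    qed
    have const: "const ls \<delta> b = \<Phi> \<delta> (Fr.free_hom ?F (\<lambda>l. Fr.letter (fst l, if fst l < n then ls ! fst l else ([], False, undefined))) b)"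
      (is "_ = \<Phi> \<delta> (?\<iota> ls b)") if b: "b \<in> carrier ?F" for ls \<delta> b
    proof -
      note \<iota> = Fr.free_hom[OF nF, of "\<lambda>l. Fr.letter (fst l, if fst l < n then ls ! fst l else ([], False, undefined))",
          OF Fr.letter_closed]
      have "const ls \<delta> b $ k = \<Phi> \<delta> (?\<iota> ls b) $ k" for k
      proof (rule Fr.F_lin_eq[OF _ lin_fun_hom[OF linear_map_component[OF \<Phi>] \<iota>(1)] b])
        show "lin_fun ?F (\<lambda>b. const ls \<delta> b $ k)"
          unfolding const_def by (rule linear_map_component[OF Fr.lin_words_linear])
        fix z :: "(nat \<times> 'd label) list" assume z: "z \<noteq> []"
        let ?f = "\<lambda>i. if i < n then ls ! i else ([], False, undefined)"
        have lc: "set (map Fr.letter z) \<subseteq> carrier ?F" using Fr.letter_closed by auto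
        have "?\<iota> ls (lprod ?F (map Fr.letter z)) = lprod ?F (map Fr.letter (map (\<lambda>i. (i, ?f i)) (map fst z)))"
          using alg_hom_lprod[OF nF nF \<iota>(1) lc] by (simp add: \<iota>(2) comp_def)
        then have "\<Phi> \<delta> (?\<iota> ls (lprod ?F (map Fr.letter z))) = marked_fun \<psi> \<delta> (map (\<lambda>i. (i, ?f i)) (map fst z))"
          using z by (simp only: \<Phi>_def Fr.lin_words_word map_is_Nil_conv not_False_eq_True)
        then show "const ls \<delta> (lprod ?F (map Fr.letter z)) $ k = \<Phi> \<delta> (?\<iota> ls (lprod ?F (map Fr.letter z))) $ k"
          unfolding marked_fun_consistent const_def Fr.lin_words_word[OF z] by simp
      qed
      then show ?thesis by (simp add: vec_eq_iff)
    qed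
    have "P A1 \<phi>1 A2 \<phi>2 (lprod ?C (map (\<lambda>i. if \<epsilon> i then inl A1 A2 (u i) else inr A1 A2 (u i)) [0..<n])) =
        P A1 \<phi>1 A2 \<phi>2 (fp_map ?F ?F A1 A2 (j True) (j False) x0)"
    proof -
      have hom: "alg_hom ?F A1 (j True)" "alg_hom ?F A2 (j False)" using jh[of True] jh[of False] by (simp_all add: A_def)
      have "map (\<lambda>i. if \<epsilon> i then inl A1 A2 (u i) else inr A1 A2 (u i)) [0..<n] =
          map (\<lambda>i. if \<epsilon> i then inl A1 A2 (j True (X i)) else inr A1 A2 (j False (X i))) [0..<n]"
        by (auto simp: X_def jl v_def)
      then show ?thesis unfolding fp[OF A1 A2 hom] by (simp only:)
    qed
    also have "\<dots> = P ?F (\<lambda>b. \<phi>1 (j True b)) ?F (\<lambda>b. \<phi>2 (j False b)) x0"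
      using universal_product_natural[OF P A1 A2 F F \<phi>1 \<phi>2 _ _ _ _ x0, of "j True" "j False"]
        jf[of True] jf[of False] by (simp add: A_def)
    also have "\<dots> = P ?F (\<Phi> True) ?F (\<Phi> False) (fp_map ?F ?F ?F ?F s s x0)"
    proof (rule universal_product_natural[OF P F F F F \<Phi> \<Phi> sf sf _ _ x0])
      show "\<phi>1 (j True b) = \<Phi> True (s b)" "\<phi>2 (j False b) = \<Phi> False (s b)" if "b \<in> carrier ?F" for b
        using word[OF that, of True] word[OF that, of False] by (simp_all add: vec_eq_iff \<phi>_def)
    qed
    also have "fp_map ?F ?F ?F ?F s s x0 = lprod ?FF (map (\<lambda>i. em (\<epsilon> i) (S i)) [0..<n])"
      unfolding fp[OF F F sh sh] by (rule arg_cong[where f = "lprod ?FF"]) (auto simp: X_def sl em_def)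
    \<comment> \<open>Expansion of the substituted word; the coefficients carry the values of the
      given functionals, and the remaining factors involve labelled letters only.\<close>
    also have "P ?F (\<Phi> True) ?F (\<Phi> False) \<dots> $ k0 =
        (\<Sum>ls\<in>labellings ?W [0..<n]. prod_list (map2 c [0..<n] ls) *
           P ?F (\<Phi> True) ?F (\<Phi> False) (lprod ?FF (map2 (\<lambda>i l. em (\<epsilon> i) (Fr.letter (i, l))) [0..<n] ls)) $ k0)"
    proof (rule lprod_expand[OF nFF])
      show "lin_fun ?FF (\<lambda>x. P ?F (\<Phi> True) ?F (\<Phi> False) x $ k0)"
        by (rule linear_map_component[OF universal_product_linear[OF P F F \<Phi> \<Phi>]])
      show "N (em (\<epsilon> i) (S i)) = (\<Sum>l\<in>?W i. c i l * N (em (\<epsilon> i) (Fr.letter (i, l))))" if "lin_fun ?FF N" for N i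
        by (rule S_lin[OF lin_fun_hom[OF that em]])
    qed (use emc Fr.letter_closed Sc n in auto)
    also have "\<dots> = (\<Sum>ls\<in>labellings ?W [0..<n]. prod_list (map2 c [0..<n] ls) * G ls)"
    proof (rule sum.cong[OF refl])
      fix ls assume "ls \<in> labellings ?W [0..<n]"
      then have len: "length ls = n" by (auto simp: labellings_iff dest: list_all2_lengthD)
      let ?g = "\<lambda>l. Fr.letter (fst l, if fst l < n then ls ! fst l else ([], False, undefined))"
      let ?\<iota> = "Fr.free_hom ?F ?g"
      note \<iota> = Fr.free_hom[OF nF, of ?g, OF Fr.letter_closed]
      have g: "?g l \<in> face ?F (\<kappa>0 (fst l))" for l
        using Fr.letter_face[of "(fst l, if fst l < n then ls ! fst l else ([], False, undefined))"] by simp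
      have \<iota>f: "faced_hom ?F ?F ?\<iota>" by (rule Fr.free_hom_faced[OF F g])
      \<comment> \<open>Every index occurs once in \<open>[0..<n]\<close>, so a labelled word is the
        image of \<open>x0\<close> under a relabelling, and naturality can be applied
        backwards.\<close>
      have "lprod ?FF (map2 (\<lambda>i l. em (\<epsilon> i) (Fr.letter (i, l))) [0..<n] ls) = fp_map ?F ?F ?F ?F ?\<iota> ?\<iota> x0"
        unfolding fp[OF F F \<iota>(1) \<iota>(1)]
        by (rule arg_cong[where f = "lprod ?FF"], rule nth_equalityI) (auto simp: len X_def \<iota>(2) em_def)
      also have "P ?F (\<Phi> True) ?F (\<Phi> False) \<dots> = P ?F (const ls True) ?F (const ls False) x0"
        by (rule universal_product_natural[OF P F F F F \<Phi> \<Phi> \<iota>f \<iota>f const const x0, symmetric])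
      finally show "prod_list (map2 c [0..<n] ls) *
          P ?F (\<Phi> True) ?F (\<Phi> False) (lprod ?FF (map2 (\<lambda>i l. em (\<epsilon> i) (Fr.letter (i, l))) [0..<n] ls)) $ k0 =
          prod_list (map2 c [0..<n] ls) * G ls" by (simp add: G_def)
    qed
    also have "\<psi> = (\<lambda>\<delta> w. if \<delta> then \<phi>1 (a True w) else \<phi>2 (a False w))"
      by (auto simp: \<psi>_def \<phi>_def fun_eq_iff)
    then have "c = label_coeff (\<lambda>\<delta> w. if \<delta> then \<phi>1 (a True w) else \<phi>2 (a False w))"
      by (simp add: c_def)
    finally show ?thesis .
  qed
  \<comment> \<open>Each coefficient is either 1 or a coordinate of a functional at a fixed element,
    and \<open>G\<close> is constant.\<close>
  have "representable A1 A2 (\<lambda>\<phi>1 \<phi>2. label_coeff (\<lambda>\<delta> w. if \<delta> then \<phi>1 (a True w) else \<phi>2 (a False w)) i l)"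
    for i and l :: "'d label"
  proof -
    obtain w \<delta> k where l: "l = (w, \<delta>, k)" by (cases l)
    have ac': "a True w \<in> carrier A1" "a False w \<in> carrier A2" using ac[of True w] ac[of False w] by (simp_all add: A_def)
    show ?thesis
      using representable_eval[OF nA1 nA2 ac', of k] representable_const[OF nA1 nA2, of 1]
      by (cases \<delta>; cases "w \<noteq> [] \<and> hd w = i") (auto simp: l label_coeff_def)
  qed
  then have "representable A1 A2 (\<lambda>\<phi>1 \<phi>2. \<Sum>ls\<in>labellings ?W [0..<n].
      prod_list (map (\<lambda>(i, l). label_coeff (\<lambda>\<delta> w. if \<delta> then \<phi>1 (a True w) else \<phi>2 (a False w)) i l) (zip [0..<n] ls)) * G ls)"
    by (intro representable_sum[OF nA1 nA2] finite_labellings finite_label_set representable_mult[OF nA1 nA2]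
        representable_prod_list[OF nA1 nA2] representable_const[OF nA1 nA2])
       (simp add: split_beta)
  then show ?thesis by (rule representable_cong[OF nA1 nA2]) (rule formula)
qed

text \<open>The free product is spanned by words whose letters come from faces of the two factors,
  and representable functions are closed under linear combinations.\<close>

lemma universal_product_representable:
  fixes P :: "('u, 'm::finite, 'd::finite) functional_product"
  assumes P: "universal_product P" and A1: "faced_algebra A1" and A2: "faced_algebra A2"
    and x: "x \<in> carrier (A1 \<squnion>\<^sub>f A2)"
  shows "representable A1 A2 (\<lambda>\<phi>1 \<phi>2. P A1 \<phi>1 A2 \<phi>2 x $ k)"
proof -
  let ?C = "A1 \<squnion>\<^sub>f A2"
  note nA1 = faced_algebraD(1)[OF A1] and nA2 = faced_algebraD(1)[OF A2]
  note nC = free_product_nu_algebra[OF nA1 nA2] and C = free_product_faced[OF A1 A2]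
  note cm = module_complexD[OF nu_algebraD(1)[OF nC]]
  note lin = universal_product_linear[OF P A1 A2]
  note l = inl_hom[OF nA1 nA2] and r = inr_hom[OF nA1 nA2]
  have zero: "P A1 \<phi>1 A2 \<phi>2 \<zero>\<^bsub>?C\<^esub> $ k = 0" if "linear_map A1 \<phi>1" "linear_map A2 \<phi>2" for \<phi>1 \<phi>2
    using linear_map_zero[OF nu_algebraD(1)[OF nC] lin[OF that]] by simp
  define S where "S = (\<Union>k. inl A1 A2 ` face A1 k \<union> inr A1 A2 ` face A2 k)"
  have S: "S \<subseteq> carrier ?C"
    using faced_algebraD(3)[OF A1] faced_algebraD(3)[OF A2] alg_homD(1)[OF l] alg_homD(1)[OF r]
    unfolding S_def by blast
  have "face ?C k \<subseteq> subalg_gen ?C S" for k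
    unfolding free_product_face[OF nA1 nA2]
    using subalg_gen_superset[of S ?C] by (intro subalg_gen_minimal[OF subalg_gen_subalg[OF nC S]]) (auto simp: S_def)
  then have "carrier ?C \<subseteq> subalg_gen ?C S"
    using subalg_gen_minimal[OF subalg_gen_subalg[OF nC S]] unfolding faced_generated[OF C] by blast
  then have xS: "x \<in> subalg_gen ?C S" using x by blast
  show ?thesis
  \<comment> \<open>If both algebras are zero, the universe may have no room for a free algebra, but
    then x is zero. Otherwise a nonzero element supplies the copy of the complex numbers from which
    the embedding of the free algebra is built.\<close>
  proof (cases "carrier A1 \<subseteq> {\<zero>\<^bsub>A1\<^esub>} \<and> carrier A2 \<subseteq> {\<zero>\<^bsub>A2\<^esub>}")
    case True
    have "S \<subseteq> {\<zero>\<^bsub>?C\<^esub>}"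
      using True faced_algebraD(3)[OF A1] faced_algebraD(3)[OF A2] alg_hom_zero[OF nA1 nC l] alg_hom_zero[OF nA2 nC r]
      unfolding S_def by fastforce
    moreover have "subalg {\<zero>\<^bsub>?C\<^esub>} ?C"
      using cm(1,5,13) by (simp add: subalg_def nu_algebra_zero_mult[OF nC])
    ultimately have x0: "x = \<zero>\<^bsub>?C\<^esub>" using subalg_gen_minimal xS by blast
    show ?thesis
      unfolding x0 by (rule representable_cong[OF nA1 nA2 representable_const[OF nA1 nA2, of 0]]) (rule zero)
  next
    case False
    then obtain j :: "complex \<Rightarrow> 'u" where "inj j"
      using nu_algebra_scalar_inj[OF nA1] nu_algebra_scalar_inj[OF nA2] by blast
    then obtain e :: "((nat \<times> 'd label) list \<Rightarrow>\<^sub>0 complex) \<Rightarrow> 'u" where e: "inj e"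
      by (rule poly_mapping_injection)
    have word: "representable A1 A2 (\<lambda>\<phi>1 \<phi>2. P A1 \<phi>1 A2 \<phi>2 (lprod ?C w) $ k)" if w: "w \<noteq> []" "set w \<subseteq> S" for w
    proof -
      have "\<forall>i. \<exists>b k y. i < length w \<longrightarrow>
          y \<in> face (if b then A1 else A2) k \<and> w ! i = (if b then inl A1 A2 y else inr A1 A2 y)"
      proof (intro allI)
        fix i
        show "\<exists>b k y. i < length w \<longrightarrow>
          y \<in> face (if b then A1 else A2) k \<and> w ! i = (if b then inl A1 A2 y else inr A1 A2 y)"
        proof (cases "i < length w")
          case True
          then have "w ! i \<in> S" using w(2) by auto
          then obtain k y where "(y \<in> face A1 k \<and> w ! i = inl A1 A2 y) \<or> (y \<in> face A2 k \<and> w ! i = inr A1 A2 y)"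
            by (auto simp: S_def)
          then show ?thesis by (metis (full_types))
        qed simp
      qed
      then obtain \<epsilon> \<kappa> u where u: "\<And>i. i < length w \<Longrightarrow>
          u i \<in> face (if \<epsilon> i then A1 else A2) (\<kappa> i) \<and> w ! i = (if \<epsilon> i then inl A1 A2 (u i) else inr A1 A2 (u i))"
        by metis
      have "w = map (\<lambda>i. if \<epsilon> i then inl A1 A2 (u i) else inr A1 A2 (u i)) [0..<length w]"
        by (rule nth_equalityI) (simp_all add: u)
      moreover have "0 < length w" using w(1) by simp
      ultimately show ?thesis
        using universal_word_representable[OF P A1 A2 e, of "length w" u \<epsilon> \<kappa> k] u by metis
    qed
    obtain ts where ts: "\<forall>(c, w)\<in>set ts. w \<noteq> [] \<and> set w \<subseteq> S" "x = lcomb ?C ts"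
      by (rule subalg_gen_lcomb[OF nC S xS])
    have "representable A1 A2 (\<lambda>\<phi>1 \<phi>2. P A1 \<phi>1 A2 \<phi>2 (lcomb ?C ts) $ k) \<and> lcomb ?C ts \<in> carrier ?C"
      using ts(1)
    proof (induction ts)
      case Nil
      show ?case
        unfolding lcomb.simps using cm(1)
        by (intro conjI representable_cong[OF nA1 nA2 representable_const[OF nA1 nA2, of 0]] zero)
    next
      case (Cons t ts)
      obtain c w where t: "t = (c, w)" by (cases t)
      have w: "w \<noteq> []" "set w \<subseteq> S" using Cons.prems by (auto simp: t)
      have wc: "lprod ?C w \<in> carrier ?C" using w S by (intro lprod_closed[OF nC]) auto
      have IH: "representable A1 A2 (\<lambda>\<phi>1 \<phi>2. P A1 \<phi>1 A2 \<phi>2 (lcomb ?C ts) $ k)" "lcomb ?C ts \<in> carrier ?C"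
        using Cons by auto
      have "representable A1 A2 (\<lambda>\<phi>1 \<phi>2. c * P A1 \<phi>1 A2 \<phi>2 (lprod ?C w) $ k + P A1 \<phi>1 A2 \<phi>2 (lcomb ?C ts) $ k)"
        by (intro representable_add[OF nA1 nA2] representable_mult[OF nA1 nA2] representable_const[OF nA1 nA2]
            word w IH)
      then have "representable A1 A2 (\<lambda>\<phi>1 \<phi>2. P A1 \<phi>1 A2 \<phi>2 (lcomb ?C (t # ts)) $ k)"
      proof (rule representable_cong[OF nA1 nA2])
        fix \<phi>1 \<phi>2 :: "'u \<Rightarrow> complex ^ 'd" assume "linear_map A1 \<phi>1" "linear_map A2 \<phi>2"
        then show "P A1 \<phi>1 A2 \<phi>2 (lcomb ?C (t # ts)) $ k =
            c * P A1 \<phi>1 A2 \<phi>2 (lprod ?C w) $ k + P A1 \<phi>1 A2 \<phi>2 (lcomb ?C ts) $ k"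
          using linear_map_component[OF lin, of \<phi>1 \<phi>2 k] wc IH(2) cm(7)[OF wc] by (simp add: t lin_fun_def)
      qed
      moreover have "lcomb ?C (t # ts) \<in> carrier ?C" using cm(2,7) wc IH(2) by (simp add: t)
      ultimately show ?case by blast
    qed
    then show ?thesis using ts(2) by simp
  qed
qed

lemma character_comp:
  assumes "unital_alg_hom S T h" "character T g"
  shows "character S (\<lambda>x. g (h x))"
  using assms by (simp add: unital_alg_hom_def alg_hom_def character_def lin_fun_def)

text \<open>Representing elements are chosen linearly on the generators and extended
  multiplicatively. Both sides of the required formula are then characters of the symmetric algebra
  with equal values on generators.\<close>

lemma sigma_exists:
  fixes P :: "('u, 'm::finite, 'd::finite) functional_product"
  assumes P: "universal_product P" and A1: "faced_algebra A1" and A2: "faced_algebra A2"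
  shows "is_sigma P A1 A2 (sigma P A1 A2)"
proof -
  note nA1 = faced_algebraD(1)[OF A1] and nA2 = faced_algebraD(1)[OF A2]
  note nC = free_product_nu_algebra[OF nA1 nA2]
  let ?V = "dsum (A1 \<squnion>\<^sub>f A2) :: (complex, 'u ^ 'd) module"
  let ?W = "tensor (Sym (dsum A1 :: (complex, 'u ^ 'd) module)) (Sym (dsum A2 :: (complex, 'u ^ 'd) module))"
  have V: "Module.module complex_ring ?V" by (rule dsum_module[OF nu_algebraD(1)[OF nC]])
  have W: "algebra complex_ring ?W" by (rule tensor_Sym_algebra[OF nA1 nA2])
  note lin = universal_product_linear[OF P A1 A2]
  define R where "R v p \<longleftrightarrow> (\<forall>\<phi>1 \<phi>2. linear_map A1 \<phi>1 \<longrightarrow> linear_map A2 \<phi>2 \<longrightarrow>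
      transp (P A1 \<phi>1 A2 \<phi>2) v = tensor_fun (sym_fun (transp \<phi>1)) (sym_fun (transp \<phi>2)) p)" for v p
  obtain s where s: "\<And>v. v \<in> carrier ?V \<Longrightarrow> s v \<in> carrier ?W \<and> R v (s v)"
    "\<And>v v'. v \<in> carrier ?V \<Longrightarrow> v' \<in> carrier ?V \<Longrightarrow> s (v \<oplus>\<^bsub>?V\<^esub> v') = s v \<oplus>\<^bsub>?W\<^esub> s v'"
    "\<And>c v. v \<in> carrier ?V \<Longrightarrow> s (c \<odot>\<^bsub>?V\<^esub> v) = c \<odot>\<^bsub>?W\<^esub> s v"
  proof (rule linear_selection[OF V algebra.module[OF W], of R])
    fix v assume v: "v \<in> carrier ?V"
    have "representable A1 A2 (\<lambda>\<phi>1 \<phi>2. \<Sum>k\<in>UNIV. P A1 \<phi>1 A2 \<phi>2 (v $ k) $ k)"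
      using v by (intro representable_sum[OF nA1 nA2] universal_product_representable[OF P A1 A2]) auto
    then show "\<exists>p\<in>carrier ?W. R v p" unfolding representable_def R_def transp_def .
  next
    fix v p v' p'
    assume "R v p" "R v' p'" "v \<in> carrier ?V" "p \<in> carrier ?W" "v' \<in> carrier ?V" "p' \<in> carrier ?W"
    then show "R (v \<oplus>\<^bsub>?V\<^esub> v') (p \<oplus>\<^bsub>?W\<^esub> p')"
      using transp_lin_fun[OF lin] eval_character[OF nA1 nA2] unfolding R_def character_def lin_fun_def by metis
  next
    fix c v p assume "R v p" "v \<in> carrier ?V" "p \<in> carrier ?W"
    then show "R (c \<odot>\<^bsub>?V\<^esub> v) (c \<odot>\<^bsub>?W\<^esub> p)"
      using transp_lin_fun[OF lin] eval_character[OF nA1 nA2] unfolding R_def character_def lin_fun_def by metis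
  qed blast
  have sc: "\<And>v. v \<in> carrier ?V \<Longrightarrow> s v \<in> carrier ?W" using s(1) by blast
  obtain h where h: "unital_alg_hom (Sym ?V) ?W h" "\<And>v. v \<in> carrier ?V \<Longrightarrow> h (sym_emb ?V v) = s v"
    by (rule Sym_extension[OF V W sc s(2,3)]) blast+
  have "is_sigma P A1 A2 h"
    unfolding is_sigma_def
  proof (intro conjI allI impI ballI h(1))
    fix \<phi>1 \<phi>2 :: "'u \<Rightarrow> complex ^ 'd" and x
    assume \<phi>: "linear_map A1 \<phi>1 \<and> linear_map A2 \<phi>2" and x: "x \<in> carrier (Sym ?V)"
    show "sym_fun (transp (P A1 \<phi>1 A2 \<phi>2)) x = tensor_fun (sym_fun (transp \<phi>1)) (sym_fun (transp \<phi>2)) (h x)"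
    proof (rule character_Sym_eq[OF V _ _ _ x, symmetric])
      show "character (Sym ?V) (\<lambda>x. tensor_fun (sym_fun (transp \<phi>1)) (sym_fun (transp \<phi>2)) (h x))"
        using character_comp[OF h(1) eval_character[OF nA1 nA2]] \<phi> by blast
      show "lin_fun ?V (transp (P A1 \<phi>1 A2 \<phi>2))" using transp_lin_fun[OF lin] \<phi> by blast
      show "tensor_fun (sym_fun (transp \<phi>1)) (sym_fun (transp \<phi>2)) (h (sym_emb ?V v)) = transp (P A1 \<phi>1 A2 \<phi>2) v"
        if "v \<in> carrier ?V" for v
        using s(1)[OF that] h(2)[OF that] \<phi> by (simp add: R_def)
    qed
  qed
  then show ?thesis unfolding sigma_def by (rule someI[where P = "is_sigma P A1 A2"])
qed

section \<open>Convolution powers\<close>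

locale convolution =
  fixes P :: "('u, 'm::finite, 'd::finite) functional_product"
    and B :: "('u, 'm) faced" and \<Lambda> :: "'u \<Rightarrow> 'u"
  assumes P: "universal_product P" and dual: "dual_semigroup B \<Lambda>"
begin

lemma B: "faced_algebra B" and \<Lambda>: "faced_hom B (B \<squnion>\<^sub>f B) \<Lambda>"
  using dual by (simp_all add: dual_semigroup_def)

lemmas nB = faced_algebraD(1)[OF B] and BB = free_product_faced[OF B B]
lemmas nBB = faced_algebraD(1)[OF BB]

lemma \<Lambda>_hom: "alg_hom B (B \<squnion>\<^sub>f B) \<Lambda>"
  using \<Lambda> by (simp add: faced_hom_def)

abbreviation V :: "(complex, 'u ^ 'd) module" where "V \<equiv> dsum B"

lemma V: "Module.module complex_ring V"
  by (rule dsum_module[OF nu_algebraD(1)[OF nB]])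

lemmas SV = Sym_algebra[OF V]

definition star :: "('u \<Rightarrow> complex ^ 'd) \<Rightarrow> ('u \<Rightarrow> complex ^ 'd) \<Rightarrow> 'u \<Rightarrow> complex ^ 'd" where
  "star \<phi> \<eta> b = P B \<phi> B \<eta> (\<Lambda> b)"

lemma faced_hom_id: "faced_hom A A (\<lambda>x. x)"
  by (simp add: faced_hom_def alg_hom_id)

lemma linear_map_hom: "linear_map C \<phi> \<Longrightarrow> alg_hom A C h \<Longrightarrow> linear_map A (\<lambda>x. \<phi> (h x))"
  by (simp add: linear_map_def alg_hom_def)

lemma star_linear: "linear_map B \<phi> \<Longrightarrow> linear_map B \<eta> \<Longrightarrow> linear_map B (star \<phi> \<eta>)"
  unfolding star_def[abs_def]
  by (rule linear_map_hom[OF universal_product_linear[OF P B B] \<Lambda>_hom])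

text \<open>Naturality pulls \<Lambda> out of either leg; then associativity of the product of
  functionals meets coassociativity of \<Lambda>.\<close>

lemma star_assoc:
  assumes "linear_map B \<phi>" "linear_map B \<eta>" "linear_map B \<omega>" and b: "b \<in> carrier B"
  shows "star (star \<phi> \<eta>) \<omega> b = star \<phi> (star \<eta> \<omega>) b"
proof -
  have \<Lambda>b: "\<Lambda> b \<in> carrier (B \<squnion>\<^sub>f B)" using alg_homD(1)[OF \<Lambda>_hom b] .
  note l1 = universal_product_linear[OF P B B assms(1,2)] and l2 = universal_product_linear[OF P B B assms(2,3)]
  have "star (star \<phi> \<eta>) \<omega> b = P (B \<squnion>\<^sub>f B) (P B \<phi> B \<eta>) B \<omega> (fp_map B B (B \<squnion>\<^sub>f B) B \<Lambda> (\<lambda>x. x) (\<Lambda> b))"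
    unfolding star_def[of "star \<phi> \<eta>"]
    by (rule universal_product_natural[OF P BB B B B l1 assms(3) \<Lambda> faced_hom_id _ _ \<Lambda>b])
       (simp_all add: star_def)
  also have "\<dots> = P B \<phi> (B \<squnion>\<^sub>f B) (P B \<eta> B \<omega>) (fp_assoc B B B (fp_map B B (B \<squnion>\<^sub>f B) B \<Lambda> (\<lambda>x. x) (\<Lambda> b)))"
  proof (rule P[unfolded universal_product_def, THEN conjunct2, THEN conjunct2, THEN conjunct1, rule_format])
    show "fp_map B B (B \<squnion>\<^sub>f B) B \<Lambda> (\<lambda>x. x) (\<Lambda> b) \<in> carrier ((B \<squnion>\<^sub>f B) \<squnion>\<^sub>f B)"
      using alg_homD(1)[OF fp_map_hom(1)[OF nBB nB nB nB \<Lambda>_hom alg_hom_id] \<Lambda>b] .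
  qed (use B assms in auto)
  also have "fp_assoc B B B (fp_map B B (B \<squnion>\<^sub>f B) B \<Lambda> (\<lambda>x. x) (\<Lambda> b)) = fp_map B B B (B \<squnion>\<^sub>f B) (\<lambda>x. x) \<Lambda> (\<Lambda> b)"
    using dual b by (simp add: dual_semigroup_def)
  also have "P B \<phi> (B \<squnion>\<^sub>f B) (P B \<eta> B \<omega>) \<dots> = star \<phi> (star \<eta> \<omega>) b"
    unfolding star_def[of \<phi>]
    by (rule universal_product_natural[OF P B BB B B assms(1) l2 faced_hom_id \<Lambda> _ _ \<Lambda>b, symmetric])
       (simp_all add: star_def)
  finally show ?thesis .
qed

lemma linear_map_0: "linear_map A (\<lambda>_. 0)"
  by (simp add: linear_map_def)

lemma zero_hom_faced: "faced_hom B zero_alg zero_hom"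
  by (auto simp: faced_hom_def alg_hom_def zero_hom_def)

text \<open>The functional 0 on B factors through the zero algebra, so naturality reduces the claim
  to the counit property of \<Lambda> and the unit axiom of the product.\<close>

lemma star_zero:
  assumes \<phi>: "linear_map B \<phi>" and b: "b \<in> carrier B"
  shows "star \<phi> (\<lambda>_. 0) b = \<phi> b" "star (\<lambda>_. 0) \<phi> b = \<phi> b"
proof -
  have \<Lambda>b: "\<Lambda> b \<in> carrier (B \<squnion>\<^sub>f B)" using alg_homD(1)[OF \<Lambda>_hom b] .
  have un: "P B \<phi> zero_alg (\<lambda>_. 0) (inl B zero_alg b) = \<phi> b" "P zero_alg (\<lambda>_. 0) B \<phi> (inr zero_alg B b) = \<phi> b"
    using P B \<phi> b unfolding universal_product_def by blast+
  have "star \<phi> (\<lambda>_. 0) b = P B \<phi> zero_alg (\<lambda>_. 0) (fp_map B B B zero_alg (\<lambda>x. x) zero_hom (\<Lambda> b))"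
    unfolding star_def
    by (rule universal_product_natural[OF P B zero_alg_faced B B \<phi> linear_map_0 faced_hom_id zero_hom_faced _ _ \<Lambda>b])
       simp_all
  then show "star \<phi> (\<lambda>_. 0) b = \<phi> b" using dual b un(1) by (simp add: dual_semigroup_def)
  have "star (\<lambda>_. 0) \<phi> b = P zero_alg (\<lambda>_. 0) B \<phi> (fp_map B B zero_alg B zero_hom (\<lambda>x. x) (\<Lambda> b))"
    unfolding star_def
    by (rule universal_product_natural[OF P zero_alg_faced B B B linear_map_0 \<phi> zero_hom_faced faced_hom_id _ _ \<Lambda>b])
       simp_all
  then show "star (\<lambda>_. 0) \<phi> b = \<phi> b" using dual b un(2) by (simp add: dual_semigroup_def)
qed

definition ev :: "('u \<Rightarrow> complex ^ 'd) \<Rightarrow> ('u ^ 'd) sym \<Rightarrow> complex" where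
  "ev \<phi> = sym_fun (transp \<phi>)"

lemma ev_lin: "linear_map B \<phi> \<Longrightarrow> lin_fun (Sym V) (ev \<phi>)"
  using character_sym_fun[OF V transp_lin_fun] by (simp add: ev_def character_def)

lemma ev_cong:
  assumes "linear_map B \<phi>" "linear_map B \<eta>" "\<And>b. b \<in> carrier B \<Longrightarrow> \<phi> b = \<eta> b" "x \<in> carrier (Sym V)"
  shows "ev \<phi> x = ev \<eta> x"
  unfolding ev_def
proof (rule character_Sym_eq[OF V character_sym_fun[OF V transp_lin_fun[OF assms(1)]] transp_lin_fun[OF assms(2)] _ assms(4)])
  fix v assume v: "v \<in> carrier V"
  show "sym_fun (transp \<phi>) (sym_emb V v) = transp \<eta> v"
    using v assms(3) by (simp add: sym_fun_emb[OF V transp_lin_fun[OF assms(1)] v] transp_def)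
qed

text \<open>The second part is the link between the coproduct on the symmetric algebra and the
  product \<open>star\<close> of functionals: convolving characters means multiplying the
  functionals.\<close>

lemma comult_hom: "alg_hom (Sym V) (tensor (Sym V) (Sym V)) (comult P B \<Lambda>)"
  and comult_ev: "linear_map B \<phi> \<Longrightarrow> linear_map B \<eta> \<Longrightarrow> x \<in> carrier (Sym V) \<Longrightarrow>
    tensor_fun (ev \<phi>) (ev \<eta>) (comult P B \<Lambda> x) = ev (star \<phi> \<eta>) x"
proof -
  let ?W = "dsum (B \<squnion>\<^sub>f B) :: (complex, 'u ^ 'd) module"
  let ?T = "\<lambda>b :: 'u ^ 'd. \<chi> k. \<Lambda> (b $ k)"
  have W: "Module.module complex_ring ?W" by (rule dsum_module[OF nu_algebraD(1)[OF nBB]])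
  have T: "?T ` carrier V \<subseteq> carrier ?W" using alg_homD(1)[OF \<Lambda>_hom] by auto
  have Ta: "?T (x \<oplus>\<^bsub>V\<^esub> y) = ?T x \<oplus>\<^bsub>?W\<^esub> ?T y" if "x \<in> carrier V" "y \<in> carrier V" for x y
    using that alg_homD(2)[OF \<Lambda>_hom] by (simp add: vec_eq_iff)
  have Ts: "?T (c \<odot>\<^bsub>V\<^esub> x) = c \<odot>\<^bsub>?W\<^esub> ?T x" if "x \<in> carrier V" for c x
    using that alg_homD(4)[OF \<Lambda>_hom] by (simp add: vec_eq_iff)
  have cl: "sym_map ?W ?T (sym_class V p) = sym_class ?W (push ?T p)" if "p \<in> carrier (polys V)" for p
    by (rule sym_map_class[OF V W T _ _ that]; (rule Ta Ts; assumption))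
  have pw: "push ?T p \<in> carrier (polys ?W)" if "p \<in> carrier (polys V)" for p by (rule push_carrier[OF T that])
  have hom: "alg_hom (Sym V) (Sym ?W) (sym_map ?W ?T)"
    unfolding alg_hom_def Sym_simps[OF V] Sym_simps[OF W]
  proof (intro conjI ballI allI)
    fix x assume "x \<in> sym_class V ` carrier (polys V)"
    then obtain p where p: "p \<in> carrier (polys V)" "x = sym_class V p" by auto
    show "sym_map ?W ?T x \<in> sym_class ?W ` carrier (polys ?W)" unfolding p(2) cl[OF p(1)] using pw[OF p(1)] by (rule imageI)
    fix c
    have "Poly_Mapping.map ((*) c) p \<in> carrier (polys V)" using p(1) keys_scale_subset[of c p] by auto
    then show "sym_map ?W ?T (c \<odot>\<^bsub>Sym V\<^esub> x) = c \<odot>\<^bsub>Sym ?W\<^esub> sym_map ?W ?T x"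
      unfolding p(2) cl[OF p(1)] Sym_ops(3)[OF V p(1) p(1)] Sym_ops(3)[OF W pw[OF p(1)] pw[OF p(1)]]
      by (subst cl) (simp_all only: push_scale)
  next
    fix x y assume "x \<in> sym_class V ` carrier (polys V)" "y \<in> sym_class V ` carrier (polys V)"
    then obtain p q where p: "p \<in> carrier (polys V)" "x = sym_class V p" and q: "q \<in> carrier (polys V)" "y = sym_class V q" by auto
    show "sym_map ?W ?T (x \<oplus>\<^bsub>Sym V\<^esub> y) = sym_map ?W ?T x \<oplus>\<^bsub>Sym ?W\<^esub> sym_map ?W ?T y"
      unfolding p(2) q(2) cl[OF p(1)] cl[OF q(1)] Sym_ops(1)[OF V p(1) q(1)] Sym_ops(1)[OF W pw[OF p(1)] pw[OF q(1)]]
        cl[OF polys_add_closed[OF V p(1) q(1)]] push_add ..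
    show "sym_map ?W ?T (x \<otimes>\<^bsub>Sym V\<^esub> y) = sym_map ?W ?T x \<otimes>\<^bsub>Sym ?W\<^esub> sym_map ?W ?T y"
      unfolding p(2) q(2) cl[OF p(1)] cl[OF q(1)] Sym_ops(2)[OF V p(1) q(1)] Sym_ops(2)[OF W pw[OF p(1)] pw[OF q(1)]]
        cl[OF polys_mult_closed[OF V p(1) q(1)]] push_mult[where W = ?W] ..
  qed
  note sig = sigma_exists[OF P B B, unfolded is_sigma_def unital_alg_hom_def]
  show "alg_hom (Sym V) (tensor (Sym V) (Sym V)) (comult P B \<Lambda>)"
    unfolding comult_def[abs_def] using alg_hom_comp[OF hom] sig by blast
  show "tensor_fun (ev \<phi>) (ev \<eta>) (comult P B \<Lambda> x) = ev (star \<phi> \<eta>) x"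
    if l: "linear_map B \<phi>" "linear_map B \<eta>" and x: "x \<in> carrier (Sym V)"
  proof -
    obtain p where p: "p \<in> carrier (polys V)" "x = sym_class V p" using x by (auto simp: Sym_simps[OF V])
    have "tensor_fun (ev \<phi>) (ev \<eta>) (comult P B \<Lambda> x) = sym_fun (transp (P B \<phi> B \<eta>)) (sym_map ?W ?T x)"
      unfolding comult_def ev_def using sig l alg_homD(1)[OF hom x] by simp
    also have "\<dots> = lin_ext (\<lambda>M. \<Prod>v\<in>#M. transp (P B \<phi> B \<eta>) v) (push ?T p)"
      unfolding p(2) cl[OF p(1)]
      by (rule sym_fun_class[OF W transp_lin_fun[OF universal_product_linear[OF P B B l]] pw[OF p(1)]])
    also have "\<dots> = lin_ext (\<lambda>M. \<Prod>v\<in>#M. transp (star \<phi> \<eta>) v) p"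
      by (simp add: lin_ext_push transp_def star_def)
    also have "\<dots> = ev (star \<phi> \<eta>) x"
      unfolding ev_def p(2) by (rule sym_fun_class[OF V transp_lin_fun[OF star_linear[OF l]] p(1), symmetric])
    finally show ?thesis .
  qed
qed

lemma comult_class:
  assumes "x \<in> carrier (Sym V)"
  obtains q where "q \<in> carrier (tpolys (Sym V) (Sym V))" "comult P B \<Lambda> x = tensor_class (Sym V) (Sym V) q"
  using alg_homD(1)[OF comult_hom assms] unfolding tensor_simps(1)[OF SV SV] by blast

lemma convolve_lin:
  assumes "lin_fun (Sym V) f" "lin_fun (Sym V) g"
  shows "lin_fun (Sym V) (convolve P B \<Lambda> f g)"
  unfolding convolve_def[abs_def] by (rule lin_fun_hom[OF tensor_fun_lin[OF SV SV assms] comult_hom])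

lemma conv_power_lin:
  assumes "lin_fun (Sym V) f"
  shows "lin_fun (Sym V) (conv_power P B \<Lambda> f n)"
proof (induction n)
  case 0
  have "lin_fun V (\<lambda>_. 0)" by (simp add: lin_fun_def)
  then show ?case using character_sym_fun[OF V] by (simp add: character_def)
qed (simp add: convolve_lin assms)

lemma conv_power_scale:
  assumes f: "lin_fun (Sym V) f" and g: "lin_fun (Sym V) g"
    and eq: "\<And>x. x \<in> carrier (Sym V) \<Longrightarrow> g x = t * f x" and x: "x \<in> carrier (Sym V)"
  shows "conv_power P B \<Lambda> g n x = t ^ n * conv_power P B \<Lambda> f n x"
  using x
proof (induction n arbitrary: x)
  case (Suc n)
  obtain q where q: "q \<in> carrier (tpolys (Sym V) (Sym V))" "comult P B \<Lambda> x = tensor_class (Sym V) (Sym V) q"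
    using Suc.prems by (rule comult_class)
  have k: "Poly_Mapping.keys q \<subseteq> carrier (Sym V) \<times> carrier (Sym V)" using q(1) by (auto simp: DirProd_simps)
  have "conv_power P B \<Lambda> g (Suc n) x = lin_ext (\<lambda>(x, y). conv_power P B \<Lambda> g n x * g y) q"
    by (simp add: convolve_def q(2) tensor_fun_class[OF SV SV conv_power_lin[OF g] g q(1)])
  also have "\<dots> = lin_ext (\<lambda>xy. t ^ Suc n * (case xy of (x, y) \<Rightarrow> conv_power P B \<Lambda> f n x * f y)) q"
    by (rule lin_ext_cong) (use k Suc.IH eq in fastforce)
  also have "\<dots> = t ^ Suc n * lin_ext (\<lambda>(x, y). conv_power P B \<Lambda> f n x * f y) q"
    by (rule lin_ext_fun_scale)
  also have "lin_ext (\<lambda>(x, y). conv_power P B \<Lambda> f n x * f y) q = conv_power P B \<Lambda> f (Suc n) x"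
    by (simp add: convolve_def q(2) tensor_fun_class[OF SV SV conv_power_lin[OF f] f q(1)])
  finally show ?case .
qed simp

end

section \<open>Linear dependence, recurrences and exponential series\<close>

lemma finite_linear_dependence:
  fixes a :: "'j \<Rightarrow> 'i \<Rightarrow> complex"
  assumes "finite I" "finite J" "card I < card J"
  shows "\<exists>b. (\<exists>j\<in>J. b j \<noteq> 0) \<and> (\<forall>i\<in>I. (\<Sum>j\<in>J. b j * a j i) = 0)"
  using assms
proof (induction I arbitrary: J a rule: finite_induct)
  case empty
  then obtain j where "j \<in> J" by (metis card.empty ex_in_conv less_irrefl)
  then show ?case by (intro exI[of _ "\<lambda>_. 1"]) auto
next
  case (insert i I)
  show ?case
  proof (cases "\<forall>j\<in>J. a j i = 0")
    case True
    have "card I < card J" using insert by simp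
    from insert.IH[OF insert.prems(1) this, of a] obtain b where
      b: "\<exists>j\<in>J. b j \<noteq> 0" "\<forall>i\<in>I. (\<Sum>j\<in>J. b j * a j i) = 0" by blast
    have "(\<Sum>j\<in>J. b j * a j i) = 0" using True by (intro sum.neutral) auto
    then show ?thesis using b by (intro exI[of _ b]) auto
  next
    case False
    then obtain p where p: "p \<in> J" "a p i \<noteq> 0" by blast
    define J' where "J' = J - {p}"
    \<comment> \<open>Gaussian elimination of coordinate i with pivot p.\<close>
    define a' where "a' j k = a j k - a j i / a p i * a p k" for j k
    have fJ: "finite J'" and "card I < card J'" and J: "J = insert p J'" "p \<notin> J'"
      using insert p by (auto simp: J'_def)
    from insert.IH[OF this(1,2), of a'] obtain b' where
      b': "\<exists>j\<in>J'. b' j \<noteq> 0" "\<forall>k\<in>I. (\<Sum>j\<in>J'. b' j * a' j k) = 0" by blast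
    \<comment> \<open>The entry at the pivot is determined by the vanishing of coordinate i.\<close>
    define b where "b j = (if j = p then - (\<Sum>j\<in>J'. b' j * a j i) / a p i else b' j)" for j
    have sum: "(\<Sum>j\<in>J. b j * a j k) = b p * a p k + (\<Sum>j\<in>J'. b' j * a j k)" for k
    proof -
      have "(\<Sum>j\<in>J'. b j * a j k) = (\<Sum>j\<in>J'. b' j * a j k)"
        using J(2) by (intro sum.cong) (auto simp: b_def)
      then show ?thesis unfolding J(1) using fJ J(2) by simp
    qed
    have "(\<Sum>j\<in>J. b j * a j k) = (\<Sum>j\<in>J'. b' j * a' j k)" for k
    proof -
      have "(\<Sum>j\<in>J'. b' j * a' j k) = (\<Sum>j\<in>J'. b' j * a j k) - (\<Sum>j\<in>J'. b' j * a j i) / a p i * a p k"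
        by (simp add: a'_def algebra_simps sum_subtractf sum_distrib_left sum_distrib_right sum_divide_distrib)
      then show ?thesis unfolding sum by (simp add: b_def)
    qed
    moreover have "a' j i = 0" for j using p(2) by (simp add: a'_def)
    moreover have "\<exists>j\<in>J. b j \<noteq> 0" using b'(1) J by (auto simp: b_def)
    ultimately show ?thesis using b'(2) by (intro exI[of _ b]) auto
  qed
qed

text \<open>Solving for the highest term with nonzero coefficient bounds each entry by a fixed
  multiple of earlier ones.\<close>

lemma linear_recurrence_growth:
  fixes u :: "nat \<Rightarrow> complex"
  assumes b: "\<exists>j\<le>N. b j \<noteq> 0" and rec: "\<And>m. (\<Sum>j\<le>N. b j * u (j + m)) = 0"
  obtains C K where "\<And>n. norm (u n) \<le> C * K ^ n"
proof -
  define d where "d = Max {j. j \<le> N \<and> b j \<noteq> 0}"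
  have fin: "finite {j. j \<le> N \<and> b j \<noteq> 0}" by simp
  have d: "d \<le> N" "b d \<noteq> 0" using Max_in[OF fin] b unfolding d_def by auto
  have above: "b j = 0" if "d < j" "j \<le> N" for j
  proof (rule ccontr)
    assume "b j \<noteq> 0"
    then have "j \<le> d" unfolding d_def using that(2) by (intro Max_ge[OF fin]) simp
    then show False using that(1) by simp
  qed
  \<comment> \<open>\<gamma> is the factor lost in one recurrence step and is absorbed by K. In
    addition \<open>K \<ge> 1\<close> makes powers increasing, so that the bound at n - 1 covers all
    earlier terms. C bounds the initial values.\<close>
  define \<gamma> where "\<gamma> = (\<Sum>j<d. norm (b j / b d))"
  define K where "K = max 1 \<gamma>"
  define C where "C = (\<Sum>j<d. norm (u j))"
  have K: "1 \<le> K" "\<gamma> \<le> K" by (auto simp: K_def)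
  have C: "0 \<le> C" by (simp add: C_def sum_nonneg)
  have step: "u (d + m) = - (\<Sum>j<d. b j / b d * u (j + m))" for m
  proof -
    have "(\<Sum>j\<le>N. b j * u (j + m)) = (\<Sum>j\<le>d. b j * u (j + m))"
      using d(1) above by (intro sum.mono_neutral_right) auto
    also have "\<dots> = (\<Sum>j<d. b j * u (j + m)) + b d * u (d + m)"
      by (simp add: lessThan_Suc_atMost[symmetric])
    finally have "b d * u (d + m) = - (\<Sum>j<d. b j * u (j + m))"
      using rec[of m] by (simp add: eq_neg_iff_add_eq_0 add.commute)
    then have "u (d + m) = - (\<Sum>j<d. b j * u (j + m)) / b d" using d(2) by (simp add: field_simps)
    then show ?thesis by (simp add: sum_divide_distrib)
  qed
  have "norm (u n) \<le> C * K ^ n" for n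
  proof (induction n rule: less_induct)
    case (less n)
    show ?case
    proof (cases "n < d")
      case True
      then have "norm (u n) \<le> C" unfolding C_def by (intro member_le_sum) auto
      also have "\<dots> \<le> C * K ^ n" using C K(1) by (simp add: mult_le_cancel_left1 one_le_power)
      finally show ?thesis .
    next
      case False
      then obtain m where n: "n = d + m" using le_Suc_ex not_less by blast
      have "norm (u n) \<le> (\<Sum>j<d. norm (b j / b d * u (j + m)))"
        unfolding n step norm_minus_cancel by (rule norm_sum)
      also have "\<dots> \<le> (\<Sum>j<d. norm (b j / b d) * (C * K ^ (n - 1)))"
      proof (rule sum_mono)
        fix j assume "j \<in> {..<d}"
        then have j: "j + m < n" "j + m \<le> n - 1" using n by auto
        have "norm (u (j + m)) \<le> C * K ^ (j + m)" by (rule less.IH[OF j(1)])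
        also have "\<dots> \<le> C * K ^ (n - 1)" using C K(1) j(2) by (intro mult_left_mono power_increasing) auto
        finally show "norm (b j / b d * u (j + m)) \<le> norm (b j / b d) * (C * K ^ (n - 1))"
          unfolding norm_mult by (rule mult_left_mono) simp
      qed
      also have "\<dots> = \<gamma> * (C * K ^ (n - 1))" by (simp add: \<gamma>_def sum_distrib_right)
      also have "\<dots> \<le> C * K ^ n"
      proof (cases n)
        \<comment> \<open>The truncated n - 1 is harmless: n = 0 forces d = 0, where \<gamma> is an
          empty sum.\<close>
        case 0
        then have "d = 0" using n by simp
        then show ?thesis using C by (simp add: \<gamma>_def 0)
      next
        case (Suc n')
        have "\<gamma> * (C * K ^ n') \<le> K * (C * K ^ n')" using C K by (intro mult_right_mono) auto
        then show ?thesis by (simp add: Suc algebra_simps)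
      qed
      finally show ?thesis .
    qed
  qed
  then show ?thesis by (rule that)
qed

text \<open>By the geometric bound, the sum of \<open>u k * z ^ k / fact k\<close> is an entire
  function of z. It vanishes at 0 with derivative \<open>u 1\<close>, and the sequence consists of
  its difference quotients at the points 1/(n+1).\<close>

lemma exponential_series_derivative:
  fixes u :: "nat \<Rightarrow> complex"
  assumes bound: "\<And>n. norm (u n) \<le> C * K ^ n" and u0: "u 0 = 0"
  shows "(\<lambda>n. of_nat (Suc n) * suminf (\<lambda>k. 1 / fact k * (inverse (of_nat (Suc n)) ^ k * u k))) \<longlonglongrightarrow> u 1"
proof -
  define c where "c k = u k / fact k" for k
  have "summable (\<lambda>k. c k * z ^ k)" for z
  proof (rule summable_comparison_test')
    show "summable (\<lambda>k. C * (inverse (fact k) * (\<bar>K\<bar> * norm z) ^ k))"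
      by (intro summable_mult summable_exp)
    fix k :: nat
    \<comment> \<open>K may be negative, hence the absolute value; C is nonnegative by the bound at
      0.\<close>
    have "norm (u k) \<le> C * \<bar>K\<bar> ^ k"
    proof -
      have "0 \<le> C" using bound[of 0] u0 by simp
      then have "C * K ^ k \<le> C * \<bar>K\<bar> ^ k" by (intro mult_left_mono) (simp_all add: power_abs[symmetric])
      then show ?thesis using bound[of k] by simp
    qed
    then have "norm (u k) * (norm z ^ k / fact k) \<le> C * \<bar>K\<bar> ^ k * (norm z ^ k / fact k)"
      by (rule mult_right_mono) simp
    then show "norm (c k * z ^ k) \<le> C * (inverse (fact k) * (\<bar>K\<bar> * norm z) ^ k)"
      by (simp add: c_def norm_mult norm_divide norm_power power_mult_distrib field_simps)
  qed
  then have "((\<lambda>z. suminf (\<lambda>k. c k * z ^ k)) has_field_derivative suminf (\<lambda>k. diffs c k * 0 ^ k)) (at 0)"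
    by (rule termdiffs_strong_converges_everywhere)
  moreover have "suminf (\<lambda>k. diffs c k * 0 ^ k) = u 1" unfolding powser_zero by (simp add: diffs_def c_def)
  moreover have "suminf (\<lambda>k. c k * 0 ^ k) = 0" unfolding powser_zero by (simp add: c_def u0)
  ultimately have L: "(\<lambda>h. suminf (\<lambda>k. c k * h ^ k) / h) \<midarrow>0\<rightarrow> u 1"
    by (simp add: DERIV_def)
  have "(\<lambda>n. inverse (of_nat (Suc n)) :: complex) \<longlonglongrightarrow> 0"
    using LIMSEQ_inverse_real_of_nat[THEN tendsto_of_real, where 'a = complex] by (simp del: of_nat_Suc)
  then have "filterlim (\<lambda>n. inverse (of_nat (Suc n)) :: complex) (at 0) sequentially"
    by (simp add: filterlim_at del: of_nat_Suc)
  from filterlim_compose[OF L this]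
  have "(\<lambda>n. suminf (\<lambda>k. c k * inverse (of_nat (Suc n)) ^ k) / inverse (of_nat (Suc n))) \<longlonglongrightarrow> u 1" .
  then show ?thesis by (simp add: c_def field_simps)
qed

section \<open>Growth of the convolution powers of the generator\<close>

context convolution
begin

context
  fixes \<psi> :: "'u \<Rightarrow> complex ^ 'd"
  assumes \<psi>: "linear_map B \<psi>"
begin

abbreviation "gen \<equiv> sym_der (transp \<psi>)"

lemma gen_lin: "lin_fun (Sym V) gen"
  by (rule lin_fun_sym_der[OF V transp_lin_fun[OF \<psi>]])

lemma scaled_linear: "linear_map B (\<lambda>b. s *s \<psi> b)"
  using \<psi> by (simp add: linear_map_def vector_add_ldistrib vector_smult_assoc mult.commute)

text \<open>One representative of the coproduct of x serves all pairs of functionals simultaneously.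
  Its support is what makes the later dependence argument finite.\<close>

lemma comult_expand:
  assumes "x \<in> carrier (Sym V)"
  obtains q where "Poly_Mapping.keys q \<subseteq> carrier (Sym V) \<times> carrier (Sym V)"
    "\<And>f g. lin_fun (Sym V) f \<Longrightarrow> lin_fun (Sym V) g \<Longrightarrow>
       convolve P B \<Lambda> f g x = lin_ext (\<lambda>(x, y). f x * g y) q"
    "\<And>\<phi> \<eta>. linear_map B \<phi> \<Longrightarrow> linear_map B \<eta> \<Longrightarrow> ev (star \<phi> \<eta>) x = lin_ext (\<lambda>(x, y). ev \<phi> x * ev \<eta> y) q"
proof -
  obtain q where q: "q \<in> carrier (tpolys (Sym V) (Sym V))" "comult P B \<Lambda> x = tensor_class (Sym V) (Sym V) q"
    using assms by (rule comult_class)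
  show ?thesis
  proof (rule that)
    show "Poly_Mapping.keys q \<subseteq> carrier (Sym V) \<times> carrier (Sym V)" using q(1) by (simp add: DirProd_simps)
    show "convolve P B \<Lambda> f g x = lin_ext (\<lambda>(x, y). f x * g y) q"
      if "lin_fun (Sym V) f" "lin_fun (Sym V) g" for f g
      unfolding convolve_def q(2) by (rule tensor_fun_class[OF SV SV that q(1)])
    show "ev (star \<phi> \<eta>) x = lin_ext (\<lambda>(x, y). ev \<phi> x * ev \<eta> y) q"
      if "linear_map B \<phi>" "linear_map B \<eta>" for \<phi> \<eta>
      unfolding comult_ev[OF that assms, symmetric] q(2)
      by (rule tensor_fun_class[OF SV SV ev_lin[OF that(1)] ev_lin[OF that(2)] q(1)])
  qed
qed

lemma lin_ext_derivative:
  assumes "\<And>x. x \<in> Poly_Mapping.keys p \<Longrightarrow> ((\<lambda>s. f s x) has_field_derivative f' x) (at 0)"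
  shows "((\<lambda>s. lin_ext (f s) p) has_field_derivative lin_ext f' p) (at 0)"
  unfolding lin_ext_def using assms by (intro DERIV_sum DERIV_cmult) auto

lemma ev_scaled_derivative:
  assumes "y \<in> carrier (Sym V)"
  shows "((\<lambda>s. ev (\<lambda>b. s *s \<psi> b) y) has_field_derivative gen y) (at 0)"
proof -
  have "transp (\<lambda>b. s *s \<psi> b) = (\<lambda>v. s * transp \<psi> v)" for s
    by (simp add: fun_eq_iff transp_def sum_distrib_left)
  then show ?thesis
    using sym_fun_derivative[OF V transp_lin_fun[OF \<psi>] assms] by (simp add: ev_def)
qed

text \<open>Convolving with the generator from the right acts on elements by \<open>(id \<otimes> gen) \<circ> \<Delta>\<close>.\<close>

lemma right_action:
  assumes c: "c \<in> carrier (Sym V)"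
  shows "\<exists>c'\<in>carrier (Sym V).
     (\<forall>f. lin_fun (Sym V) f \<longrightarrow> convolve P B \<Lambda> f gen c = f c') \<and>
     (\<forall>\<phi>. linear_map B \<phi> \<longrightarrow> ((\<lambda>s. ev (star \<phi> (\<lambda>b. s *s \<psi> b)) c) has_field_derivative ev \<phi> c') (at 0))"
proof -
  obtain q where q: "Poly_Mapping.keys q \<subseteq> carrier (Sym V) \<times> carrier (Sym V)"
    "\<And>f g. lin_fun (Sym V) f \<Longrightarrow> lin_fun (Sym V) g \<Longrightarrow>
       convolve P B \<Lambda> f g c = lin_ext (\<lambda>(x, y). f x * g y) q"
    "\<And>\<phi> \<eta>. linear_map B \<phi> \<Longrightarrow> linear_map B \<eta> \<Longrightarrow> ev (star \<phi> \<eta>) c = lin_ext (\<lambda>(x, y). ev \<phi> x * ev \<eta> y) q"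
    using c by (rule comult_expand) blast
  \<comment> \<open>Applies the generator to the right leg and keeps the left one: \<open>c'\<close>
    is the sum of the left legs x weighted by \<open>gen y\<close>.\<close>
  let ?m = "\<lambda>(x, y). gen y \<odot>\<^bsub>Sym V\<^esub> x"
  note sm = module_complexD[OF algebra.module[OF SV]]
  have m: "?m xy \<in> carrier (Sym V)" if "xy \<in> carrier (Sym V) \<times> carrier (Sym V)" for xy using that sm(7) by auto
  note L = algebra.module[OF SV] m
  define c' where "c' = lext (Sym V) ?m q"
  have "c' \<in> carrier (Sym V)" unfolding c'_def by (rule lext_closed[where m = ?m, OF L q(1)])
  moreover have fc': "f c' = lin_ext (\<lambda>(x, y). f x * gen y) q" if f: "lin_fun (Sym V) f" for f
    unfolding c'_def using q(1)
  proof (induction q rule: pm_induct)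
    case zero
    have "f \<zero>\<^bsub>Sym V\<^esub> = 0" using f sm(1,13) unfolding lin_fun_def by (metis mult_zero_left)
    then show ?case by (simp add: lext_zero[where m = ?m, OF L])
  next
    case (add xy a q)
    obtain x y where xy: "xy = (x, y)" "x \<in> carrier (Sym V)" "y \<in> carrier (Sym V)" using add(1) by blast
    have k: "Poly_Mapping.keys (Poly_Mapping.single xy a) \<subseteq> carrier (Sym V) \<times> carrier (Sym V)" using add(1) by auto
    have "lext (Sym V) ?m (Poly_Mapping.single xy a + q) = (a \<odot>\<^bsub>Sym V\<^esub> ?m xy) \<oplus>\<^bsub>Sym V\<^esub> lext (Sym V) ?m q"
      using lext_add[where m = ?m, OF L k add(2)] lext_single[where m = ?m, OF L add(1)] by simp
    then have "f (lext (Sym V) ?m (Poly_Mapping.single xy a + q)) =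
        a * (gen y * f x) + f (lext (Sym V) ?m q)"
      using f xy sm(7) lext_closed[where m = ?m, OF L add(2)] by (simp add: lin_fun_def)
    then show ?case unfolding add(3) by (simp add: lin_ext_add xy mult.commute)
  qed
  \<comment> \<open>Only the right leg depends on s, and its derivative at 0 is the
    generator.\<close>
  moreover have "((\<lambda>s. ev (star \<phi> (\<lambda>b. s *s \<psi> b)) c) has_field_derivative ev \<phi> c') (at 0)" if \<phi>: "linear_map B \<phi>" for \<phi>
    unfolding q(3)[OF \<phi> scaled_linear] fc'[OF ev_lin[OF \<phi>]]
    by (rule lin_ext_derivative) (use q(1) ev_scaled_derivative in \<open>auto intro!: DERIV_cmult\<close>)
  ultimately show ?thesis using q(2)[OF _ gen_lin] by metis
qed

text \<open>Chosen element by element; no linearity is claimed, and later arguments see it only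
  through its evaluations.\<close>

definition act :: "('u ^ 'd) sym \<Rightarrow> ('u ^ 'd) sym" where
  "act c = (SOME c'. c' \<in> carrier (Sym V) \<and>
     (\<forall>f. lin_fun (Sym V) f \<longrightarrow> convolve P B \<Lambda> f gen c = f c') \<and>
     (\<forall>\<phi>. linear_map B \<phi> \<longrightarrow> ((\<lambda>s. ev (star \<phi> (\<lambda>b. s *s \<psi> b)) c) has_field_derivative ev \<phi> c') (at 0)))"

lemma act:
  assumes "c \<in> carrier (Sym V)"
  shows "act c \<in> carrier (Sym V)"
    "lin_fun (Sym V) f \<Longrightarrow> convolve P B \<Lambda> f gen c = f (act c)"
    "linear_map B \<phi> \<Longrightarrow> ((\<lambda>s. ev (star \<phi> (\<lambda>b. s *s \<psi> b)) c) has_field_derivative ev \<phi> (act c)) (at 0)"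
proof -
  have "\<exists>c'. c' \<in> carrier (Sym V) \<and>
     (\<forall>f. lin_fun (Sym V) f \<longrightarrow> convolve P B \<Lambda> f gen c = f c') \<and>
     (\<forall>\<phi>. linear_map B \<phi> \<longrightarrow> ((\<lambda>s. ev (star \<phi> (\<lambda>b. s *s \<psi> b)) c) has_field_derivative ev \<phi> c') (at 0))"
    using right_action[OF assms] by blast
  from someI_ex[OF this, folded act_def] show "act c \<in> carrier (Sym V)"
    "lin_fun (Sym V) f \<Longrightarrow> convolve P B \<Lambda> f gen c = f (act c)"
    "linear_map B \<phi> \<Longrightarrow> ((\<lambda>s. ev (star \<phi> (\<lambda>b. s *s \<psi> b)) c) has_field_derivative ev \<phi> (act c)) (at 0)"
    by blast+
qed

lemma act_pow: "c \<in> carrier (Sym V) \<Longrightarrow> (act ^^ n) c \<in> carrier (Sym V)"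
  by (induction n) (auto intro: act(1))

lemma transp_0: "transp (\<lambda>_. 0) = (\<lambda>_. 0)"
  by (simp add: fun_eq_iff transp_def)

text \<open>Each power convolves with one more generator on the right, which is traded for one
  application of \<open>act\<close>; what remains at the end is the counit, the character of the
  functional 0.\<close>

lemma conv_power_act:
  assumes "c \<in> carrier (Sym V)"
  shows "conv_power P B \<Lambda> gen n c = ev (\<lambda>_. 0) ((act ^^ n) c)"
  using assms
proof (induction n arbitrary: c)
  case (Suc n)
  then show ?case using act(1)[OF Suc.prems] act(2)[OF Suc.prems conv_power_lin[OF gen_lin]]
    by (simp add: funpow_swap1)
qed (simp add: ev_def transp_0)

text \<open>Associativity: all \<open>act\<^sup>n c\<close> lie in the span of the left legs of \<open>\<Delta> c\<close>.\<close>

lemma act_pow_expand: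
  assumes c: "c \<in> carrier (Sym V)"
  obtains q where "\<And>n \<phi>. linear_map B \<phi> \<Longrightarrow>
    ev \<phi> ((act ^^ n) c) = lin_ext (\<lambda>(x, y). ev \<phi> x * ev (\<lambda>_. 0) ((act ^^ n) y)) q"
proof -
  obtain q where q: "Poly_Mapping.keys q \<subseteq> carrier (Sym V) \<times> carrier (Sym V)"
    "\<And>\<phi> \<eta>. linear_map B \<phi> \<Longrightarrow> linear_map B \<eta> \<Longrightarrow> ev (star \<phi> \<eta>) c = lin_ext (\<lambda>(x, y). ev \<phi> x * ev \<eta> y) q"
    using c by (rule comult_expand) blast
  \<comment> \<open>The case \<eta> = 0 of interest is not inductive. With \<eta> arbitrary, the
    step replaces \<eta> by the product of \<eta> with s\<psi> and differentiates at s = 0;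
    associativity lets both sides be read as such a derivative.\<close>
  have *: "ev (star \<phi> \<eta>) ((act ^^ n) c) = lin_ext (\<lambda>(x, y). ev \<phi> x * ev \<eta> ((act ^^ n) y)) q"
    if \<phi>: "linear_map B \<phi>" and \<eta>: "linear_map B \<eta>" for n \<phi> \<eta>
    using \<eta>
  proof (induction n arbitrary: \<eta>)
    case 0
    then show ?case using q(2)[OF \<phi>] by simp
  next
    case (Suc n)
    let ?\<psi> = "\<lambda>s b. s *s \<psi> b"
    have l: "linear_map B (star \<eta> (?\<psi> s))" for s by (rule star_linear[OF Suc.prems scaled_linear])
    have "((\<lambda>s. lin_ext (\<lambda>(x, y). ev \<phi> x * ev (star \<eta> (?\<psi> s)) ((act ^^ n) y)) q) has_field_derivative
        lin_ext (\<lambda>(x, y). ev \<phi> x * ev \<eta> ((act ^^ Suc n) y)) q) (at 0)"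
      by (rule lin_ext_derivative) (use q(1) act(3)[OF act_pow Suc.prems] in \<open>auto intro!: DERIV_cmult\<close>)
    moreover have "lin_ext (\<lambda>(x, y). ev \<phi> x * ev (star \<eta> (?\<psi> s)) ((act ^^ n) y)) q =
        ev (star (star \<phi> \<eta>) (?\<psi> s)) ((act ^^ n) c)" for s
    proof -
      have "ev (star (star \<phi> \<eta>) (?\<psi> s)) ((act ^^ n) c) = ev (star \<phi> (star \<eta> (?\<psi> s))) ((act ^^ n) c)"
        by (rule ev_cong[OF star_linear[OF star_linear[OF \<phi> Suc.prems] scaled_linear] star_linear[OF \<phi> l]
              star_assoc[OF \<phi> Suc.prems scaled_linear] act_pow[OF c]])
      then show ?thesis using Suc.IH[OF l] by simp
    qed
    ultimately have "((\<lambda>s. ev (star (star \<phi> \<eta>) (?\<psi> s)) ((act ^^ n) c)) has_field_derivative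
        lin_ext (\<lambda>(x, y). ev \<phi> x * ev \<eta> ((act ^^ Suc n) y)) q) (at 0)" by simp
    moreover have "((\<lambda>s. ev (star (star \<phi> \<eta>) (?\<psi> s)) ((act ^^ n) c)) has_field_derivative
        ev (star \<phi> \<eta>) ((act ^^ Suc n) c)) (at 0)"
      using act(3)[OF act_pow[OF c] star_linear[OF \<phi> Suc.prems]] by simp
    ultimately show ?case by (rule DERIV_unique[symmetric])
  qed
  have "ev \<phi> ((act ^^ n) c) = lin_ext (\<lambda>(x, y). ev \<phi> x * ev (\<lambda>_. 0) ((act ^^ n) y)) q" if \<phi>: "linear_map B \<phi>" for \<phi> n
    using *[OF \<phi> linear_map_0] ev_cong[OF star_linear[OF \<phi> linear_map_0] \<phi> star_zero(1)[OF \<phi>] act_pow[OF c]] by metis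
  then show ?thesis by (rule that)
qed

text \<open>The vectors of right-leg values have as many entries as the support of q, so finitely
  many iterates are dependent. The coefficients do not involve \<phi>, and so the dependence can be
  shifted along the sequence.\<close>

lemma conv_power_growth:
  assumes c: "c \<in> carrier (Sym V)"
  obtains C K where "\<And>n. norm (conv_power P B \<Lambda> gen n c) \<le> C * K ^ n"
proof -
  obtain q where q: "\<And>n \<phi>. linear_map B \<phi> \<Longrightarrow>
      ev \<phi> ((act ^^ n) c) = lin_ext (\<lambda>(x, y). ev \<phi> x * ev (\<lambda>_. 0) ((act ^^ n) y)) q"
    by (rule act_pow_expand[OF c]) blast
  let ?N = "card (Poly_Mapping.keys q)"
  \<comment> \<open>The indices up to ?N give one vector more than there are coordinates.\<close>
  obtain b where b: "\<exists>j\<in>{..?N}. b j \<noteq> 0"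
    "\<forall>xy\<in>Poly_Mapping.keys q. (\<Sum>j\<in>{..?N}. b j * ev (\<lambda>_. 0) ((act ^^ j) (snd xy))) = 0"
    using finite_linear_dependence[of "Poly_Mapping.keys q" "{..?N}" "\<lambda>j xy. ev (\<lambda>_. 0) ((act ^^ j) (snd xy))"]
    by auto
  \<comment> \<open>The shift by one more \<open>act\<close> is the derivative at s = 0 of the
    relation for the product of \<phi> with s\<psi>; hence \<phi> must stay arbitrary in the
    induction.\<close>
  have rec: "(\<Sum>j\<le>?N. b j * ev \<phi> ((act ^^ (j + m)) c)) = 0" if "linear_map B \<phi>" for m \<phi>
    using that
  proof (induction m arbitrary: \<phi>)
    case 0
    have "(\<Sum>j\<le>?N. b j * ev \<phi> ((act ^^ j) c)) =
        (\<Sum>j\<le>?N. \<Sum>xy\<in>Poly_Mapping.keys q. Poly_Mapping.lookup q xy * ev \<phi> (fst xy) *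
           (b j * ev (\<lambda>_. 0) ((act ^^ j) (snd xy))))"
      unfolding q[OF 0] lin_ext_def
      by (simp add: sum_distrib_left split_beta algebra_simps)
    also have "\<dots> = (\<Sum>xy\<in>Poly_Mapping.keys q. Poly_Mapping.lookup q xy * ev \<phi> (fst xy) *
           (\<Sum>j\<le>?N. b j * ev (\<lambda>_. 0) ((act ^^ j) (snd xy))))"
      by (subst sum.swap) (simp add: sum_distrib_left)
    also have "\<dots> = 0" using b(2) by (intro sum.neutral) auto
    finally show ?case by simp
  next
    case (Suc m)
    have "((\<lambda>s. \<Sum>j\<le>?N. b j * ev (star \<phi> (\<lambda>b. s *s \<psi> b)) ((act ^^ (j + m)) c)) has_field_derivative
        (\<Sum>j\<le>?N. b j * ev \<phi> (act ((act ^^ (j + m)) c)))) (at 0)"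
      by (intro DERIV_sum DERIV_cmult act(3)[OF act_pow[OF c] Suc.prems])
    moreover have "(\<Sum>j\<le>?N. b j * ev (star \<phi> (\<lambda>b. s *s \<psi> b)) ((act ^^ (j + m)) c)) = 0" for s
      by (rule Suc.IH[OF star_linear[OF Suc.prems scaled_linear]])
    ultimately have "((\<lambda>s. 0) has_field_derivative (\<Sum>j\<le>?N. b j * ev \<phi> (act ((act ^^ (j + m)) c)))) (at 0)"
      by simp
    from DERIV_unique[OF this DERIV_const] show ?case by simp
  qed
  show ?thesis
    by (rule linear_recurrence_growth[of ?N b "\<lambda>n. conv_power P B \<Lambda> gen n c"])
       (use b(1) rec[OF linear_map_0] that in \<open>auto simp: conv_power_act[OF c]\<close>)
qed

text \<open>The k-th component of the exponential at b is the bialgebra exponential at the generator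
  c with b in slot k. There the counit vanishes and the first convolution power is the k-th
  component of \<psi>, so the series starts with t\<psi>.\<close>

lemma conv_exp_limit:
  assumes b: "b \<in> carrier B"
  shows "(\<lambda>n. real (Suc n) *\<^sub>R conv_exp P B \<Lambda> (\<lambda>b. inverse (real (Suc n)) *\<^sub>R \<psi> b) b $ k) \<longlonglongrightarrow> \<psi> b $ k"
proof -
  let ?v = "dsum_unit B k b"
  have v: "?v \<in> carrier V" by (rule dsum_unit_closed[OF nu_algebraD(1)[OF nB] b])
  define c where "c = sym_emb V ?v"
  have c: "c \<in> carrier (Sym V)"
    unfolding c_def sym_emb_def Sym_simps(1)[OF V] using v by (intro imageI) (simp add: sym_var_def)
  have ev_c: "ev \<phi> c = \<phi> b $ k" if "linear_map B \<phi>" for \<phi>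
    unfolding ev_def c_def sym_fun_emb[OF V transp_lin_fun[OF that] v]
    by (rule transp_dsum_unit[OF nu_algebraD(1)[OF nB] that])
  define u where "u n = conv_power P B \<Lambda> gen n c" for n
  have u0: "u 0 = 0"
    using ev_c[OF linear_map_0] by (simp add: u_def ev_def transp_0)
  \<comment> \<open>\<open>u 1\<close> is the character of 0 at \<open>act c\<close>, hence this
    derivative; and the product of 0 with s\<psi> is s\<psi>, which is linear in s.\<close>
  have "((\<lambda>s. ev (star (\<lambda>_. 0) (\<lambda>b. s *s \<psi> b)) c) has_field_derivative u 1) (at 0)"
    using act(3)[OF c linear_map_0] by (simp add: u_def conv_power_act[OF c] del: conv_power.simps)
  moreover have "ev (star (\<lambda>_. 0) (\<lambda>b. s *s \<psi> b)) c = s * \<psi> b $ k" for s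
    using ev_c[OF star_linear[OF linear_map_0 scaled_linear]] star_zero(2)[OF scaled_linear b] by simp
  ultimately have "((\<lambda>s. s * \<psi> b $ k) has_field_derivative u 1) (at 0)" by simp
  moreover have "((\<lambda>s. s * \<psi> b $ k) has_field_derivative \<psi> b $ k) (at 0)"
    by (rule derivative_eq_intros refl)+ simp
  ultimately have u1: "u 1 = \<psi> b $ k" by (rule DERIV_unique)
  obtain C K where "\<And>n. norm (u n) \<le> C * K ^ n"
    unfolding u_def by (rule conv_power_growth[OF c]) blast
  from exponential_series_derivative[OF this u0]
  have lim: "(\<lambda>n. of_nat (Suc n) * suminf (\<lambda>k. 1 / fact k * (inverse (of_nat (Suc n)) ^ k * u k))) \<longlonglongrightarrow> \<psi> b $ k"
    by (simp only: u1)
  have "conv_exp P B \<Lambda> (\<lambda>b. t *\<^sub>R \<psi> b) b $ k = suminf (\<lambda>j. 1 / fact j * (of_real t ^ j * u j))" for t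
  proof -
    have eq: "transp (\<lambda>b. t *\<^sub>R \<psi> b) = (\<lambda>v. of_real t * transp \<psi> v)"
    proof -
      have "(t *\<^sub>R x) $ k = of_real t * x $ k" for x :: "complex ^ 'd" and k
        unfolding vector_scaleR_component by (rule scaleR_conv_of_real)
      then show ?thesis by (simp add: fun_eq_iff transp_def sum_distrib_left)
    qed
    have lf: "lin_fun V (\<lambda>v. of_real t * transp \<psi> v)"
      using transp_lin_fun[OF \<psi>] by (simp add: lin_fun_def algebra_simps)
    \<comment> \<open>The generator of t\<psi> is t times that of \<psi>, because only monomials of
      degree one contribute; its n-th power then scales with \<open>t ^ n\<close>.\<close>
    have "sym_der (\<lambda>v. of_real t * transp \<psi> v) x = of_real t * gen x" if x: "x \<in> carrier (Sym V)" for x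
    proof -
      obtain p where p: "p \<in> carrier (polys V)" "x = sym_class V p" using x by (auto simp: Sym_simps[OF V])
      have "der_ext (\<lambda>v. of_real t * transp \<psi> v) p = of_real t * der_ext (transp \<psi>) p"
        unfolding der_ext_def lin_ext_fun_scale[symmetric]
        by (rule lin_ext_cong) (auto simp: prod_mset.distrib)
      then show ?thesis
        unfolding p(2) sym_der_class[OF V lf p(1)] sym_der_class[OF V transp_lin_fun[OF \<psi>] p(1)] .
    qed
    then have "conv_power P B \<Lambda> (sym_der (\<lambda>v. of_real t * transp \<psi> v)) j c = of_real t ^ j * u j" for j
      unfolding u_def by (rule conv_power_scale[OF gen_lin lin_fun_sym_der[OF V lf] _ c])
    then show ?thesis
      by (simp add: conv_exp_def inv_transp_def bialg_exp_def eq c_def dsum_unit_def)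
  qed
  then show ?thesis using lim by (simp add: scaleR_conv_of_real)
qed

end

end

section \<open>The Schoenberg correspondence\<close>

text \<open>Positivity is expanded at the element (c, a) of the unitization. The choice c = 0 gives
  the first two claims, while c = 1 and c = \<open>\<i>\<close> couple a with its adjoint.\<close>

lemma restricted_state_nonneg:
  assumes A: "nu_algebra A" and s: "involution A s" and \<phi>: "restricted_state A s \<phi>" and a: "a \<in> carrier A"
  shows "Re (\<phi> (s a \<otimes>\<^bsub>A\<^esub> a) $ k) \<ge> 0" "Im (\<phi> (s a \<otimes>\<^bsub>A\<^esub> a) $ k) = 0" "\<phi> (s a) $ k = cnj (\<phi> a $ k)"
proof -
  note m = module_complexD[OF nu_algebraD(1)[OF A]]
  have l: "linear_map A \<phi>" using \<phi> by (simp add: restricted_state_def)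
  have sa: "s a \<in> carrier A" using s a by (simp add: involution_def)
  have saa: "s a \<otimes>\<^bsub>A\<^esub> a \<in> carrier A" by (rule nu_algebraD(2)[OF A sa a])
  have "cnj c * c + (cnj c * \<phi> a $ k + c * \<phi> (s a) $ k + \<phi> (s a \<otimes>\<^bsub>A\<^esub> a) $ k) \<in> \<real>\<^sub>\<ge>\<^sub>0" for c
  proof -
    have "nonneg_vec (unit_ext \<phi> (unit_star s (c, a) \<otimes>\<^bsub>unitization A\<^esub> (c, a)))"
      using \<phi> a by (simp add: restricted_state_def unitization_def)
    then have "nonneg_vec ((\<chi> k. cnj c * c) + \<phi> (cnj c \<odot>\<^bsub>A\<^esub> a \<oplus>\<^bsub>A\<^esub> c \<odot>\<^bsub>A\<^esub> s a \<oplus>\<^bsub>A\<^esub> s a \<otimes>\<^bsub>A\<^esub> a))"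
      by (simp add: unit_star_def unitization_def unit_ext_def)
    then show ?thesis
      using l a sa saa m(2,7) by (simp add: nonneg_vec_def linear_map_def)
  qed
  note * = this[unfolded complex_nonneg_Reals_iff]
  show "Re (\<phi> (s a \<otimes>\<^bsub>A\<^esub> a) $ k) \<ge> 0" and i0: "Im (\<phi> (s a \<otimes>\<^bsub>A\<^esub> a) $ k) = 0" using *[of 0] by simp_all
  \<comment> \<open>At c = 1 the imaginary part of the sum of the values at a and s a vanishes; at c
    = \<open>\<i>\<close> so does that of \<open>\<i>\<close> times their difference, which equates
    the real parts.\<close>
  show "\<phi> (s a) $ k = cnj (\<phi> a $ k)" using *[of 1] *[of \<i>] i0 by (simp add: complex_eq_iff)
qed

lemma generating_functional_of_states:
  fixes P :: "('u, 'm::finite, 'd::finite) functional_product"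
  assumes P: "universal_product P" and B: "star_dual_semigroup B s \<Lambda>" and \<psi>: "linear_map B \<psi>"
    and state: "\<And>t::real. t > 0 \<Longrightarrow> restricted_state B s (conv_exp P B \<Lambda> (\<lambda>b. t *\<^sub>R \<psi> b))"
  shows "restricted_generating_functional B s \<psi>"
proof -
  interpret cv: convolution P B \<Lambda> by unfold_locales (use P B in \<open>simp_all add: star_dual_semigroup_def\<close>)
  have s: "involution B s" using B by (simp add: star_dual_semigroup_def)
  \<comment> \<open>The limit t \<down> 0 is taken along t = 1/(n+1).\<close>
  define \<phi> where "\<phi> n = conv_exp P B \<Lambda> (\<lambda>b. inverse (real (Suc n)) *\<^sub>R \<psi> b)" for n
  have st: "restricted_state B s (\<phi> n)" for n unfolding \<phi>_def by (rule state) simp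
  note pos = restricted_state_nonneg[OF cv.nB s st]
  have lim: "(\<lambda>n. real (Suc n) *\<^sub>R \<phi> n b $ k) \<longlonglongrightarrow> \<psi> b $ k" if "b \<in> carrier B" for b k
    unfolding \<phi>_def by (rule cv.conv_exp_limit[OF \<psi> that])
  have sc: "s a \<in> carrier B" if "a \<in> carrier B" for a using s that by (simp add: involution_def)
  show ?thesis
    unfolding restricted_generating_functional_def nonneg_vec_def
  proof (intro conjI ballI allI \<psi>)
    fix a k assume a: "a \<in> carrier B"
    have "(\<lambda>n. real (Suc n) *\<^sub>R \<phi> n (s a) $ k) \<longlonglongrightarrow> cnj (\<psi> a $ k)"
      using tendsto_cnj[OF lim[OF a, of k]] by (simp add: pos(3)[OF a])
    with lim[OF sc[OF a], of k] show "\<psi> (s a) $ k = cnj (\<psi> a $ k)" by (rule LIMSEQ_unique)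
    note L = lim[OF nu_algebraD(2)[OF cv.nB sc[OF a] a], of k]
    \<comment> \<open>Nonnegativity of a complex number is split into two closed conditions, on the
      real and on the imaginary part, each of which passes to the limit.\<close>
    have "0 \<le> Re (\<psi> (s a \<otimes>\<^bsub>B\<^esub> a) $ k)"
      by (rule LIMSEQ_le_const[OF tendsto_Re[OF L]]) (use pos(1)[OF a] in \<open>auto intro!: exI[of _ 0] mult_nonneg_nonneg\<close>)
    moreover have "(\<lambda>n. 0) \<longlonglongrightarrow> Im (\<psi> (s a \<otimes>\<^bsub>B\<^esub> a) $ k)"
      using tendsto_Im[OF L] by (simp add: pos(2)[OF a])
    then have "Im (\<psi> (s a \<otimes>\<^bsub>B\<^esub> a) $ k) = 0" by (metis LIMSEQ_unique tendsto_const)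
    ultimately show "\<psi> (s a \<otimes>\<^bsub>B\<^esub> a) $ k \<in> \<real>\<^sub>\<ge>\<^sub>0" by (simp add: complex_nonneg_Reals_iff)
  qed
qed

lemma generating_functional_scale:
  assumes \<psi>: "restricted_generating_functional A s \<psi>" and t: "0 \<le> (t::real)"
  shows "restricted_generating_functional A s (\<lambda>b. t *\<^sub>R \<psi> b)"
  using assms
  by (auto simp: restricted_generating_functional_def linear_map_def nonneg_vec_def complex_nonneg_Reals_iff
      scaleR_right_distrib vec_eq_iff)

theorem mainTheorem2:
  fixes P :: "('u, 'm::finite, 'd::finite) functional_product"
  assumes "universal_product P"
  shows "schoenberg P \<longleftrightarrow>
    (\<forall>B s \<Lambda> \<psi>. star_dual_semigroup B s \<Lambda> \<and> linear_map B \<psi> \<longrightarrow>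
       (restricted_generating_functional B s \<psi> \<longleftrightarrow>
        (\<forall>t::real. t > 0 \<longrightarrow> restricted_state B s (conv_exp P B \<Lambda> (\<lambda>b. t *\<^sub>R \<psi> b)))))"
proof
  assume S: "schoenberg P"
  show "\<forall>B s \<Lambda> \<psi>. star_dual_semigroup B s \<Lambda> \<and> linear_map B \<psi> \<longrightarrow>
       (restricted_generating_functional B s \<psi> \<longleftrightarrow>
        (\<forall>t::real. t > 0 \<longrightarrow> restricted_state B s (conv_exp P B \<Lambda> (\<lambda>b. t *\<^sub>R \<psi> b))))"
  proof (intro allI impI iffI)
    fix B :: "('u, 'm) faced" and s \<Lambda> and \<psi> :: "'u \<Rightarrow> complex ^ 'd" and t :: real
    assume "star_dual_semigroup B s \<Lambda> \<and> linear_map B \<psi>" "restricted_generating_functional B s \<psi>" "0 < t"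
    \<comment> \<open>A positive multiple of a restricted generating functional is again one, so the
      Schoenberg property applies to t\<psi>.\<close>
    then show "restricted_state B s (conv_exp P B \<Lambda> (\<lambda>b. t *\<^sub>R \<psi> b))"
      using S generating_functional_scale[of B s \<psi> t] unfolding schoenberg_def by auto
  next
    fix B :: "('u, 'm) faced" and s \<Lambda> and \<psi> :: "'u \<Rightarrow> complex ^ 'd"
    assume "star_dual_semigroup B s \<Lambda> \<and> linear_map B \<psi>"
      "\<forall>t>0. restricted_state B s (conv_exp P B \<Lambda> (\<lambda>b. t *\<^sub>R \<psi> b))"
    then show "restricted_generating_functional B s \<psi>"
      using generating_functional_of_states[OF assms] by blast
  qed
next
  assume *: "\<forall>B s \<Lambda> \<psi>. star_dual_semigroup B s \<Lambda> \<and> linear_map B \<psi> \<longrightarrow>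
       (restricted_generating_functional B s \<psi> \<longleftrightarrow>
        (\<forall>t::real. t > 0 \<longrightarrow> restricted_state B s (conv_exp P B \<Lambda> (\<lambda>b. t *\<^sub>R \<psi> b))))"
  show "schoenberg P"
    unfolding schoenberg_def
  proof (intro allI impI)
    fix B :: "('u, 'm) faced" and s \<Lambda> and \<psi> :: "'u \<Rightarrow> complex ^ 'd"
    assume B: "star_dual_semigroup B s \<Lambda> \<and> restricted_generating_functional B s \<psi>"
    then have "linear_map B \<psi>" by (simp add: restricted_generating_functional_def)
    \<comment> \<open>At t = 1 the correspondence speaks of \<psi> itself.\<close>
    with * B have "restricted_state B s (conv_exp P B \<Lambda> (\<lambda>b. (1::real) *\<^sub>R \<psi> b))"
      using zero_less_one by blast
    then show "restricted_state B s (conv_exp P B \<Lambda> \<psi>)" by simp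
  qed
qed

end
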